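(* Let $a$ satisfy the standing assumptions (i)-(iii) of the context, and let $u$ be the mild solution of the degenerate wave problem described in the context with initial data $(u_0,u_1)\in H^1_a(0,1)\times L^2(0,1)$. Then, for every $T\geqslant 0$, $$a(1)\int_0^T u_x^2(t,1)\,dt\;\geqslant\;\Big\{(2-\mu_a)T-\frac{4}{\min\{1,a(1)\}}-2\,\mu_a\sqrt{C_a}\Big\}E_u(0),$$ where $$C_a=\frac1{a(1)}\min\Big\{4,\frac1{2-\mu_a}\Big\}.$$
   Context: Standing assumptions on $a$: $a\in C([0,1])\cap C^1(]0,1])$ and (i) $a(x)>0$ for all $x\in]0,1]$, $a(0)=0$; (ii) $\mu_a:=\sup_{0<x\leqslant 1}\frac{x|a'(x)|}{a(x)}<2$; (iii) $a\in C^{[\mu_a]}([0,1])$, where $[\cdot]$ is the integer part (so $a\in C^1([0,1])$ if $\mu_a\in[1,2[$, no extra condition if $\mu_a\in[0,1[$). Spaces: $V^1_a(0,1)$ is the space of $u\in L^2(0,1)$ that are locally absolutely continuous in $]0,1]$ with $\sqrt a\,u'\in L^2(0,1)$, with norm $\|u\|_{1,a}=\{\int_0^1(a|u'|^2+|u|^2)dx\}^{1/2}$ (functions in $V^1_a(0,1)$ are continuous up to $x=0$ when $\mu_a\in[0,1[$). $H^1_a(0,1)$ is the closed subspace of those $u\in V^1_a(0,1)$ with $u(1)=0$ and, when $\mu_a\in[0,1[$, also $u(0)=0$. $V^2_a(0,1)=\{u\in V^1_a(0,1): au'\in H^1(0,1)\}$ and $H^2_a(0,1)=V^2_a(0,1)\cap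 H^1_a(0,1)$. Problem: $u_{tt}-(a(x)u_x)_x=0$ in $]0,\infty[\times]0,1[$, with $u(t,1)=0$, and $u(t,0)=0$ if $\mu_a\in[0,1[$, $\lim_{x\downarrow0}a(x)u_x(t,x)=0$ if $\mu_a\in[1,2[$, and $u(0,\cdot)=u_0$, $u_t(0,\cdot)=u_1$. Solutions: on the Hilbert space $H^1_a(0,1)\times L^2(0,1)$ with scalar product $\langle(u,v),(\tilde u,\tilde v)\rangle=\int_0^1(v\tilde v+au'\tilde u')dx$, the operator $A(u,v)=(v,(au')')$ with $D(A)=H^2_a(0,1)\times H^1_a(0,1)$ is maximal dissipative and generates a contraction semigroup $e^{tA}$. The mild solution $u\in C^1([0,\infty[;L^2(0,1))\cap C([0,\infty[;H^1_a(0,1))$ is the first component of $e^{tA}(u_0,u_1)$, its second component being $u_t$. If $(u_0,u_1)\in D(A)$ the solution is classical, with $u\in C^2([0,\infty[;L^2)\cap C^1([0,\infty[;H^1_a)\cap C([0,\infty[;H^2_a)$. For mild solutions, $u_x(\cdot,1)\in L^2(0,T)$ is defined as the $L^2(0,T)$-limit of $u^n_x(\cdot,1)$, where $u^n$ are classical solutions with data in $D(A)$ converging to $(u_0,u_1)$ in $H^1_a(0,1)\times L^2(0,1)$ (this limit exists and is independent of the approximation). Energy: $E_u(t)=\frac12\int_0^1\{u_t^2(t,x)+a(x)u_x^2(t,x)\}dx$. *)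

theory Defs
  imports "HOL-Analysis.Analysis"
begin

section \<open>Calculus on the unit interval\<close>

text \<open>Derivative relative to \<open>[0,1]\<close>: the ordinary derivative at interior points and the one-sided
  one at \<open>0\<close> and \<open>1\<close>. Values of functions outside \<open>[0,1]\<close> never matter.\<close>

definition dx :: "(real \<Rightarrow> real) \<Rightarrow> real \<Rightarrow> real" where
  "dx f x = vector_derivative f (at x within {0..1})"

fun Ck_on :: "nat \<Rightarrow> real set \<Rightarrow> (real \<Rightarrow> real) \<Rightarrow> bool" where
  "Ck_on 0 S f = continuous_on S f"
| "Ck_on (Suc k) S f =
    (\<exists>f'. (\<forall>x\<in>S. (f has_real_derivative f' x) (at x within S)) \<and> Ck_on k S f')"

text \<open>Absolute continuity on an interval: \<open>d\<close> ranges over the finite families of nonoverlapping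
  compact subintervals of \<open>S\<close>; the endpoints of \<open>k \<in> d\<close> are \<open>Inf k\<close> and \<open>Sup k\<close>.\<close>

definition abs_cont_on :: "real set \<Rightarrow> (real \<Rightarrow> real) \<Rightarrow> bool" where
  "abs_cont_on S f \<longleftrightarrow>
    (\<forall>\<epsilon>>0. \<exists>\<delta>>0. \<forall>d t. d division_of t \<and> t \<subseteq> S \<and> (\<Sum>k\<in>d. Sup k - Inf k) < \<delta>
       \<longrightarrow> (\<Sum>k\<in>d. \<bar>f (Sup k) - f (Inf k)\<bar>) < \<epsilon>)"

definition L2 :: "real set \<Rightarrow> (real \<Rightarrow> real) set" where
  "L2 I = {f \<in> borel_measurable (lebesgue_on I). integrable (lebesgue_on I) (\<lambda>x. (f x)\<^sup>2)}"

text \<open>The Sobolev space \<open>H\<^sup>1(0,1)\<close>: classes having an absolutely continuous representative on \<open>[0,1]\<close>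
  with square integrable derivative.\<close>

definition H1 :: "(real \<Rightarrow> real) set" where
  "H1 = {f. \<exists>g. abs_cont_on {0..1} g \<and> dx g \<in> L2 {0<..<1} \<and>
               (AE x in lebesgue_on {0<..<1}. f x = g x)}"


section \<open>The degenerate coefficient\<close>

definition mu :: "(real \<Rightarrow> real) \<Rightarrow> real" where
  "mu a = (SUP x\<in>{0<..1}. x * \<bar>dx a x\<bar> / a x)"

text \<open>The explicit boundedness is part of \<open>\<mu>\<^sub>a < 2\<close>, since the supremum of an unbounded set of reals is
  unspecified.\<close>

definition standing :: "(real \<Rightarrow> real) \<Rightarrow> bool" where
  "standing a \<longleftrightarrow>
     Ck_on 0 {0..1} a \<and> Ck_on 1 {0<..1} a \<and>
     (\<forall>x\<in>{0<..1}. a x > 0) \<and> a 0 = 0 \<and>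
     bdd_above ((\<lambda>x. x * \<bar>dx a x\<bar> / a x) ` {0<..1}) \<and> mu a < 2 \<and>
     Ck_on (nat \<lfloor>mu a\<rfloor>) {0..1} a"

definition C_const :: "(real \<Rightarrow> real) \<Rightarrow> real" where
  "C_const a = 1 / a 1 * min 4 (1 / (2 - mu a))"


section \<open>Weighted spaces\<close>

text \<open>Elements of the function spaces are represented by functions. An element of \<open>V1 a\<close> is given by
  its representative continuous on \<open>]0,1]\<close>.\<close>

definition V1 :: "(real \<Rightarrow> real) \<Rightarrow> (real \<Rightarrow> real) set" where
  "V1 a = {u \<in> L2 {0<..<1}. (\<forall>c\<in>{0<..1}. abs_cont_on {c..1} u) \<and>
                           (\<lambda>x. sqrt (a x) * dx u x) \<in> L2 {0<..<1}}"

text \<open>The boundary value at \<open>0\<close> is that of the continuous extension, i.e. the limit at \<open>0\<close>.\<close>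

definition H1a :: "(real \<Rightarrow> real) \<Rightarrow> (real \<Rightarrow> real) set" where
  "H1a a = {u \<in> V1 a. u 1 = 0 \<and> (mu a < 1 \<longrightarrow> (u \<longlongrightarrow> 0) (at_right 0))}"

definition V2 :: "(real \<Rightarrow> real) \<Rightarrow> (real \<Rightarrow> real) set" where
  "V2 a = {u \<in> V1 a. (\<lambda>x. a x * dx u x) \<in> H1}"

definition H2a :: "(real \<Rightarrow> real) \<Rightarrow> (real \<Rightarrow> real) set" where
  "H2a a = V2 a \<inter> H1a a"


section \<open>The semigroup\<close>

type_synonym state = "(real \<Rightarrow> real) \<times> (real \<Rightarrow> real)"

definition state_space :: "(real \<Rightarrow> real) \<Rightarrow> state set" where
  "state_space a = H1a a \<times> L2 {0<..<1}"

definition inner_state :: "(real \<Rightarrow> real) \<Rightarrow> state \<Rightarrow> state \<Rightarrow> real" where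
  "inner_state a p q =
     (LINT x|lebesgue_on {0<..<1}. snd p x * snd q x + a x * dx (fst p) x * dx (fst q) x)"

definition norm_state :: "(real \<Rightarrow> real) \<Rightarrow> state \<Rightarrow> real" where
  "norm_state a p = sqrt (inner_state a p p)"

definition lincomb :: "real \<Rightarrow> state \<Rightarrow> real \<Rightarrow> state \<Rightarrow> state" where
  "lincomb c p d q = (\<lambda>x. c * fst p x + d * fst q x, \<lambda>x. c * snd p x + d * snd q x)"

definition dist_state :: "(real \<Rightarrow> real) \<Rightarrow> state \<Rightarrow> state \<Rightarrow> real" where
  "dist_state a p q = norm_state a (lincomb 1 p (-1) q)"

text \<open>Equality in the Hilbert space \<open>H\<^sup>1\<^sub>a(0,1) \<times> L\<^sup>2(0,1)\<close>, whose elements are represented by members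
  of \<^term>\<open>state_space a\<close>.\<close>

definition eq_state :: "(real \<Rightarrow> real) \<Rightarrow> state \<Rightarrow> state \<Rightarrow> bool" where
  "eq_state a p q \<longleftrightarrow> dist_state a p q = 0"

definition dom_A :: "(real \<Rightarrow> real) \<Rightarrow> state set" where
  "dom_A a = H2a a \<times> H1a a"

definition op_A :: "(real \<Rightarrow> real) \<Rightarrow> state \<Rightarrow> state" where
  "op_A a p = (snd p, dx (\<lambda>x. a x * dx (fst p) x))"

definition contraction_semigroup :: "(real \<Rightarrow> real) \<Rightarrow> (real \<Rightarrow> state \<Rightarrow> state) \<Rightarrow> bool" where
  "contraction_semigroup a S \<longleftrightarrow>
     (\<forall>t\<ge>0. \<forall>p\<in>state_space a. S t p \<in> state_space a) \<and>
     (\<forall>t\<ge>0. \<forall>p\<in>state_space a. \<forall>q\<in>state_space a. \<forall>c d.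
        eq_state a (S t (lincomb c p d q)) (lincomb c (S t p) d (S t q))) \<and>
     (\<forall>p\<in>state_space a. eq_state a (S 0 p) p) \<and>
     (\<forall>s\<ge>0. \<forall>t\<ge>0. \<forall>p\<in>state_space a. eq_state a (S (s + t) p) (S s (S t p))) \<and>
     (\<forall>p\<in>state_space a. ((\<lambda>t. dist_state a (S t p) p) \<longlongrightarrow> 0) (at_right 0)) \<and>
     (\<forall>t\<ge>0. \<forall>p\<in>state_space a. norm_state a (S t p) \<le> norm_state a p)"

text \<open>The infinitesimal generator of \<open>S\<close> is \<open>A\<close> with domain \<open>D(A)\<close> (equality of graphs in the
  Hilbert space).\<close>

definition has_generator_A :: "(real \<Rightarrow> real) \<Rightarrow> (real \<Rightarrow> state \<Rightarrow> state) \<Rightarrow> bool" where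
  "has_generator_A a S \<longleftrightarrow>
     (\<forall>p\<in>state_space a. \<forall>q\<in>state_space a.
        ((\<lambda>t. dist_state a (lincomb (1 / t) (S t p) (- 1 / t) p) q) \<longlongrightarrow> 0) (at_right 0) \<longleftrightarrow>
        (\<exists>p'\<in>dom_A a. eq_state a p p' \<and> eq_state a q (op_A a p')))"


section \<open>Solutions\<close>

text \<open>\<open>(u t, ut t)\<close> is \<open>e\<^sup>t\<^sup>A p\<close>; the second component \<open>ut\<close> is the time derivative of \<open>u\<close>. The semigroup
  is determined by its generator, so the choice of \<open>S\<close> is immaterial.\<close>

definition mild_solution ::
  "(real \<Rightarrow> real) \<Rightarrow> state \<Rightarrow> (real \<Rightarrow> real \<Rightarrow> real) \<Rightarrow> (real \<Rightarrow> real \<Rightarrow> real) \<Rightarrow> bool" where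
  "mild_solution a p u ut \<longleftrightarrow>
     (\<exists>S. contraction_semigroup a S \<and> has_generator_A a S \<and>
        (\<forall>t\<ge>0. (u t, ut t) \<in> state_space a \<and> eq_state a (u t, ut t) (S t p)))"

definition energy ::
  "(real \<Rightarrow> real) \<Rightarrow> (real \<Rightarrow> real \<Rightarrow> real) \<Rightarrow> (real \<Rightarrow> real \<Rightarrow> real) \<Rightarrow> real \<Rightarrow> real" where
  "energy a u ut t =
     1 / 2 * (LINT x|lebesgue_on {0<..<1}. (ut t x)\<^sup>2 + a x * (dx (u t) x)\<^sup>2)"

text \<open>\<open>w\<close> is the trace \<open>u\<^sub>x(\<cdot>,1) \<in> L\<^sup>2(0,T)\<close> of the mild solution with initial state \<open>p\<close>: the
  \<open>L\<^sup>2(0,T)\<close>-limit of the traces of classical solutions whose data in \<open>D(A)\<close> converge to \<open>p\<close>.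
  The limit does not depend on the approximating sequence, so it is enough that one exists.\<close>

definition boundary_trace :: "(real \<Rightarrow> real) \<Rightarrow> real \<Rightarrow> state \<Rightarrow> (real \<Rightarrow> real) \<Rightarrow> bool" where
  "boundary_trace a T p w \<longleftrightarrow>
     w \<in> L2 {0<..<T} \<and>
     (\<exists>pn un utn.
        (\<forall>n::nat. pn n \<in> dom_A a \<and> mild_solution a (pn n) (un n) (utn n) \<and>
                 (\<lambda>t. dx (un n t) 1) \<in> L2 {0<..<T}) \<and>
        (\<lambda>n. dist_state a (pn n) p) \<longlonglongrightarrow> 0 \<and>
        (\<lambda>n. LINT t|lebesgue_on {0<..<T}. (dx (un n t) 1 - w t)\<^sup>2) \<longlonglongrightarrow> 0)"

end

theory Submission
  imports Defs
begin

text \<open>The proof is the multiplier method. For a classical solution with velocity \<open>v = u\<^sub>t\<close> let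
  \<open>M(t) = \<integral> (x u\<^sub>x + (\<mu>/4) u) v dx\<close>. Differentiating along the flow and integrating by parts in \<open>x\<close>
  gives \<open>M' \<le> a(1) u\<^sub>x(t,1)\<^sup>2 / 2 - (1 - \<mu>/2) E\<close>: the multiplier \<open>x u\<^sub>x\<close> produces the boundary term
  and \<open>\<integral> v\<^sup>2\<close> and \<open>\<integral> (a - x a') u\<^sub>x\<^sup>2\<close> with weight \<open>-1/2\<close>, the definition of \<open>\<mu>\<close> bounds \<open>x a'\<close> by \<open>\<mu> a\<close>,
  and the multiplier \<open>u\<close> redistributes kinetic and elastic energy so that both carry the same
  coefficient. Energy is conserved and \<open>\<bar>M\<bar> \<le> E (1/min {1, a(1)} + (\<mu>/2) \<surd>C)\<close> with \<open>C\<close> the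
  constant \<open>C_const\<close>, by \<open>a(x) \<ge> a(1) x\<^sup>2\<close> and a Hardy-Poincare inequality. Integrating over
  \<open>[0,T]\<close> proves the estimate for data in \<open>D(A)\<close> (\<open>classical_boundary_observability\<close>); both sides
  are continuous in the data, hence the estimate for mild solutions.

  The degenerate end point \<open>0\<close> is handled without computing any boundary limit there. In the
  integrations by parts against \<open>x u\<^sub>x\<close> the contributions at \<open>0\<close> have a favourable sign, so the
  one-sided \<open>integral_le_boundary_value\<close> suffices. The identity \<open>\<integral> u (a u\<^sub>x)\<^sub>x = - \<integral> a u\<^sub>x\<^sup>2\<close> is read off
  from contractivity: the generator is dissipative at \<open>(u,v)\<close> and at \<open>(u,-v)\<close>, which forces
  \<open>\<langle>A p, p\<rangle> = 0\<close> on \<open>D(A)\<close>, and \<open>v = u\<close> is an admissible velocity (\<open>op_A_skew_adjoint\<close>). The same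
  identity gives conservation of energy.

  Two ingredients make this rigorous. The first is the fundamental theorem of calculus for
  absolutely continuous functions, \<open>abs_cont_on_FTC\<close>: almost everywhere differentiability together
  with recovery of the function from its derivative. A monotone absolutely continuous function has
  a density by Radon-Nikodym, the total variation reduces the general case to the monotone one, and
  Henstock's lemma with a Vitali covering shows that an indefinite integral is differentiable
  almost everywhere. The second concerns the flow, about which only the semigroup laws and the
  generator are known: orbits starting in \<open>D(A)\<close> are Lipschitz and differentiable from the right,
  so every bounded bilinear form evaluated along such an orbit is a Lipschitz function of time whose
  right derivative is explicit (\<open>form_orbit_integral_bound\<close>). This is applied to the energy and to
  \<open>M\<close>.\<close>

section \<open>Total variation of absolutely continuous functions\<close>

definition nonoverlapping :: "'i set \<Rightarrow> ('i \<Rightarrow> real) \<Rightarrow> ('i \<Rightarrow> real) \<Rightarrow> bool" where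
  "nonoverlapping I l r \<longleftrightarrow> finite I \<and> (\<forall>i\<in>I. l i \<le> r i) \<and>
     pairwise (\<lambda>i j. {l i<..<r i} \<inter> {l j<..<r j} = {}) I"

text \<open>Indexed families of intervals are more flexible than divisions, since clamping their end points
  keeps the index set. A division has neither repeated nor overlapping members, so
  degenerate intervals are discarded; this is harmless for interval functions that vanish on them.\<close>

lemma nonoverlapping_division:
  fixes l r :: "'i \<Rightarrow> real"
  assumes "nonoverlapping I l r"
  obtains d where "d division_of \<Union>d" "\<And>k. k \<in> d \<Longrightarrow> \<exists>i\<in>I. k = {l i..r i}"
    "\<And>F::real \<Rightarrow> real \<Rightarrow> real. (\<And>x. F x x = 0) \<Longrightarrow> (\<Sum>i\<in>I. F (l i) (r i)) = (\<Sum>k\<in>d. F (Inf k) (Sup k))"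
proof
  define J where "J = {i\<in>I. l i < r i}"
  define K where "K = (\<lambda>i. {l i..r i})"
  have fin: "finite I" "finite J" and le: "\<And>i. i \<in> I \<Longrightarrow> l i \<le> r i"
    and disj: "\<And>i j. i \<in> I \<Longrightarrow> j \<in> I \<Longrightarrow> i \<noteq> j \<Longrightarrow> {l i<..<r i} \<inter> {l j<..<r j} = {}"
    using assms unfolding nonoverlapping_def pairwise_def J_def by auto
  have lr: "l i = l j \<and> r i = r j" if "i \<in> J" "j \<in> J" "K i = K j" for i j
    using that unfolding J_def K_def by (simp add: Icc_eq_Icc)
  have inj: "inj_on K J"
  proof (rule inj_onI, rule ccontr)
    fix i j assume *: "i \<in> J" "j \<in> J" "K i = K j" "i \<noteq> j"
    then have "{l i<..<r i} = {}" using lr[OF *(1-3)] disj[of i j] unfolding J_def by auto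
    then show False using *(1) unfolding J_def by auto
  qed
  show "K ` J division_of \<Union>(K ` J)"
    unfolding division_of_def
  proof (intro conjI ballI impI)
    show "finite (K ` J)" using fin by simp
    fix k assume k: "k \<in> K ` J"
    then show "k \<subseteq> \<Union>(K ` J)" "k \<noteq> {}" "\<exists>a b. k = cbox a b"
      unfolding J_def K_def by auto
    fix k' assume k': "k' \<in> K ` J" "k \<noteq> k'"
    obtain i j where ij: "i \<in> J" "k = K i" "j \<in> J" "k' = K j" using k k' by auto
    with k' have "i \<noteq> j" by auto
    then show "interior k \<inter> interior k' = {}"
      using disj[of i j] ij unfolding K_def J_def by (simp add: interior_atLeastAtMost_real)
  qed simp
  show "\<exists>i\<in>I. k = {l i..r i}" if "k \<in> K ` J" for k
    using that unfolding J_def K_def by auto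
  show "(\<Sum>i\<in>I. F (l i) (r i)) = (\<Sum>k\<in>K ` J. F (Inf k) (Sup k))"
    if F: "\<And>x. F x x = 0" for F :: "real \<Rightarrow> real \<Rightarrow> real"
  proof -
    have "(\<Sum>k\<in>K ` J. F (Inf k) (Sup k)) = (\<Sum>i\<in>J. F (l i) (r i))"
      unfolding sum.reindex[OF inj] by (rule sum.cong) (auto simp: J_def K_def)
    also have "\<dots> = (\<Sum>i\<in>I. F (l i) (r i))"
    proof (rule sum.mono_neutral_left)
      show "\<forall>i\<in>I - J. F (l i) (r i) = 0"
      proof
        fix i assume "i \<in> I - J"
        then have "l i = r i" using le[of i] unfolding J_def by auto
        then show "F (l i) (r i) = 0" using F by simp
      qed
    qed (use fin in \<open>auto simp: J_def\<close>)
    finally show ?thesis by simp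
  qed
qed

definition ac_modulus :: "real set \<Rightarrow> (real \<Rightarrow> real) \<Rightarrow> real \<Rightarrow> real \<Rightarrow> bool" where
  "ac_modulus S f \<epsilon> \<delta> \<longleftrightarrow> 0 < \<delta> \<and>
     (\<forall>d t. d division_of t \<and> t \<subseteq> S \<and> (\<Sum>k\<in>d. Sup k - Inf k) < \<delta>
       \<longrightarrow> (\<Sum>k\<in>d. \<bar>f (Sup k) - f (Inf k)\<bar>) < \<epsilon>)"

lemma abs_cont_on_modulus:
  "abs_cont_on S f \<longleftrightarrow> (\<forall>\<epsilon>>0. \<exists>\<delta>. ac_modulus S f \<epsilon> \<delta>)"
  unfolding abs_cont_on_def ac_modulus_def by auto

lemma ac_modulus_family:
  fixes l r :: "'i \<Rightarrow> real"
  assumes ac: "ac_modulus S f \<epsilon> \<delta>" and no: "nonoverlapping I l r"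
    and S: "\<And>i. i \<in> I \<Longrightarrow> {l i..r i} \<subseteq> S" and lt: "(\<Sum>i\<in>I. r i - l i) < \<delta>"
  shows "(\<Sum>i\<in>I. \<bar>f (r i) - f (l i)\<bar>) < \<epsilon>"
proof -
  obtain d where d: "d division_of \<Union>d" "\<And>k. k \<in> d \<Longrightarrow> \<exists>i\<in>I. k = {l i..r i}"
    and F: "\<And>F::real \<Rightarrow> real \<Rightarrow> real. (\<And>x. F x x = 0) \<Longrightarrow> (\<Sum>i\<in>I. F (l i) (r i)) = (\<Sum>k\<in>d. F (Inf k) (Sup k))"
    using nonoverlapping_division[OF no] by blast
  have "\<Union>d \<subseteq> S" using d(2) S by fastforce
  moreover have "(\<Sum>k\<in>d. Sup k - Inf k) < \<delta>" using F[of "\<lambda>x y. y - x"] lt by simp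
  ultimately have "(\<Sum>k\<in>d. \<bar>f (Sup k) - f (Inf k)\<bar>) < \<epsilon>"
    using ac d(1) unfolding ac_modulus_def by blast
  then show ?thesis using F[of "\<lambda>x y. \<bar>f y - f x\<bar>"] by simp
qed

lemma nonoverlapping_length:
  fixes l r :: "'i \<Rightarrow> real"
  assumes no: "nonoverlapping I l r" and S: "\<And>i. i \<in> I \<Longrightarrow> x \<le> l i \<and> r i \<le> y" and "x \<le> y"
  shows "(\<Sum>i\<in>I. r i - l i) \<le> y - x"
proof -
  obtain d where d: "d division_of \<Union>d" "\<And>k. k \<in> d \<Longrightarrow> \<exists>i\<in>I. k = {l i..r i}"
    and F: "\<And>F::real \<Rightarrow> real \<Rightarrow> real. (\<And>x. F x x = 0) \<Longrightarrow> (\<Sum>i\<in>I. F (l i) (r i)) = (\<Sum>k\<in>d. F (Inf k) (Sup k))"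
    using nonoverlapping_division[OF no] by blast
  have sub: "\<Union>d \<subseteq> cbox x y" using d(2) S by fastforce
  have "(\<Sum>i\<in>I. r i - l i) = (\<Sum>k\<in>d. Sup k - Inf k)" using F[of "\<lambda>x y. y - x"] by simp
  also have "\<dots> = sum (measure lborel) d"
  proof (rule sum.cong)
    fix k assume "k \<in> d"
    then obtain i where "i \<in> I" "k = {l i..r i}" using d(2) by blast
    moreover have "l i \<le> r i" using no \<open>i \<in> I\<close> unfolding nonoverlapping_def by auto
    ultimately show "Sup k - Inf k = measure lborel k" by simp
  qed simp
  also have "\<dots> \<le> measure lborel (cbox x y)" using subadditive_content_division[OF d(1) sub] .
  finally show ?thesis using \<open>x \<le> y\<close> by simp
qed

text \<open>Intervals outside \<open>[x,y]\<close> become degenerate, the others are truncated.\<close>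

lemma nonoverlapping_clamp:
  assumes "nonoverlapping I l r"
  shows "nonoverlapping I (\<lambda>i. max x (min y (l i))) (\<lambda>i. max x (min y (r i)))"
proof -
  have sub: "{max x (min y (l i))<..<max x (min y (r i))} \<subseteq> {l i<..<r i}" for i
    by (auto simp: max_def min_def split: if_splits)
  have "{max x (min y (l i))<..<max x (min y (r i))} \<inter> {max x (min y (l j))<..<max x (min y (r j))} = {}"
    if "{l i<..<r i} \<inter> {l j<..<r j} = {}" for i j
    using sub[of i] sub[of j] that by blast
  then show ?thesis
    using assms unfolding nonoverlapping_def pairwise_def
    by (auto intro: max.mono min.mono)
qed

text \<open>The members need not cover \<open>[a,x]\<close>. Appending one interval to a family is then immediate, which
  is what superadditivity of the variation uses.\<close>

definition families :: "real \<Rightarrow> real \<Rightarrow> (nat \<times> (nat \<Rightarrow> real) \<times> (nat \<Rightarrow> real)) set" where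
  "families a x = {(n, l, r). nonoverlapping {..<n} l r \<and> (\<forall>i<n. a \<le> l i \<and> r i \<le> x)}"

definition oscillation :: "(real \<Rightarrow> real) \<Rightarrow> nat \<times> (nat \<Rightarrow> real) \<times> (nat \<Rightarrow> real) \<Rightarrow> real" where
  "oscillation f = (\<lambda>(n, l, r). \<Sum>i<n. \<bar>f (r i) - f (l i)\<bar>)"

definition total_variation :: "(real \<Rightarrow> real) \<Rightarrow> real \<Rightarrow> real \<Rightarrow> real" where
  "total_variation f a x = (SUP P\<in>families a x. oscillation f P)"

lemma families_mono: "x \<le> y \<Longrightarrow> families a x \<subseteq> families a y"
  unfolding families_def by force

lemma families_empty: "(0, l, r) \<in> families a x"
  unfolding families_def nonoverlapping_def by auto

text \<open>Cut \<open>[a,b]\<close> into finitely many pieces shorter than the modulus belonging to \<open>\<epsilon> = 1\<close>. Each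
  member of a family is split by clamping it to the pieces, and the clamped family has oscillation
  at most \<open>1\<close> in every piece.\<close>

lemma bounded_oscillation:
  assumes ac: "abs_cont_on {a..b} f" and ab: "a \<le> b"
  shows "bdd_above (oscillation f ` families a b)"
proof -
  obtain \<delta> where \<delta>: "ac_modulus {a..b} f 1 \<delta>"
    using ac unfolding abs_cont_on_modulus by (meson zero_less_one)
  have "\<delta> > 0" using \<delta> unfolding ac_modulus_def by auto
  then obtain N :: nat where N: "(b - a) / \<delta> < real N" using reals_Archimedean2 by blast
  define N1 where "N1 = Suc N"
  define s where "s = (\<lambda>m::nat. a + real m * ((b - a) / real N1))"
  have "b - a < \<delta> * real N1" using N \<open>\<delta> > 0\<close> unfolding N1_def by (simp add: field_simps)
  then have step: "(b - a) / real N1 < \<delta>" unfolding N1_def by (simp add: divide_less_eq)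
  have s0: "s 0 = a" and sN: "s N1 = b" unfolding s_def N1_def by auto
  have sS: "s (Suc m) = s m + (b - a) / real N1" for m unfolding s_def by (simp add: distrib_right add_divide_distrib)
  have smono: "mono s" using ab by (auto simp: s_def mono_def intro!: divide_right_mono mult_right_mono)
  have bnd: "a \<le> s m" "m \<le> N1 \<Longrightarrow> s m \<le> b" for m
    using monoD[OF smono, of 0 m] monoD[OF smono, of m N1] s0 sN by auto
  have "oscillation f P \<le> real N1" if "P \<in> families a b" for P
  proof -
    obtain n l r where P: "P = (n, l, r)" by (cases P)
    have no: "nonoverlapping {..<n} l r" and lr: "\<And>i. i < n \<Longrightarrow> a \<le> l i \<and> r i \<le> b"
      and le: "\<And>i. i < n \<Longrightarrow> l i \<le> r i"
      using that unfolding P families_def nonoverlapping_def by auto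
    define c where "c = (\<lambda>m u. max (s m) (min (s (Suc m)) u))"
    \<comment> \<open>The pieces of \<open>[a,u]\<close> cut out by the grid telescope.\<close>
    have tele: "(\<Sum>m<M. f (c m u) - f (s m)) = f (min (s M) u) - f (s 0)" if "a \<le> u" for M u
    proof (induction M)
      case 0 then show ?case using s0 that by simp
    next
      case (Suc M)
      have "f (c M u) - f (s M) = f (min (s (Suc M)) u) - f (min (s M) u)"
        using monoD[OF smono, of M "Suc M"] unfolding c_def by (auto simp: max_def min_def)
      then show ?case using Suc by simp
    qed
    have tele': "(\<Sum>m<N1. f (c m u) - f (s m)) = f u - f (s 0)" if "a \<le> u" "u \<le> b" for u
      using tele[OF that(1), of N1] sN that by (simp add: min_def)
    have "\<bar>f (r i) - f (l i)\<bar> \<le> (\<Sum>m<N1. \<bar>f (c m (r i)) - f (c m (l i))\<bar>)" if "i < n" for i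
    proof -
      have "f (r i) - f (l i) = (\<Sum>m<N1. f (c m (r i)) - f (s m)) - (\<Sum>m<N1. f (c m (l i)) - f (s m))"
        using lr[OF that] le[OF that] by (simp add: tele')
      also have "\<dots> = (\<Sum>m<N1. f (c m (r i)) - f (c m (l i)))"
        by (simp add: sum_subtractf)
      finally show ?thesis by (simp add: sum_abs)
    qed
    then have "oscillation f P \<le> (\<Sum>i<n. \<Sum>m<N1. \<bar>f (c m (r i)) - f (c m (l i))\<bar>)"
      unfolding P oscillation_def by (auto intro: sum_mono)
    also have "\<dots> = (\<Sum>m<N1. \<Sum>i<n. \<bar>f (c m (r i)) - f (c m (l i))\<bar>)" by (rule sum.swap)
    also have "\<dots> \<le> (\<Sum>m<N1. 1)"
    proof (rule sum_mono)
      fix m assume m: "m \<in> {..<N1}"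
      have nc: "nonoverlapping {..<n} (\<lambda>i. c m (l i)) (\<lambda>i. c m (r i))"
        unfolding c_def by (rule nonoverlapping_clamp[OF no])
      have sm: "s m \<le> s (Suc m)" using monoD[OF smono, of m "Suc m"] by simp
      have cb: "s m \<le> c m u" "c m u \<le> s (Suc m)" for u using sm unfolding c_def by auto
      have "(\<Sum>i<n. c m (r i) - c m (l i)) \<le> s (Suc m) - s m"
        by (rule nonoverlapping_length[OF nc]) (use cb sm in auto)
      then have len: "(\<Sum>i<n. c m (r i) - c m (l i)) < \<delta>" using sS step by simp
      have "{c m (l i)..c m (r i)} \<subseteq> {a..b}" for i
        using cb(1)[of "l i"] cb(2)[of "r i"] bnd(1)[of m] bnd(2)[of "Suc m"] m by auto
      then show "(\<Sum>i<n. \<bar>f (c m (r i)) - f (c m (l i))\<bar>) \<le> 1"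
        using ac_modulus_family[OF \<delta> nc _ len] by fastforce
    qed
    finally show ?thesis by simp
  qed
  then show ?thesis by (auto intro!: bdd_aboveI)
qed

lemma total_variation_superadditive:
  assumes ac: "abs_cont_on {a..b} f" and "a \<le> x" "x \<le> y" "y \<le> b"
  shows "total_variation f a x + \<bar>f y - f x\<bar> \<le> total_variation f a y"
proof -
  have "abs_cont_on {a..b} f" "a \<le> b" using assms by auto
  note bdd = bounded_oscillation[OF this]
  have bddy: "bdd_above (oscillation f ` families a y)"
    using families_mono[OF \<open>y \<le> b\<close>] bdd by (meson bdd_above_mono image_mono)
  have "oscillation f P \<le> total_variation f a y - \<bar>f y - f x\<bar>" if PP: "P \<in> families a x" for P
  proof -
    obtain n l r where P: "P = (n, l, r)" by (cases P)
    define l' r' where "l' = l(n := x)" and "r' = r(n := y)"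
    have no: "nonoverlapping {..<n} l r" and lr: "\<And>i. i < n \<Longrightarrow> a \<le> l i \<and> r i \<le> x"
      using PP unfolding P families_def by auto
    have "nonoverlapping {..<Suc n} l' r'"
      using no lr \<open>x \<le> y\<close> unfolding nonoverlapping_def pairwise_def l'_def r'_def
      by (fastforce simp: less_Suc_eq)
    moreover have "\<forall>i<Suc n. a \<le> l' i \<and> r' i \<le> y"
      using lr assms unfolding l'_def r'_def by (auto simp: less_Suc_eq dest: order_trans)
    ultimately have "(Suc n, l', r') \<in> families a y" unfolding families_def by auto
    then have "oscillation f (Suc n, l', r') \<le> total_variation f a y"
      unfolding total_variation_def by (rule cSUP_upper[OF _ bddy])
    moreover have "oscillation f (Suc n, l', r') = oscillation f P + \<bar>f y - f x\<bar>"
      unfolding oscillation_def P l'_def r'_def by simp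
    ultimately show ?thesis by simp
  qed
  then have "total_variation f a x \<le> total_variation f a y - \<bar>f y - f x\<bar>"
    unfolding total_variation_def[of f a x] by (intro cSUP_least) (use families_empty[of _ _ a x] in auto)
  then show ?thesis by simp
qed

text \<open>Clamping to \<open>[a,x]\<close> and to \<open>[x,y]\<close> splits every member of a family at \<open>x\<close>, and the first half is
  one of the families competing for the variation on \<open>[a,x]\<close>.\<close>

lemma total_variation_increment:
  assumes ac: "abs_cont_on {a..b} f" and "a \<le> x" "x \<le> y" "y \<le> b" and P: "(n, l, r) \<in> families a y"
  defines "c \<equiv> \<lambda>u. max x (min y u)"
  shows "oscillation f (n, l, r) - total_variation f a x \<le> (\<Sum>i<n. \<bar>f (c (r i)) - f (c (l i))\<bar>)"
proof -
  have "abs_cont_on {a..b} f" "a \<le> b" using assms by auto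
  note bdd = bounded_oscillation[OF this]
  have bddx: "bdd_above (oscillation f ` families a x)"
    using families_mono[of x b] assms bdd by (meson bdd_above_mono image_mono order_trans)
  define c' where "c' = (\<lambda>u. max a (min x u))"
  have no: "nonoverlapping {..<n} l r" and lr: "\<And>i. i < n \<Longrightarrow> a \<le> l i \<and> r i \<le> y"
    and le: "\<And>i. i < n \<Longrightarrow> l i \<le> r i"
    using P unfolding families_def nonoverlapping_def by auto
  have "nonoverlapping {..<n} (\<lambda>i. c' (l i)) (\<lambda>i. c' (r i))"
    unfolding c'_def by (rule nonoverlapping_clamp[OF no])
  then have "(n, \<lambda>i. c' (l i), \<lambda>i. c' (r i)) \<in> families a x"
    unfolding families_def c'_def using \<open>a \<le> x\<close> by auto
  then have "oscillation f (n, \<lambda>i. c' (l i), \<lambda>i. c' (r i)) \<le> total_variation f a x"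
    unfolding total_variation_def by (rule cSUP_upper[OF _ bddx])
  moreover have "oscillation f (n, l, r) \<le> oscillation f (n, \<lambda>i. c' (l i), \<lambda>i. c' (r i))
      + (\<Sum>i<n. \<bar>f (c (r i)) - f (c (l i))\<bar>)"
    unfolding oscillation_def split_conv sum.distrib[symmetric]
  proof (rule sum_mono)
    fix i assume "i \<in> {..<n}"
    then have "a \<le> l i" "l i \<le> r i" "r i \<le> y" using lr le by auto
    then show "\<bar>f (r i) - f (l i)\<bar> \<le> \<bar>f (c' (r i)) - f (c' (l i))\<bar> + \<bar>f (c (r i)) - f (c (l i))\<bar>"
      using assms(2-4) unfolding c_def c'_def by (auto simp: max_def min_def)
  qed
  ultimately show ?thesis by simp
qed

text \<open>Over each interval of a short division choose a family that nearly realises the increment of the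
  variation there. All these families together are nonoverlapping and short, so the modulus of
  \<open>f\<close> controls their total oscillation.\<close>

lemma abs_cont_on_total_variation:
  assumes ac: "abs_cont_on {a..b} f"
  shows "abs_cont_on {a..b} (total_variation f a)"
  unfolding abs_cont_on_modulus
proof (intro allI impI)
  fix \<epsilon> :: real assume "\<epsilon> > 0"
  then obtain \<delta> where \<delta>: "ac_modulus {a..b} f (\<epsilon>/2) \<delta>"
    using ac unfolding abs_cont_on_modulus by (meson half_gt_zero)
  let ?h = "total_variation f a"
  have "(\<Sum>k\<in>d. \<bar>?h (Sup k) - ?h (Inf k)\<bar>) < \<epsilon>"
    if d: "d division_of t" and t: "t \<subseteq> {a..b}" and lt: "(\<Sum>k\<in>d. Sup k - Inf k) < \<delta>" for d t
  proof -
    have fin: "finite d" using d by auto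
    \<comment> \<open>The total loss over the division is below \<open>\<epsilon>/2\<close>.\<close>
    define \<eta> where "\<eta> = \<epsilon> / (2 * (real (card d) + 1))"
    have "\<eta> > 0" using \<open>\<epsilon> > 0\<close> unfolding \<eta>_def by auto
    have k: "Inf k \<le> Sup k \<and> a \<le> Inf k \<and> Sup k \<le> b \<and> interior k = {Inf k<..<Sup k}" if "k \<in> d" for k
    proof -
      obtain u v where uv: "k = cbox u v" "k \<noteq> {}" "k \<subseteq> t" using d \<open>k \<in> d\<close> by (metis division_ofD(2,3,4))
      then have "u \<le> v" by auto
      moreover have "cbox u v \<subseteq> {a..b}" using uv t by blast
      then have "a \<le> u" "v \<le> b" using \<open>u \<le> v\<close> by (simp_all add: atLeastatMost_subset_iff)
      ultimately show ?thesis using uv by (auto simp: interior_atLeastAtMost_real)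
    qed
    have disj: "{Inf k<..<Sup k} \<inter> {Inf k'<..<Sup k'} = {}" if "k \<in> d" "k' \<in> d" "k \<noteq> k'" for k k'
      using division_ofD(5)[OF d that] k that by simp
    have "\<exists>P. P \<in> families a (Sup k) \<and> ?h (Sup k) - \<eta> < oscillation f P" if "k \<in> d" for k
    proof -
      have "?h (Sup k) - \<eta> < ?h (Sup k)" using \<open>\<eta> > 0\<close> by simp
      then have "\<exists>P\<in>families a (Sup k). ?h (Sup k) - \<eta> < oscillation f P"
        unfolding total_variation_def
        by (subst (asm) less_cSUP_iff)
          (use families_empty[of _ _ a "Sup k"] k[OF that] bounded_oscillation[OF ac] families_mono[of "Sup k" b a]
            in \<open>auto intro!: bdd_above_mono[OF bounded_oscillation[OF ac]]\<close>)
      then show ?thesis by blast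
    qed
    then obtain P where P: "\<And>k. k \<in> d \<Longrightarrow> P k \<in> families a (Sup k)"
      "\<And>k. k \<in> d \<Longrightarrow> ?h (Sup k) - \<eta> < oscillation f (P k)" by metis
    define n l r where "n = (\<lambda>k. fst (P k))" and "l = (\<lambda>k. fst (snd (P k)))" and "r = (\<lambda>k. snd (snd (P k)))"
    have fam: "\<And>k. k \<in> d \<Longrightarrow> (n k, l k, r k) \<in> families a (Sup k)"
      and osc: "\<And>k. k \<in> d \<Longrightarrow> ?h (Sup k) - \<eta> < oscillation f (n k, l k, r k)"
      using P unfolding n_def l_def r_def by simp_all
    define c where "c = (\<lambda>k u. max (Inf k) (min (Sup k) (u::real)))"
    define I where "I = Sigma d (\<lambda>k. {..<n k})"
    define L where "L = (\<lambda>(k, i). c k (l k i))"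
    define R where "R = (\<lambda>(k, i). c k (r k i))"
    have nok: "nonoverlapping {..<n k} (\<lambda>i. c k (l k i)) (\<lambda>i. c k (r k i))" if "k \<in> d" for k
      unfolding c_def by (rule nonoverlapping_clamp) (use fam[OF that] in \<open>auto simp: families_def\<close>)
    have cb: "Inf k \<le> c k u" "c k u \<le> Sup k" if "k \<in> d" for k u using k[OF that] unfolding c_def by auto
    have no: "nonoverlapping I L R"
      unfolding nonoverlapping_def
    proof (intro conjI ballI)
      show "finite I" unfolding I_def using fin by auto
      show "L p \<le> R p" if "p \<in> I" for p
        using that nok unfolding I_def L_def R_def nonoverlapping_def by auto
      show "pairwise (\<lambda>i j. {L i<..<R i} \<inter> {L j<..<R j} = {}) I"
      proof (rule pairwiseI)
        fix p q assume pq: "p \<in> I" "q \<in> I" "p \<noteq> q"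
        obtain k i where p: "p = (k, i)" by (cases p)
        obtain k' j where q: "q = (k', j)" by (cases q)
        have kk: "k \<in> d" "k' \<in> d" "i < n k" "j < n k'" using pq p q unfolding I_def by auto
        show "{L p<..<R p} \<inter> {L q<..<R q} = {}"
        proof (cases "k = k'")
          case True
          then show ?thesis using nok[OF kk(1)] pq kk p q unfolding nonoverlapping_def pairwise_def L_def R_def by auto
        next
          case False
          have "{L p<..<R p} \<subseteq> {Inf k<..<Sup k}" "{L q<..<R q} \<subseteq> {Inf k'<..<Sup k'}"
            using cb(1)[OF kk(1), of "l k i"] cb(2)[OF kk(1), of "r k i"]
              cb(1)[OF kk(2), of "l k' j"] cb(2)[OF kk(2), of "r k' j"]
            unfolding p q L_def R_def by auto
          then show ?thesis using disj[OF kk(1,2) False] by blast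
        qed
      qed
    qed
    have "(\<Sum>p\<in>I. R p - L p) = (\<Sum>k\<in>d. \<Sum>i<n k. c k (r k i) - c k (l k i))"
      unfolding I_def L_def R_def using fin by (subst sum.Sigma) (auto simp: case_prod_beta)
    also have "\<dots> \<le> (\<Sum>k\<in>d. Sup k - Inf k)"
      by (rule sum_mono, rule nonoverlapping_length[OF nok]) (use cb k in auto)
    finally have "(\<Sum>p\<in>I. R p - L p) < \<delta>" using lt by simp
    moreover have "{L p..R p} \<subseteq> {a..b}" if "p \<in> I" for p
    proof -
      obtain k i where p: "p = (k, i)" by (cases p)
      then have "k \<in> d" using that unfolding I_def by auto
      then show ?thesis using k[OF \<open>k \<in> d\<close>] cb(1)[OF \<open>k \<in> d\<close>, of "l k i"] cb(2)[OF \<open>k \<in> d\<close>, of "r k i"]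
        unfolding p L_def R_def by auto
    qed
    ultimately have "(\<Sum>p\<in>I. \<bar>f (R p) - f (L p)\<bar>) < \<epsilon>/2"
      by (intro ac_modulus_family[OF \<delta> no])
    moreover have "(\<Sum>p\<in>I. \<bar>f (R p) - f (L p)\<bar>) = (\<Sum>k\<in>d. \<Sum>i<n k. \<bar>f (c k (r k i)) - f (c k (l k i))\<bar>)"
      unfolding I_def L_def R_def using fin by (subst sum.Sigma) (auto simp: case_prod_beta)
    ultimately have small: "(\<Sum>k\<in>d. \<Sum>i<n k. \<bar>f (c k (r k i)) - f (c k (l k i))\<bar>) < \<epsilon>/2" by simp
    have "(\<Sum>k\<in>d. \<bar>?h (Sup k) - ?h (Inf k)\<bar>) \<le> (\<Sum>k\<in>d. \<eta> + (\<Sum>i<n k. \<bar>f (c k (r k i)) - f (c k (l k i))\<bar>))"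
    proof (rule sum_mono)
      fix j assume j: "j \<in> d"
      have "0 \<le> ?h (Sup j) - ?h (Inf j)"
        using total_variation_superadditive[OF ac, of "Inf j" "Sup j"] k[OF j] by simp
      moreover have "?h (Sup j) - ?h (Inf j) \<le> \<eta> + (\<Sum>i<n j. \<bar>f (c j (r j i)) - f (c j (l j i))\<bar>)"
        using total_variation_increment[OF ac, of "Inf j" "Sup j", OF _ _ _ fam[OF j]] k[OF j] osc[OF j]
        unfolding c_def by linarith
      ultimately show "\<bar>?h (Sup j) - ?h (Inf j)\<bar> \<le> \<eta> + (\<Sum>i<n j. \<bar>f (c j (r j i)) - f (c j (l j i))\<bar>)" by simp
    qed
    also have "\<dots> < real (card d) * \<eta> + \<epsilon>/2" using small by (simp add: sum.distrib)
    also have "\<dots> \<le> \<epsilon>"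
      unfolding \<eta>_def using \<open>\<epsilon> > 0\<close> by (simp add: field_simps)
    finally show ?thesis .
  qed
  then show "\<exists>\<delta>. ac_modulus {a..b} ?h \<epsilon> \<delta>"
    using \<delta> unfolding ac_modulus_def by blast
qed

section \<open>The fundamental theorem of calculus for absolutely continuous functions\<close>

lemma abs_cont_on_subset: "abs_cont_on S f \<Longrightarrow> T \<subseteq> S \<Longrightarrow> abs_cont_on T f"
  unfolding abs_cont_on_modulus ac_modulus_def by (meson order_trans)

lemma abs_cont_on_imp_continuous_on:
  assumes "abs_cont_on {a..b} f"
  shows "continuous_on {a..b} f"
  unfolding continuous_on_iff
proof (intro ballI allI impI)
  fix x e assume x: "x \<in> {a..b}" and "(e::real) > 0"
  then obtain \<delta> where \<delta>: "ac_modulus {a..b} f e \<delta>"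
    using assms unfolding abs_cont_on_modulus by blast
  have "dist (f y) (f x) < e" if "y \<in> {a..b}" "dist y x < \<delta>" for y
  proof -
    have "(\<Sum>i\<in>{()}. \<bar>f (max x y) - f (min x y)\<bar>) < e"
      by (rule ac_modulus_family[OF \<delta>])
        (use that x in \<open>auto simp: nonoverlapping_def dist_real_def\<close>)
    then show ?thesis by (auto simp: dist_real_def max_def min_def split: if_splits)
  qed
  then show "\<exists>d>0. \<forall>y\<in>{a..b}. dist y x < d \<longrightarrow> dist (f y) (f x) < e"
    using \<delta> unfolding ac_modulus_def by blast
qed

text \<open>Linear combinations, products and Lipschitz functions are all instances.\<close>

lemma abs_cont_on_dominated:
  assumes f: "abs_cont_on {a..b} f" and g: "abs_cont_on {a..b} g" and M: "M \<ge> 0"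
    and le: "\<And>x y. a \<le> x \<Longrightarrow> x \<le> y \<Longrightarrow> y \<le> b \<Longrightarrow> \<bar>h y - h x\<bar> \<le> M * (\<bar>f y - f x\<bar> + \<bar>g y - g x\<bar>)"
  shows "abs_cont_on {a..b} h"
  unfolding abs_cont_on_modulus
proof (intro allI impI)
  fix \<epsilon> :: real assume "\<epsilon> > 0"
  then have e: "\<epsilon> / (2 * (M + 1)) > 0" using M by auto
  obtain \<delta>1 where 1: "ac_modulus {a..b} f (\<epsilon> / (2 * (M + 1))) \<delta>1"
    using f e unfolding abs_cont_on_modulus by blast
  obtain \<delta>2 where 2: "ac_modulus {a..b} g (\<epsilon> / (2 * (M + 1))) \<delta>2"
    using g e unfolding abs_cont_on_modulus by blast
  have "(\<Sum>k\<in>d. \<bar>h (Sup k) - h (Inf k)\<bar>) < \<epsilon>"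
    if d: "d division_of t" and t: "t \<subseteq> {a..b}" and lt: "(\<Sum>k\<in>d. Sup k - Inf k) < min \<delta>1 \<delta>2" for d t
  proof -
    have k: "a \<le> Inf k \<and> Inf k \<le> Sup k \<and> Sup k \<le> b" if "k \<in> d" for k
    proof -
      obtain u v where uv: "k = cbox u v" "k \<noteq> {}" "k \<subseteq> t" using d \<open>k \<in> d\<close> by (metis division_ofD(2,3,4))
      then have "u \<le> v" by auto
      moreover have "cbox u v \<subseteq> {a..b}" using uv t by blast
      then have "a \<le> u" "v \<le> b" using \<open>u \<le> v\<close> by (simp_all add: atLeastatMost_subset_iff)
      ultimately show ?thesis using uv by auto
    qed
    have F: "(\<Sum>k\<in>d. \<bar>f (Sup k) - f (Inf k)\<bar>) < \<epsilon> / (2 * (M + 1))"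
      and G: "(\<Sum>k\<in>d. \<bar>g (Sup k) - g (Inf k)\<bar>) < \<epsilon> / (2 * (M + 1))"
      using 1 2 d t lt unfolding ac_modulus_def by auto
    have "(\<Sum>k\<in>d. \<bar>h (Sup k) - h (Inf k)\<bar>) \<le> (\<Sum>k\<in>d. M * (\<bar>f (Sup k) - f (Inf k)\<bar> + \<bar>g (Sup k) - g (Inf k)\<bar>))"
      by (rule sum_mono) (use le k in auto)
    also have "\<dots> = M * ((\<Sum>k\<in>d. \<bar>f (Sup k) - f (Inf k)\<bar>) + (\<Sum>k\<in>d. \<bar>g (Sup k) - g (Inf k)\<bar>))"
      by (simp add: sum_distrib_left sum.distrib distrib_left)
    also have "\<dots> \<le> M * (\<epsilon> / (2 * (M + 1)) + \<epsilon> / (2 * (M + 1)))"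
      using F G M by (intro mult_left_mono) auto
    also have "\<dots> = M * (\<epsilon> / (M + 1))"
      by (metis (no_types) field_sum_of_halves divide_divide_eq_left mult.commute)
    also have "\<dots> < \<epsilon>" using M \<open>\<epsilon> > 0\<close> by (simp add: divide_less_eq algebra_simps)
    finally show ?thesis .
  qed
  then show "\<exists>\<delta>. ac_modulus {a..b} h \<epsilon> \<delta>"
    using 1 2 unfolding ac_modulus_def by (intro exI[of _ "min \<delta>1 \<delta>2"]) auto
qed

text \<open>Finite unions of compact intervals exhaust \<open>G\<close>, and for those the claim is absolute continuity
  itself. The function \<open>F\<close> extends \<open>h\<close> by constants because Stieltjes measures live on the line.\<close>

lemma interval_measure_open_small:
  assumes ac: "ac_modulus {a..b} h \<epsilon> \<delta>" and ab: "a \<le> b"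
    and F: "F = (\<lambda>t. h (max a (min b t)))" "mono F" "continuous_on UNIV F"
    and G: "open G" "emeasure lborel G < ennreal \<delta>"
  shows "emeasure (interval_measure F) G \<le> ennreal \<epsilon>"
proof -
  let ?N = "interval_measure F"
  have Icc: "emeasure ?N {x..y} = ennreal (F y - F x)" if "x \<le> y" for x y
    using emeasure_interval_measure_Icc[OF that _ F(3)] monoD[OF F(2)] by auto
  obtain D where D: "countable D" "D \<subseteq> Pow G" "\<And>X. X \<in> D \<Longrightarrow> \<exists>a b. X = cbox a b" "\<Union>D = G"
    using open_countable_Union_open_cbox[OF G(1)] by metis
  have fm: "X \<in> fmeasurable ?N" if "X \<in> D" for X
  proof -
    obtain x y where X: "X = {x..y}" using D(3)[OF \<open>X \<in> D\<close>] by auto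
    show ?thesis
    proof (cases "x \<le> y")
      case True then show ?thesis unfolding X fmeasurable_def by (simp add: Icc)
    next
      case False then show ?thesis unfolding X by simp
    qed
  qed
  have bound: "measure ?N (\<Union>X\<in>D'. X) \<le> \<epsilon>" if D': "D' \<subseteq> D" "finite D'" for D'
  proof -
    obtain d where d: "d division_of \<Union>D'"
      using elementary_unions_intervals[OF D'(2)] D(3) D'(1) by (metis subset_iff)
    have fin: "finite d" using d by auto
    have kk: "Inf k \<le> Sup k \<and> interior k = {Inf k<..<Sup k} \<and> k = {Inf k..Sup k}" if "k \<in> d" for k
    proof -
      obtain u v where uv: "k = cbox u v" "k \<noteq> {}" using d \<open>k \<in> d\<close> by (metis division_ofD(3,4))
      then have "u \<le> v" by auto
      then show ?thesis using uv by (auto simp: interior_atLeastAtMost_real)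
    qed
    have k: "Inf k \<le> Sup k \<and> interior k = {Inf k<..<Sup k}" if "k \<in> d" for k
      using kk[OF that] by blast
    have kI: "k = {Inf k..Sup k}" if "k \<in> d" for k using kk[OF that] by blast
    have disj: "{Inf k<..<Sup k} \<inter> {Inf k'<..<Sup k'} = {}" if "k \<in> d" "k' \<in> d" "k \<noteq> k'" for k k'
      using division_ofD(5)[OF d that] k that by simp
    have no: "nonoverlapping d Inf Sup"
      unfolding nonoverlapping_def pairwise_def using fin k disj by auto
    \<comment> \<open>The open interiors are disjoint, so their lengths add up to at most the measure of \<open>G\<close>.\<close>
    have "ennreal (\<Sum>k\<in>d. Sup k - Inf k) = (\<Sum>k\<in>d. emeasure lborel {Inf k<..<Sup k})"
      by (subst sum_ennreal[symmetric]) (use k in auto)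
    also have "\<dots> = emeasure lborel (\<Union>k\<in>d. {Inf k<..<Sup k})"
      by (rule sum_emeasure) (use fin disj in \<open>auto simp: disjoint_family_on_def\<close>)
    also have "\<dots> \<le> emeasure lborel G"
    proof (rule emeasure_mono)
      have "\<Union>d \<subseteq> G" using division_ofD(6)[OF d] Union_mono[OF D'(1)] D(4) by simp
      moreover have "{Inf k<..<Sup k} \<subseteq> k" if "k \<in> d" for k
        using k[OF that] interior_subset[of k] by simp
      ultimately show "(\<Union>k\<in>d. {Inf k<..<Sup k}) \<subseteq> G" by blast
    qed (use G in auto)
    also have "\<dots> < ennreal \<delta>" by fact
    finally have len: "(\<Sum>k\<in>d. Sup k - Inf k) < \<delta>"
      using k by (subst (asm) ennreal_less_iff) (auto intro: sum_nonneg)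
    let ?c = "\<lambda>t. max a (min b t)"
    have "(\<Sum>k\<in>d. \<bar>h (?c (Sup k)) - h (?c (Inf k))\<bar>) < \<epsilon>"
    proof (rule ac_modulus_family[OF ac nonoverlapping_clamp[OF no]])
      show "(\<Sum>k\<in>d. ?c (Sup k) - ?c (Inf k)) < \<delta>"
      proof (rule order_le_less_trans[OF _ len], rule sum_mono)
        fix k assume "k \<in> d"
        then show "?c (Sup k) - ?c (Inf k) \<le> Sup k - Inf k"
          using k[of k] by (auto simp: max_def min_def)
      qed
    qed (use ab in auto)
    moreover have "measure ?N (\<Union>d) \<le> (\<Sum>k\<in>d. measure ?N k)"
      by (rule measure_Union_le[OF fin]) (metis kI borel_closed closed_atLeastAtMost sets_interval_measure)
    moreover have "measure ?N k = \<bar>h (?c (Sup k)) - h (?c (Inf k))\<bar>" if "k \<in> d" for k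
    proof -
      have "measure ?N {Inf k..Sup k} = F (Sup k) - F (Inf k)"
        using Icc[of "Inf k" "Sup k"] k[OF that] monoD[OF F(2), of "Inf k" "Sup k"]
        unfolding measure_def by simp
      moreover have "measure ?N k = measure ?N {Inf k..Sup k}" by (rule arg_cong[OF kI[OF that]])
      ultimately show ?thesis using k[OF that] monoD[OF F(2), of "Inf k" "Sup k"] unfolding F(1) by simp
    qed
    moreover have "\<Union>d = (\<Union>X\<in>D'. X)" using division_ofD(6)[OF d] by simp
    ultimately show ?thesis by simp
  qed
  have "(\<Union>X\<in>D. X) \<in> fmeasurable ?N" "measure ?N (\<Union>X\<in>D. X) \<le> \<epsilon>"
    using fmeasurable_UN_bound[OF D(1) fm bound] measure_UN_bound[OF D(1) fm bound] by auto
  moreover have "(\<Union>X\<in>D. X) = G" using D(4) by auto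
  ultimately show ?thesis by (simp add: emeasure_eq_measure2 ennreal_leI)
qed

text \<open>Null sets lie in open sets of small measure, so the Stieltjes measure of \<open>h\<close> is absolutely
  continuous with respect to Lebesgue measure and Radon-Nikodym supplies the density.\<close>

lemma monotone_abs_cont_density:
  assumes ac: "abs_cont_on {a..b} h" and ab: "a \<le> b"
    and mono: "\<And>x y. a \<le> x \<Longrightarrow> x \<le> y \<Longrightarrow> y \<le> b \<Longrightarrow> h x \<le> h y"
  obtains g where "g absolutely_integrable_on {a..b}"
    "\<And>x. a \<le> x \<Longrightarrow> x \<le> b \<Longrightarrow> (g has_integral h x - h a) {a..x}"
proof -
  define F where "F = (\<lambda>t. h (max a (min b t)))"
  have monoF: "mono F" unfolding F_def by (rule monoI, rule mono) (use ab in auto)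
  have contF: "continuous_on UNIV F"
    unfolding F_def
    by (rule continuous_on_compose2[OF abs_cont_on_imp_continuous_on[OF ac]])
      (use ab in \<open>auto intro!: continuous_intros\<close>)
  let ?N = "interval_measure F"
  have Icc: "emeasure ?N {x..y} = ennreal (F y - F x)" if "x \<le> y" for x y
    using emeasure_interval_measure_Icc[OF that _ contF] monoD[OF monoF] by auto
  have "absolutely_continuous lborel ?N"
    unfolding absolutely_continuous_def
  proof
    fix A :: "real set" assume A: "A \<in> null_sets lborel"
    have "emeasure ?N A \<le> ennreal \<epsilon>" if "\<epsilon> > 0" for \<epsilon>
    proof -
      obtain \<delta> where \<delta>: "ac_modulus {a..b} h \<epsilon> \<delta>"
        using ac \<open>\<epsilon> > 0\<close> unfolding abs_cont_on_modulus by blast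
      have "\<delta> > 0" using \<delta> unfolding ac_modulus_def by auto
      have A': "A \<in> sets lebesgue" "A \<in> null_sets lebesgue" using A by (auto intro: null_sets_completionI)
      obtain G where G: "open G" "A \<subseteq> G" "emeasure lebesgue (G - A) < ennreal \<delta>"
        using sets_lebesgue_outer_open[OF A'(1) \<open>\<delta> > 0\<close>] by metis
      have "emeasure lebesgue (G - A) = emeasure lebesgue G"
        using A' G(1) by (intro emeasure_Diff_null_set) auto
      then have "emeasure lborel G < ennreal \<delta>" using G by simp
      then have "emeasure ?N G \<le> ennreal \<epsilon>"
        by (intro interval_measure_open_small[OF \<delta> ab F_def monoF contF G(1)])
      moreover have "emeasure ?N A \<le> emeasure ?N G"
        using G by (intro emeasure_mono) auto
      ultimately show ?thesis by simp
    qed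
    then have "emeasure ?N A \<le> 0 + ennreal \<epsilon>" if "\<epsilon> > 0" for \<epsilon>
      using that by simp
    then have "emeasure ?N A \<le> 0" using ennreal_le_epsilon[of 0 "emeasure ?N A"] by blast
    then show "A \<in> null_sets ?N" using A by (auto simp: null_sets_def)
  qed
  then obtain f where f: "f \<in> borel_measurable lborel" "density lborel f = ?N"
    using sigma_finite_measure.Radon_Nikodym[OF sigma_finite_lborel, of ?N] by auto
  have f'[measurable]: "f \<in> borel_measurable borel" using f by simp
  have fI: "(\<integral>\<^sup>+t. f t * indicator {x..y} t \<partial>lborel) = ennreal (F y - F x)" if "x \<le> y" for x y
    using emeasure_density[of f lborel "{x..y}"] f Icc[OF that] by simp
  have "AE x in lborel. f x * indicator {a..b} x \<noteq> \<infinity>"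
    by (rule nn_integral_PInf_AE) (use fI[OF ab] in auto)
  \<comment> \<open>The density is finite almost everywhere on \<open>[a,b]\<close>; where it is not, \<open>enn2real\<close> returns \<open>0\<close>.\<close>
  define g where "g = (\<lambda>x. enn2real (f x * indicator {a..b} x))"
  have gb: "g \<in> borel_measurable borel" unfolding g_def by measurable
  have gI: "(g has_integral h x - h a) {a..x}" if x: "a \<le> x" "x \<le> b" for x
  proof -
    have "((\<lambda>t. g t * indicator {a..x} t) has_integral h x - h a) UNIV"
    proof (rule nn_integral_has_integral)
      show "(\<lambda>t. g t * indicator {a..x} t) \<in> borel_measurable borel" using gb by measurable
      show "0 \<le> g t * indicator {a..x} t" for t unfolding g_def by auto
      have "(\<integral>\<^sup>+t. ennreal (g t * indicator {a..x} t) \<partial>lborel) = (\<integral>\<^sup>+t. f t * indicator {a..x} t \<partial>lborel)"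
      proof (rule nn_integral_cong_AE)
        show "AE t in lborel. ennreal (g t * indicator {a..x} t) = f t * indicator {a..x} t"
          using \<open>AE x in lborel. f x * indicator {a..b} x \<noteq> \<infinity>\<close>
        proof eventually_elim
          case (elim t)
          then show ?case using x unfolding g_def
            by (auto simp: indicator_def less_top split: if_splits)
        qed
      qed
      also have "\<dots> = ennreal (h x - h a)" using fI[OF x(1)] x ab unfolding F_def by simp
      finally show "(\<integral>\<^sup>+t. ennreal (g t * indicator {a..x} t) \<partial>lborel) = ennreal (h x - h a)" .
      show "0 \<le> h x - h a" using mono x by simp
    qed
    moreover have "(\<lambda>t. g t * indicator {a..x} t) = (\<lambda>t. if t \<in> {a..x} then g t else 0)"
      by (auto simp: indicator_def)
    ultimately show ?thesis by (simp only: has_integral_restrict_UNIV)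
  qed
  moreover have "g absolutely_integrable_on {a..b}"
    by (rule nonnegative_absolutely_integrable_1) (use gI[OF ab] in \<open>auto simp: g_def\<close>)
  ultimately show thesis using that by blast
qed

text \<open>With \<open>h\<close> the total variation, both \<open>h\<close> and \<open>f + h\<close> are monotone.\<close>

lemma abs_cont_density:
  assumes ac: "abs_cont_on {a..b} f" and ab: "a \<le> b"
  obtains g where "g absolutely_integrable_on {a..b}"
    "\<And>x. a \<le> x \<Longrightarrow> x \<le> b \<Longrightarrow> (g has_integral f x - f a) {a..x}"
proof -
  let ?h = "total_variation f a"
  have sup: "\<bar>f y - f x\<bar> \<le> ?h y - ?h x" if "a \<le> x" "x \<le> y" "y \<le> b" for x y
    using total_variation_superadditive[OF ac that] by simp
  have ach: "abs_cont_on {a..b} ?h" by (rule abs_cont_on_total_variation[OF ac])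
  have ach': "abs_cont_on {a..b} (\<lambda>x. f x + ?h x)"
    by (rule abs_cont_on_dominated[OF ac ach, of 1]) auto
  have m1: "f x + ?h x \<le> f y + ?h y" and m2: "?h x \<le> ?h y" if "a \<le> x" "x \<le> y" "y \<le> b" for x y
    using sup[OF that] by linarith+
  obtain g1 where g1: "g1 absolutely_integrable_on {a..b}"
    "\<And>x. a \<le> x \<Longrightarrow> x \<le> b \<Longrightarrow> (g1 has_integral (f x + ?h x) - (f a + ?h a)) {a..x}"
    using monotone_abs_cont_density[OF ach' ab m1] by blast
  obtain g2 where g2: "g2 absolutely_integrable_on {a..b}"
    "\<And>x. a \<le> x \<Longrightarrow> x \<le> b \<Longrightarrow> (g2 has_integral ?h x - ?h a) {a..x}"
    using monotone_abs_cont_density[OF ach ab m2] by blast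
  show thesis
  proof (rule that)
    show "(\<lambda>x. g1 x - g2 x) absolutely_integrable_on {a..b}"
      using g1(1) g2(1) by (rule set_integral_diff)
    fix x assume x: "a \<le> x" "x \<le> b"
    show "((\<lambda>x. g1 x - g2 x) has_integral f x - f a) {a..x}"
      using has_integral_diff[OF g1(2)[OF x] g2(2)[OF x]] by (simp add: algebra_simps)
  qed
qed

text \<open>At a bad point arbitrarily short intervals \<open>[u,v]\<close> around \<open>x\<close> have
  \<open>\<bar>F v - F u - g x (v - u)\<bar> > (v - u)/(k + 1)\<close>. Vitali's theorem covers almost all bad points by
  disjoint such intervals, fine for the gauge of Henstock's lemma; the lemma makes the sum of the
  errors small, hence also the sum of the lengths.\<close>

lemma indefinite_integral_differentiable_ae:
  fixes g :: "real \<Rightarrow> real"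
  assumes g: "g integrable_on {a..b}"
  defines "F \<equiv> \<lambda>x. integral {a..x} g"
  obtains N where "negligible N" "\<And>x. x \<in> {a<..<b} - N \<Longrightarrow> (F has_real_derivative g x) (at x)"
proof -
  define good where "good = (\<lambda>k x u v. \<bar>F v - F u - g x * (v - u)\<bar> \<le> (v - u) / real (Suc k))"
  define Bad where "Bad = (\<lambda>k. {x\<in>{a<..<b}. \<forall>d>0. \<exists>u v. a \<le> u \<and> u \<le> x \<and> x \<le> v \<and> v \<le> b \<and> u < v \<and> v - u < d \<and> \<not> good k x u v})"
  have incr: "integral {u..v} g = F v - F u" if "a \<le> u" "u \<le> v" "v \<le> b" for u v
  proof -
    have "integral {a..u} g + integral {u..v} g = integral {a..v} g"
      by (rule Henstock_Kurzweil_Integration.integral_combine)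
        (use that g in \<open>auto intro: integrable_on_subinterval\<close>)
    then show ?thesis unfolding F_def by simp
  qed
  have neg: "negligible (Bad k)" for k
    unfolding negligible_outer_le
  proof (intro allI impI)
    fix e :: real assume "e > 0"
    then have e': "e / real (Suc k) > 0" by simp
    have gi: "g integrable_on cbox a b" using g by simp
    obtain \<gamma> where \<gamma>: "gauge \<gamma>"
      and hen: "\<And>p. p tagged_partial_division_of (cbox a b) \<Longrightarrow> \<gamma> fine p \<Longrightarrow>
             sum (\<lambda>(x,k). norm(measure lborel k *\<^sub>R g x - integral k g)) p < e / real (Suc k)"
      using Henstock_lemma[OF gi e'] by blast
    define K where "K = {(x,u,v). a \<le> u \<and> u \<le> x \<and> x \<le> v \<and> v \<le> b \<and> u < v \<and> {u..v} \<subseteq> \<gamma> x \<and> \<not> good k x u v}"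
    \<comment> \<open>Intervals are balls on the line; the tag \<open>x\<close> need not be the centre.\<close>
    define cen rad where "cen = (\<lambda>(x::real,u,v). (u + v) / 2 :: real)" and "rad = (\<lambda>(x::real,u,v). (v - u) / 2 :: real)"
    have cb: "cball (cen (x,u,v)) (rad (x,u,v)) = {u..v}" for x u v
      unfolding cen_def rad_def by (simp add: cball_eq_atLeastAtMost field_simps)
    obtain C where C: "countable C" "C \<subseteq> K"
      "pairwise (\<lambda>i j. disjnt (cball (cen i) (rad i)) (cball (cen j) (rad j))) C"
      "negligible (Bad k - (\<Union>i\<in>C. cball (cen i) (rad i)))"
    proof (rule Vitali_covering_theorem_cballs[of K rad "Bad k" cen])
      show "0 < rad i" if "i \<in> K" for i using that unfolding K_def rad_def by auto
      fix x d :: real assume x: "x \<in> Bad k" and "0 < d"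
      have "open (\<gamma> x)" "x \<in> \<gamma> x" using \<gamma> by (auto dest: gaugeD)
      then obtain \<rho> where \<rho>: "\<rho> > 0" "ball x \<rho> \<subseteq> \<gamma> x" by (meson openE)
      then have "min \<rho> d > 0" using \<open>0 < d\<close> by simp
      then obtain u v where uv: "a \<le> u" "u \<le> x" "x \<le> v" "v \<le> b" "u < v" "v - u < min \<rho> d" "\<not> good k x u v"
        using x unfolding Bad_def by blast
      have "{u..v} \<subseteq> ball x \<rho>" using uv by (auto simp: dist_real_def)
      then have "(x, u, v) \<in> K" using uv \<rho> unfolding K_def by auto
      moreover have "x \<in> cball (cen (x,u,v)) (rad (x,u,v))" unfolding cb using uv by auto
      moreover have "rad (x, u, v) < d" using uv unfolding rad_def by auto
      ultimately show "\<exists>i. i \<in> K \<and> x \<in> cball (cen i) (rad i) \<and> rad i < d" by blast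
    qed
    have bound: "measure lebesgue (\<Union>i\<in>C'. cball (cen i) (rad i)) \<le> e" if C': "C' \<subseteq> C" "finite C'" for C'
    proof -
      define \<phi> where "\<phi> = (\<lambda>(x::real,u::real,v::real). (x, {u..v}))"
      have dj: "disjnt (snd (\<phi> i)) (snd (\<phi> j))" if "i \<in> C'" "j \<in> C'" "i \<noteq> j" for i j
      proof -
        have "snd (\<phi> i) = cball (cen i) (rad i)" for i
          by (cases i) (simp add: \<phi>_def cb)
        moreover have "i \<in> C" "j \<in> C" using C' that by auto
        ultimately show ?thesis using C(3) that(3) unfolding pairwise_def by simp
      qed
      have inK: "i \<in> K" if "i \<in> C'" for i using that C C' by auto
      have ne: "snd (\<phi> i) \<noteq> {}" if "i \<in> C'" for i
        using inK[OF that] unfolding K_def \<phi>_def by auto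
      have inj: "inj_on \<phi> C'"
      proof (rule inj_onI, rule ccontr)
        fix i j assume *: "i \<in> C'" "j \<in> C'" "\<phi> i = \<phi> j" "i \<noteq> j"
        show False using dj[OF *(1,2,4)] ne[OF *(1)] *(3) unfolding disjnt_def by auto
      qed
      have "\<phi> ` C' tagged_partial_division_of cbox a b"
        unfolding tagged_partial_division_of_def
      proof (intro conjI allI impI)
        show "finite (\<phi> ` C')" using C' by simp
        fix x Q assume "(x, Q) \<in> \<phi> ` C'"
        then show "x \<in> Q" "Q \<subseteq> cbox a b" "\<exists>a b. Q = cbox a b"
          using inK unfolding \<phi>_def K_def by fastforce+
      next
        fix x Q y R assume "(x, Q) \<in> \<phi> ` C' \<and> (y, R) \<in> \<phi> ` C' \<and> (x, Q) \<noteq> (y, R)"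
        then obtain i j where ij: "i \<in> C'" "j \<in> C'" "\<phi> i = (x, Q)" "\<phi> j = (y, R)" "i \<noteq> j" by (metis imageE)
        then have "Q \<inter> R = {}" using dj[OF ij(1,2,5)] unfolding disjnt_def by simp
        then show "interior Q \<inter> interior R = {}" using interior_subset by blast
      qed
      moreover have "\<gamma> fine \<phi> ` C'"
        using inK unfolding fine_def \<phi>_def K_def by fastforce
      ultimately have "sum (\<lambda>(x,k). norm(measure lborel k *\<^sub>R g x - integral k g)) (\<phi> ` C') < e / real (Suc k)"
        by (rule hen)
      also have "sum (\<lambda>(x,k). norm(measure lborel k *\<^sub>R g x - integral k g)) (\<phi> ` C') = 
         (\<Sum>(x,u,v)\<in>C'. \<bar>(v - u) * g x - (F v - F u)\<bar>)"
        unfolding sum.reindex[OF inj]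
      proof (rule sum.cong)
        fix i assume i: "i \<in> C'"
        obtain x u v where xuv: "i = (x,u,v)" by (cases i)
        have "a \<le> u" "u \<le> v" "v \<le> b" using inK[OF i] unfolding xuv K_def by auto
        then show "((\<lambda>(x,k). norm(measure lborel k *\<^sub>R g x - integral k g)) \<circ> \<phi>) i =
            (case i of (x,u,v) \<Rightarrow> \<bar>(v - u) * g x - (F v - F u)\<bar>)"
          unfolding xuv \<phi>_def by (simp add: incr)
      qed simp
      finally have less: "(\<Sum>(x,u,v)\<in>C'. \<bar>(v - u) * g x - (F v - F u)\<bar>) < e / real (Suc k)" .
      have "(\<Sum>(x,u,v)\<in>C'. (v - u)) / real (Suc k) = (\<Sum>(x,u,v)\<in>C'. (v - u) / real (Suc k))"
        by (simp add: sum_divide_distrib case_prod_beta)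
      also have "\<dots> \<le> (\<Sum>(x,u,v)\<in>C'. \<bar>(v - u) * g x - (F v - F u)\<bar>)"
      proof (rule sum_mono)
        fix i assume i: "i \<in> C'"
        obtain x u v where xuv: "i = (x,u,v)" by (cases i)
        have "\<not> good k x u v" using inK[OF i] unfolding xuv K_def by auto
        then have "(v - u) / real (Suc k) \<le> \<bar>F v - F u - g x * (v - u)\<bar>" unfolding good_def by simp
        also have "\<dots> = \<bar>(v - u) * g x - (F v - F u)\<bar>" by (simp add: mult.commute abs_minus_commute)
        finally show "(case i of (x,u,v) \<Rightarrow> (v - u) / real (Suc k)) \<le> (case i of (x,u,v) \<Rightarrow> \<bar>(v - u) * g x - (F v - F u)\<bar>)"
          unfolding xuv by simp
      qed
      also note less
      finally have "(\<Sum>(x,u,v)\<in>C'. (v - u)) < e" by (simp add: divide_less_cancel)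
      moreover have "measure lebesgue (\<Union>i\<in>C'. cball (cen i) (rad i)) \<le> (\<Sum>i\<in>C'. measure lebesgue (cball (cen i) (rad i)))"
        by (rule measure_UNION_le) (use C' in auto)
      moreover have "(\<Sum>i\<in>C'. measure lebesgue (cball (cen i) (rad i))) = (\<Sum>(x,u,v)\<in>C'. (v - u))"
      proof (rule sum.cong)
        fix i assume i: "i \<in> C'"
        obtain x u v where xuv: "i = (x,u,v)" by (cases i)
        have "u \<le> v" using inK[OF i] unfolding xuv K_def by auto
        then show "measure lebesgue (cball (cen i) (rad i)) = (case i of (x,u,v) \<Rightarrow> v - u)"
          unfolding xuv cb by simp
      qed simp
      ultimately show ?thesis by simp
    qed
    let ?U = "\<Union>i\<in>C. cball (cen i) (rad i)"
    have U: "?U \<in> lmeasurable" "measure lebesgue ?U \<le> e"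
      using fmeasurable_UN_bound[OF C(1) _ bound] measure_UN_bound[OF C(1) _ bound] by auto
    have nn: "Bad k - ?U \<in> null_sets lebesgue" using C(4) negligible_iff_null_sets by blast
    show "\<exists>T. Bad k \<subseteq> T \<and> T \<in> lmeasurable \<and> measure lebesgue T \<le> e"
    proof (intro exI conjI)
      show "Bad k \<subseteq> ?U \<union> (Bad k - ?U)" by blast
      show "?U \<union> (Bad k - ?U) \<in> lmeasurable"
        using U(1) C(4) negligible_imp_measurable by blast
      show "measure lebesgue (?U \<union> (Bad k - ?U)) \<le> e"
        using U(2) measure_Un_null_set[OF fmeasurableD[OF U(1)] nn] by simp
    qed
  qed
  show thesis
  proof (rule that)
    show "negligible (\<Union>k. Bad k)" using neg by (intro negligible_countable_Union) auto
    fix x assume x: "x \<in> {a<..<b} - (\<Union>k. Bad k)"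
    show "(F has_real_derivative g x) (at x)"
      unfolding has_field_derivative_iff
    proof (rule LIM_I)
      fix r :: real assume "r > 0"
      then obtain k where k: "inverse (real (Suc k)) < r" using reals_Archimedean by blast
      have "x \<notin> Bad k" using x by auto
      then have "\<not> (\<forall>d>0. \<exists>u v. a \<le> u \<and> u \<le> x \<and> x \<le> v \<and> v \<le> b \<and> u < v \<and> v - u < d \<and> \<not> good k x u v)"
        using x unfolding Bad_def by simp
      then obtain d where d: "d > 0" "\<And>u v. a \<le> u \<Longrightarrow> u \<le> x \<Longrightarrow> x \<le> v \<Longrightarrow> v \<le> b \<Longrightarrow> u < v \<Longrightarrow> v - u < d \<Longrightarrow> good k x u v"
        by metis
      show "\<exists>s>0. \<forall>y. y \<noteq> x \<and> norm (y - x) < s \<longrightarrow> norm ((F y - F x) / (y - x) - g x) < r"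
      proof (intro exI conjI allI impI)
        show "min d (min (x - a) (b - x)) > 0" using d x by auto
        fix y assume y: "y \<noteq> x \<and> norm (y - x) < min d (min (x - a) (b - x))"
        have "good k x (min x y) (max x y)"
          by (rule d(2)) (use y in \<open>auto simp: min_def max_def abs_if split: if_splits\<close>)
        then have "\<bar>F y - F x - g x * (y - x)\<bar> \<le> \<bar>y - x\<bar> / real (Suc k)"
          unfolding good_def by (auto simp: min_def max_def algebra_simps abs_minus_commute split: if_splits)
        moreover have "(F y - F x) / (y - x) - g x = (F y - F x - g x * (y - x)) / (y - x)"
          using y by (simp add: field_simps)
        ultimately have "\<bar>(F y - F x) / (y - x) - g x\<bar> \<le> inverse (real (Suc k))"
          using y by (simp add: abs_divide divide_le_eq field_simps)
        then show "norm ((F y - F x) / (y - x) - g x) < r" using k by simp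
      qed
    qed
  qed
qed

theorem abs_cont_on_FTC:
  assumes ac: "abs_cont_on {a..b} f" and ab: "a \<le> b"
  obtains g N where "negligible N" "\<And>x. x \<in> {a<..<b} - N \<Longrightarrow> (f has_real_derivative g x) (at x)"
    "g absolutely_integrable_on {a..b}"
    "\<And>x y. a \<le> x \<Longrightarrow> x \<le> y \<Longrightarrow> y \<le> b \<Longrightarrow> (g has_integral f y - f x) {x..y}"
proof -
  obtain g where g: "g absolutely_integrable_on {a..b}"
    "\<And>x. a \<le> x \<Longrightarrow> x \<le> b \<Longrightarrow> (g has_integral f x - f a) {a..x}"
    using abs_cont_density[OF ac ab] by blast
  have gi: "g integrable_on {a..b}" using g(1) by (simp add: absolutely_integrable_on_def)
  obtain N where N: "negligible N"
    "\<And>x. x \<in> {a<..<b} - N \<Longrightarrow> ((\<lambda>x. integral {a..x} g) has_real_derivative g x) (at x)"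
    using indefinite_integral_differentiable_ae[OF gi] by blast
  have eq: "integral {a..x} g = f x - f a" if "a \<le> x" "x \<le> b" for x
    using g(2)[OF that] by (rule integral_unique)
  show thesis
  proof (rule that[OF N(1) _ g(1)])
    fix x assume x: "x \<in> {a<..<b} - N"
    have "((\<lambda>x. f x - f a) has_real_derivative g x) (at x)"
      by (rule has_field_derivative_transform_within_open[OF N(2)[OF x], of "{a<..<b}"])
        (use x eq in auto)
    then show "(f has_real_derivative g x) (at x)"
      using DERIV_add[OF _ DERIV_const, of "\<lambda>x. f x - f a" "g x" x UNIV "f a"] by simp
  next
    fix x y assume xy: "a \<le> x" "x \<le> y" "y \<le> b"
    have "g integrable_on {x..y}" using gi xy by (auto intro: integrable_on_subinterval)
    moreover have "integral {a..x} g + integral {x..y} g = integral {a..y} g"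
      by (rule Henstock_Kurzweil_Integration.integral_combine)
        (use xy gi in \<open>auto intro: integrable_on_subinterval\<close>)
    then have "integral {x..y} g = f y - f x" using eq xy by simp
    ultimately show "(g has_integral f y - f x) {x..y}"
      by (simp add: has_integral_integrable_integral)
  qed
qed

section \<open>Locally absolutely continuous functions on the half-open unit interval\<close>

abbreviation leb01 :: "real measure" where
  "leb01 \<equiv> lebesgue_on {0<..<1}"

lemma AE_leb01_negligible:
  assumes "negligible N" "\<And>x. 0 < x \<Longrightarrow> x < 1 \<Longrightarrow> x \<notin> N \<Longrightarrow> P x"
  shows "AE x in leb01. P x"
proof -
  have "AE x in lebesgue. x \<notin> N"
    using assms(1) by (intro AE_not_in) (simp add: negligible_iff_null_sets)
  then have "AE x in lebesgue. x \<in> {0<..<1} \<longrightarrow> P x"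
    by eventually_elim (use assms(2) in auto)
  then show ?thesis by (subst AE_restrict_space_iff) auto
qed

lemma AE_leb01_obtain:
  assumes "AE x in leb01. P x"
  obtains N where "negligible N" "\<And>x. 0 < x \<Longrightarrow> x < 1 \<Longrightarrow> x \<notin> N \<Longrightarrow> P x"
proof -
  have "AE x in lebesgue. x \<in> {0<..<1} \<longrightarrow> P x"
    using assms by (subst (asm) AE_restrict_space_iff) auto
  then obtain N where N: "{x \<in> space lebesgue. \<not> (x \<in> {0<..<1} \<longrightarrow> P x)} \<subseteq> N"
    "emeasure lebesgue N = 0" "N \<in> sets lebesgue"
    by (rule AE_E)
  then have "negligible N" by (simp add: negligible_iff_null_sets null_sets_def)
  then show thesis by (rule that) (use N(1) in auto)
qed

lemma AE_leb01_interior: "(\<And>x. 0 < x \<Longrightarrow> x < 1 \<Longrightarrow> P x) \<Longrightarrow> AE x in leb01. P x"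
  by (rule AE_leb01_negligible[of "{}"]) auto

lemma measurable_leb01_AE:
  fixes f g :: "real \<Rightarrow> real"
  assumes f: "f \<in> borel_measurable leb01" and eq: "AE x in leb01. f x = g x"
  shows "g \<in> borel_measurable leb01"
proof -
  have S: "{0<..<1::real} \<in> sets lebesgue" by simp
  have "(\<lambda>x. if x \<in> {0<..<1} then f x else 0) \<in> borel_measurable lebesgue"
    using f borel_measurable_if[OF S] by blast
  moreover have "AE x in lebesgue. (if x \<in> {0<..<1} then f x else 0) = (if x \<in> {0<..<1} then g x else 0)"
  proof -
    have "AE x in lebesgue. x \<in> {0<..<1} \<longrightarrow> f x = g x"
      using eq by (subst (asm) AE_restrict_space_iff) auto
    then show ?thesis by eventually_elim auto
  qed
  ultimately have "(\<lambda>x. if x \<in> {0<..<1} then g x else 0) \<in> borel_measurable lebesgue"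
    by (rule borel_measurable_AE)
  then show ?thesis using borel_measurable_if[OF S] by blast
qed

lemma dx_eq:
  assumes "(f has_real_derivative d) (at x within {0..1})" "0 \<le> x" "x \<le> 1"
  shows "dx f x = d"
  unfolding dx_def using assms
  by (intro vector_derivative_within_closed_interval)
    (auto simp: has_real_derivative_iff_has_vector_derivative)

lemma dx_eq_at:
  assumes "(f has_real_derivative d) (at x)" "0 \<le> x" "x \<le> 1"
  shows "dx f x = d"
  using assms by (intro dx_eq) (auto intro: has_field_derivative_at_within)

text \<open>Functions representing the same element of the weighted spaces may differ at \<open>0\<close>.\<close>

lemma dx_cong:
  assumes "\<And>y. 0 < y \<Longrightarrow> y \<le> 1 \<Longrightarrow> f y = g y" "0 < x" "x \<le> 1"
  shows "dx f x = dx g x"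
proof -
  have "(f has_vector_derivative d) (at x within {0..1}) \<longleftrightarrow> (g has_vector_derivative d) (at x within {0..1})" for d
  proof
    have *: "\<forall>y\<in>{0..1}. dist y x < x \<longrightarrow> f y = g y"
      using assms by (auto simp: dist_real_def)
    show "(g has_vector_derivative d) (at x within {0..1})" if "(f has_vector_derivative d) (at x within {0..1})"
      by (rule has_vector_derivative_transform_within[OF that \<open>0 < x\<close>]) (use * assms in auto)
    show "(f has_vector_derivative d) (at x within {0..1})" if "(g has_vector_derivative d) (at x within {0..1})"
      by (rule has_vector_derivative_transform_within[OF that \<open>0 < x\<close>]) (use * assms in auto)
  qed
  then show ?thesis unfolding dx_def vector_derivative_def by simp
qed

abbreviation loc_abs_cont :: "(real \<Rightarrow> real) \<Rightarrow> bool" where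
  "loc_abs_cont u \<equiv> \<forall>c\<in>{0<..1}. abs_cont_on {c..1} u"

lemma loc_abs_cont_FTC_AE:
  assumes u: "loc_abs_cont u" and c: "0 < c" "c < 1"
  obtains N where "negligible N" "\<And>x. c < x \<Longrightarrow> x < 1 \<Longrightarrow> x \<notin> N \<Longrightarrow> (u has_real_derivative dx u x) (at x)"
    "\<And>y. c \<le> y \<Longrightarrow> y \<le> 1 \<Longrightarrow> (dx u has_integral u y - u c) {c..y}"
proof -
  have "abs_cont_on {c..1} u" "c \<le> 1" using u c by auto
  from abs_cont_on_FTC[OF this] obtain g N where N: "negligible N"
    "\<And>x. x \<in> {c<..<1} - N \<Longrightarrow> (u has_real_derivative g x) (at x)"
    "\<And>x y. c \<le> x \<Longrightarrow> x \<le> y \<Longrightarrow> y \<le> 1 \<Longrightarrow> (g has_integral u y - u x) {x..y}"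
    by metis
  have eq: "dx u x = g x" if "c < x" "x < 1" "x \<notin> N" for x
    by (rule dx_eq_at[OF N(2)]) (use that c in auto)
  show thesis
  proof (rule that[OF N(1)])
    show "(u has_real_derivative dx u x) (at x)" if "c < x" "x < 1" "x \<notin> N" for x
      using N(2)[of x] eq[OF that] that by simp
    fix y assume y: "c \<le> y" "y \<le> 1"
    show "(dx u has_integral u y - u c) {c..y}"
    proof (rule has_integral_spike[where S="N \<union> {c, 1}"])
      show "negligible (N \<union> {c, 1})" using N(1) by (simp add: negligible_Un)
      show "dx u x = g x" if "x \<in> {c..y} - (N \<union> {c, 1})" for x using eq[of x] that y by auto
      show "(g has_integral u y - u c) {c..y}" using N(3)[of c y] y by simp
    qed
  qed
qed

lemma loc_abs_cont_FTC:
  assumes "loc_abs_cont u" and "0 < x" "x \<le> y" "y \<le> 1"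
  shows "(dx u has_integral u y - u x) {x..y}"
proof (cases "x < 1")
  case True
  then show ?thesis using loc_abs_cont_FTC_AE[OF assms(1,2) True] assms by metis
next
  case False
  then have "x = y" using assms by simp
  then show ?thesis by (simp add: has_integral_refl)
qed

lemma loc_abs_cont_AE_derivative:
  assumes u: "loc_abs_cont u"
  shows "AE x in leb01. (u has_real_derivative dx u x) (at x)"
proof -
  define c where "c = (\<lambda>n::nat. inverse (real (Suc (Suc n))))"
  have c01: "0 < c n" "c n < 1" for n unfolding c_def by (auto simp: inverse_less_1_iff)
  have "\<exists>N. negligible N \<and> (\<forall>x. c n < x \<and> x < 1 \<and> x \<notin> N \<longrightarrow> (u has_real_derivative dx u x) (at x))" for n
    using loc_abs_cont_FTC_AE[OF u c01[of n]] by metis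
  then obtain N where N: "\<And>n. negligible (N n)"
    "\<And>n x. c n < x \<Longrightarrow> x < 1 \<Longrightarrow> x \<notin> N n \<Longrightarrow> (u has_real_derivative dx u x) (at x)" by metis
  show ?thesis
  proof (rule AE_leb01_negligible)
    show "negligible (\<Union>n. N n)" using N(1) by (intro negligible_countable_Union) auto
    fix x :: real assume x: "0 < x" "x < 1" "x \<notin> (\<Union>n. N n)"
    obtain n where "inverse (real (Suc n)) < x" using reals_Archimedean[OF x(1)] by blast
    moreover have "c n \<le> inverse (real (Suc n))" unfolding c_def by (rule le_imp_inverse_le) auto
    ultimately have "c n < x" by simp
    then show "(u has_real_derivative dx u x) (at x)" using N(2) x by blast
  qed
qed

text \<open>On each \<open>[c,1]\<close> the derivative is a Henstock-Kurzweil integrable function; let \<open>c\<close> decrease to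
  \<open>0\<close>.\<close>

lemma measurable_dx:
  assumes u: "loc_abs_cont u"
  shows "dx u \<in> borel_measurable leb01"
proof -
  define c where "c = (\<lambda>n::nat. inverse (real (Suc n)))"
  have c01: "0 < c n" "c n \<le> 1" for n unfolding c_def by (auto simp: inverse_le_1_iff)
  have "(\<lambda>x. indicator {c n..1} x *\<^sub>R dx u x) \<in> borel_measurable leb01" for n
  proof -
    have "(dx u has_integral u 1 - u (c n)) {c n..1}"
      using loc_abs_cont_FTC[OF u] c01 by simp
    from has_integral_implies_lebesgue_measurable[OF this]
    have "(\<lambda>x. indicator {c n..1} x *\<^sub>R dx u x) \<in> borel_measurable lebesgue" .
    then show ?thesis by (rule measurable_restrict_space1)
  qed
  then show ?thesis
  proof (rule borel_measurable_LIMSEQ_real[rotated])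
    fix x assume "x \<in> space leb01"
    then have x: "0 < x" "x < 1" by auto
    obtain n where n: "inverse (real (Suc n)) < x" using reals_Archimedean[OF x(1)] by blast
    have "\<forall>m\<ge>n. indicator {c m..1} x *\<^sub>R dx u x = dx u x"
    proof (intro allI impI)
      fix m assume "n \<le> m"
      then have "c m \<le> c n" unfolding c_def by (intro le_imp_inverse_le) auto
      moreover have "c n < x" using n unfolding c_def .
      ultimately have "x \<in> {c m..1}" using x by simp
      then show "indicator {c m..1} x *\<^sub>R dx u x = dx u x" by simp
    qed
    then show "(\<lambda>m. indicator {c m..1} x *\<^sub>R dx u x) \<longlonglongrightarrow> dx u x"
      by (intro tendsto_eventually eventually_sequentiallyI[of n]) auto
  qed
qed

text \<open>On \<open>[c,1]\<close> the integral is at most \<open>W 1 - W c \<le> W 1\<close>; let \<open>c\<close> tend to \<open>0\<close>. The sign of \<open>W\<close> replaces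
  any information about its behaviour at the degenerate end point.\<close>

lemma integral_le_boundary_value:
  assumes W: "loc_abs_cont W" and nonneg: "\<And>x. 0 < x \<Longrightarrow> x \<le> 1 \<Longrightarrow> 0 \<le> W x"
    and le: "AE x in leb01. F x \<le> dx W x" and F: "integrable leb01 F"
  shows "(LINT x|leb01. F x) \<le> W 1"
proof -
  obtain N where N: "negligible N" "\<And>x. 0 < x \<Longrightarrow> x < 1 \<Longrightarrow> x \<notin> N \<Longrightarrow> F x \<le> dx W x"
    using AE_leb01_obtain[OF le] by blast
  have FI: "(F has_integral (LINT x|leb01. F x)) {0..1}"
    unfolding has_integral_Icc_iff_Ioo by (rule has_integral_integral_lebesgue_on[OF F]) simp
  then have Fint: "F integrable_on {0..1}" and Feq: "integral {0..1} F = (LINT x|leb01. F x)"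
    by (auto simp: integral_unique)
  have le1: "integral {c..1} F \<le> W 1" if c: "0 < c" "c \<le> 1" for c
  proof -
    have "F integrable_on {c..1}" using Fint c by (auto intro: integrable_on_subinterval)
    then have "(F has_integral integral {c..1} F) {c..1}" by (rule integrable_integral)
    \<comment> \<open>The minimum turns the almost everywhere comparison into one that holds everywhere.\<close>
    then have 1: "((\<lambda>x. min (F x) (dx W x)) has_integral integral {c..1} F) {c..1}"
    proof (rule has_integral_spike[rotated 2])
      show "negligible (N \<union> {1})" using N(1) by (simp add: negligible_Un)
      show "min (F x) (dx W x) = F x" if "x \<in> {c..1} - (N \<union> {1})" for x
        using N(2)[of x] that c by auto
    qed
    have "(dx W has_integral W 1 - W c) {c..1}" using loc_abs_cont_FTC[OF W] c by simp
    from has_integral_le[OF 1 this] have "integral {c..1} F \<le> W 1 - W c" by simp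
    then show ?thesis using nonneg[OF c] by simp
  qed
  have "continuous_on {0..1} (\<lambda>x. integral {x..1} F)"
    by (rule indefinite_integral_continuous_1'[OF Fint])
  then have "((\<lambda>x. integral {x..1} F) \<longlongrightarrow> integral {0..1} F) (at 0 within {0..1})"
    unfolding continuous_on_def by auto
  then have "((\<lambda>x. integral {x..1} F) \<longlongrightarrow> integral {0..1} F) (at_right 0)"
    by (simp add: at_within_Icc_at_right)
  moreover have "\<forall>\<^sub>F x in at_right 0. integral {x..1} F \<le> W 1"
    by (rule eventually_at_rightI[of 0 1]) (use le1 in auto)
  ultimately have "integral {0..1} F \<le> W 1"
    by (rule tendsto_upperbound) simp
  then show ?thesis using Feq by simp
qed

lemma abs_cont_on_lipschitz:
  assumes "\<And>x y. a \<le> x \<Longrightarrow> x \<le> y \<Longrightarrow> y \<le> b \<Longrightarrow> \<bar>f y - f x\<bar> \<le> K * (y - x)" "0 \<le> K"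
  shows "abs_cont_on {a..b} f"
proof -
  have "abs_cont_on {a..b} (\<lambda>x. x)"
    unfolding abs_cont_on_modulus ac_modulus_def
  proof (intro allI impI)
    fix \<epsilon> :: real assume "\<epsilon> > 0"
    have "(\<Sum>k\<in>d. \<bar>Sup k - Inf k\<bar>) < \<epsilon>"
      if d: "d division_of t" and lt: "(\<Sum>k\<in>d. Sup k - Inf k) < \<epsilon>" for d t
    proof -
      have "(\<Sum>k\<in>d. \<bar>Sup k - Inf k\<bar>) = (\<Sum>k\<in>d. Sup k - Inf k)"
      proof (rule sum.cong)
        fix k assume "k \<in> d"
        then obtain u v where "k = cbox u v" "k \<noteq> {}" using d by (metis division_ofD(3,4))
        then show "\<bar>Sup k - Inf k\<bar> = Sup k - Inf k" by auto
      qed simp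
      then show ?thesis using lt by simp
    qed
    then show "\<exists>\<delta>. 0 < \<delta> \<and> (\<forall>d t. d division_of t \<and> t \<subseteq> {a..b} \<and> (\<Sum>k\<in>d. Sup k - Inf k) < \<delta> \<longrightarrow>
             (\<Sum>k\<in>d. \<bar>Sup k - Inf k\<bar>) < \<epsilon>)"
      using \<open>\<epsilon> > 0\<close> by (intro exI[of _ \<epsilon>]) auto
  qed
  note id = this
  show ?thesis
  proof (rule abs_cont_on_dominated[OF id id \<open>0 \<le> K\<close>])
    fix x y assume xy: "a \<le> x" "x \<le> y" "y \<le> b"
    have "K * (y - x) \<le> K * (\<bar>y - x\<bar> + \<bar>y - x\<bar>)"
      using xy \<open>0 \<le> K\<close> by (intro mult_left_mono) auto
    then show "\<bar>f y - f x\<bar> \<le> K * (\<bar>y - x\<bar> + \<bar>y - x\<bar>)" using assms(1)[OF xy] by simp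
  qed
qed

lemma abs_cont_on_mult:
  assumes f: "abs_cont_on {a..b} f" and g: "abs_cont_on {a..b} g"
  shows "abs_cont_on {a..b} (\<lambda>x. f x * g x)"
proof -
  have "bounded (f ` {a..b})" "bounded (g ` {a..b})"
    using f g by (auto intro!: compact_imp_bounded compact_continuous_image abs_cont_on_imp_continuous_on)
  then obtain B C where B: "\<And>x. x \<in> {a..b} \<Longrightarrow> \<bar>f x\<bar> \<le> B" and C: "\<And>x. x \<in> {a..b} \<Longrightarrow> \<bar>g x\<bar> \<le> C"
    unfolding bounded_real by (metis imageI)
  define M where "M = max 0 (max B C)"
  have M: "\<bar>f x\<bar> \<le> M" "\<bar>g x\<bar> \<le> M" if "x \<in> {a..b}" for x
    using B[OF that] C[OF that] unfolding M_def by auto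
  show ?thesis
  proof (rule abs_cont_on_dominated[OF f g])
    show "0 \<le> M" unfolding M_def by simp
    fix x y assume "a \<le> x" "x \<le> y" "y \<le> b"
    then have xy: "x \<in> {a..b}" "y \<in> {a..b}" by auto
    have "f y * g y - f x * g x = (f y - f x) * g y + f x * (g y - g x)" by (simp add: algebra_simps)
    then have "\<bar>f y * g y - f x * g x\<bar> \<le> \<bar>f y - f x\<bar> * \<bar>g y\<bar> + \<bar>f x\<bar> * \<bar>g y - g x\<bar>"
      by (metis abs_mult abs_triangle_ineq)
    also have "\<dots> \<le> \<bar>f y - f x\<bar> * M + M * \<bar>g y - g x\<bar>"
      by (intro add_mono mult_left_mono mult_right_mono M xy) auto
    finally show "\<bar>f y * g y - f x * g x\<bar> \<le> M * (\<bar>f y - f x\<bar> + \<bar>g y - g x\<bar>)"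
      by (simp add: algebra_simps)
  qed
qed

lemma abs_cont_on_lincomb:
  assumes f: "abs_cont_on {a..b} f" and g: "abs_cont_on {a..b} g"
  shows "abs_cont_on {a..b} (\<lambda>x. c * f x + d * g x)"
proof (rule abs_cont_on_dominated[OF f g, of "\<bar>c\<bar> + \<bar>d\<bar>"])
  fix x y
  have "(c * f y + d * g y) - (c * f x + d * g x) = c * (f y - f x) + d * (g y - g x)" by (simp add: algebra_simps)
  then have "\<bar>(c * f y + d * g y) - (c * f x + d * g x)\<bar> \<le> \<bar>c\<bar> * \<bar>f y - f x\<bar> + \<bar>d\<bar> * \<bar>g y - g x\<bar>"
    by (metis abs_mult abs_triangle_ineq)
  also have "\<dots> \<le> (\<bar>c\<bar> + \<bar>d\<bar>) * (\<bar>f y - f x\<bar> + \<bar>g y - g x\<bar>)"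
    by (simp add: algebra_simps)
  finally show "\<bar>(c * f y + d * g y) - (c * f x + d * g x)\<bar> \<le> (\<bar>c\<bar> + \<bar>d\<bar>) * (\<bar>f y - f x\<bar> + \<bar>g y - g x\<bar>)" .
qed simp

lemma abs_cont_on_bounded_derivative:
  assumes cont: "continuous_on {a..b} f"
    and der: "\<And>x. a < x \<Longrightarrow> x < b \<Longrightarrow> \<exists>d. (f has_real_derivative d) (at x) \<and> \<bar>d\<bar> \<le> K"
  shows "abs_cont_on {a..b} f"
proof (rule abs_cont_on_lipschitz[where K = "max 0 K"])
  fix x y assume xy: "a \<le> x" "x \<le> y" "y \<le> b"
  show "\<bar>f y - f x\<bar> \<le> max 0 K * (y - x)"
  proof (cases "x < y")
    case True
    have "\<exists>l z. x < z \<and> z < y \<and> (f has_real_derivative l) (at z) \<and> f y - f x = (y - x) * l"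
    proof (rule MVT[OF True])
      show "continuous_on {x..y} f" using cont by (rule continuous_on_subset) (use xy in auto)
      show "f differentiable (at z)" if "x < z" "z < y" for z
        using der[of z] that xy real_differentiable_def by auto
    qed
    then obtain l z where z: "x < z" "z < y" "(f has_real_derivative l) (at z)" "f y - f x = (y - x) * l" by blast
    have "\<bar>l\<bar> \<le> K" using der[of z] z xy DERIV_unique by fastforce
    then have "\<bar>l\<bar> * (y - x) \<le> max 0 K * (y - x)" using True by (intro mult_right_mono) auto
    then show ?thesis using z True by (simp add: abs_mult mult.commute)
  next
    case False
    then show ?thesis using xy by simp
  qed
qed simp

section \<open>Square integrable functions\<close>

lemma L2D:
  assumes "f \<in> L2 S" shows "f \<in> borel_measurable (lebesgue_on S)" "integrable (lebesgue_on S) (\<lambda>x. (f x)\<^sup>2)"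
  using assms unfolding L2_def by auto

lemma L2_mult_integrable:
  assumes f: "f \<in> L2 S" and g: "g \<in> L2 S"
  shows "integrable (lebesgue_on S) (\<lambda>x. f x * g x)"
proof (rule Bochner_Integration.integrable_bound)
  show "integrable (lebesgue_on S) (\<lambda>x. (f x)\<^sup>2 + (g x)\<^sup>2)"
    using L2D(2)[OF f] L2D(2)[OF g] by simp
  show "(\<lambda>x. f x * g x) \<in> borel_measurable (lebesgue_on S)"
    using L2D(1)[OF f] L2D(1)[OF g] by simp
  have "\<bar>x * y\<bar> \<le> x\<^sup>2 + y\<^sup>2" for x y :: real
  proof -
    have "2 * (\<bar>x\<bar> * \<bar>y\<bar>) \<le> x\<^sup>2 + y\<^sup>2" using sum_squares_bound[of "\<bar>x\<bar>" "\<bar>y\<bar>"] by simp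
    moreover have "0 \<le> \<bar>x\<bar> * \<bar>y\<bar>" by simp
    ultimately show ?thesis unfolding abs_mult by linarith
  qed
  then show "AE x in lebesgue_on S. norm (f x * g x) \<le> norm ((f x)\<^sup>2 + (g x)\<^sup>2)"
    by (intro AE_I2) (simp add: abs_mult)
qed

lemma L2_bound:
  assumes f: "f \<in> L2 S" and g: "g \<in> borel_measurable (lebesgue_on S)"
    and le: "AE x in lebesgue_on S. \<bar>g x\<bar> \<le> K * \<bar>f x\<bar>"
  shows "g \<in> L2 S"
proof -
  have "integrable (lebesgue_on S) (\<lambda>x. (g x)\<^sup>2)"
  proof (rule Bochner_Integration.integrable_bound)
    show "integrable (lebesgue_on S) (\<lambda>x. K\<^sup>2 * (f x)\<^sup>2)" using L2D(2)[OF f] by simp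
    show "(\<lambda>x. (g x)\<^sup>2) \<in> borel_measurable (lebesgue_on S)" using g by simp
    show "AE x in lebesgue_on S. norm ((g x)\<^sup>2) \<le> norm (K\<^sup>2 * (f x)\<^sup>2)"
      using le
    proof eventually_elim
      case (elim x)
      then have "\<bar>g x\<bar>\<^sup>2 \<le> (K * \<bar>f x\<bar>)\<^sup>2" by (intro power_mono) auto
      then show ?case by (simp add: power_mult_distrib)
    qed
  qed
  then show ?thesis using g unfolding L2_def by simp
qed

lemma L2_lincomb:
  assumes f: "f \<in> L2 S" and g: "g \<in> L2 S"
  shows "(\<lambda>x. c * f x + d * g x) \<in> L2 S"
proof -
  have "integrable (lebesgue_on S) (\<lambda>x. c\<^sup>2 * (f x)\<^sup>2 + d\<^sup>2 * (g x)\<^sup>2 + 2 * c * d * (f x * g x))"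
    using L2D(2)[OF f] L2D(2)[OF g] L2_mult_integrable[OF f g] by simp
  moreover have "(\<lambda>x. (c * f x + d * g x)\<^sup>2) = (\<lambda>x. c\<^sup>2 * (f x)\<^sup>2 + d\<^sup>2 * (g x)\<^sup>2 + 2 * c * d * (f x * g x))"
    by (auto simp: power2_eq_square algebra_simps)
  ultimately show ?thesis using L2D(1)[OF f] L2D(1)[OF g] unfolding L2_def by simp
qed

lemma L2_AE_cong:
  assumes f: "f \<in> L2 {0<..<1}" and eq: "AE x in leb01. f x = g x"
  shows "g \<in> L2 {0<..<1}"
proof (rule L2_bound[OF f, of _ 1])
  show "g \<in> borel_measurable leb01" using measurable_leb01_AE[OF L2D(1)[OF f] eq] .
  show "AE x in leb01. \<bar>g x\<bar> \<le> 1 * \<bar>f x\<bar>" using eq by eventually_elim simp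
qed

section \<open>The degenerate coefficient and the weighted spaces\<close>

context
  fixes a :: "real \<Rightarrow> real"
  assumes standing: "standing a"
begin

lemma coeff_pos: "0 < x \<Longrightarrow> x \<le> 1 \<Longrightarrow> 0 < a x"
  using standing unfolding standing_def by auto

lemma coeff_continuous: "continuous_on {0..1} a"
  using standing unfolding standing_def by auto

lemma coeff_derivative:
  assumes "0 < x" "x < 1"
  shows "(a has_real_derivative dx a x) (at x)"
proof -
  have "Ck_on (Suc 0) {0<..1} a" using standing unfolding standing_def One_nat_def by blast
  then obtain a' where "\<forall>x\<in>{0<..1}. (a has_real_derivative a' x) (at x within {0<..1})"
    by auto
  then have "(a has_real_derivative a' x) (at x within {0<..1})" using assms by simp
  then have "(a has_real_derivative a' x) (at x within {0<..<1})"
    by (rule has_field_derivative_subset) auto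
  then have "(a has_real_derivative a' x) (at x)"
    using at_within_open[of x "{0<..<1}"] assms by simp
  then show ?thesis using dx_eq_at[of a "a' x" x] assms by simp
qed

lemma coeff_logderiv:
  assumes "0 < x" "x \<le> 1"
  shows "x * \<bar>dx a x\<bar> \<le> mu a * a x"
proof -
  have "x * \<bar>dx a x\<bar> / a x \<le> mu a"
    unfolding mu_def using standing assms unfolding standing_def by (intro cSUP_upper) auto
  then show ?thesis using coeff_pos[OF assms] by (simp add: divide_le_eq)
qed

lemma mu_nonneg: "0 \<le> mu a"
proof -
  have "0 \<le> mu a * a 1" using coeff_logderiv[of 1] abs_ge_zero[of "dx a 1"] by simp
  then show ?thesis using coeff_pos[of 1] by (simp add: zero_le_mult_iff)
qed

lemma mu_less_2: "mu a < 2"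
  using standing unfolding standing_def by auto

text \<open>The quotient \<open>a(x)/x\<^sup>p\<close> is nonincreasing, because \<open>x a' \<le> \<mu> a \<le> p a\<close>.\<close>

lemma coeff_lower_bound:
  assumes p: "mu a \<le> real p" and x: "0 < x" "x \<le> 1"
  shows "a 1 * x ^ p \<le> a x"
proof -
  have "a 1 / 1 ^ p \<le> a x / x ^ p"
  proof (rule DERIV_nonpos_imp_decreasing_open[of x 1 "\<lambda>y. a y / y ^ p"])
    show "x \<le> 1" by fact
    show "continuous_on {x..1} (\<lambda>y. a y / y ^ p)"
      using x by (intro continuous_intros continuous_on_subset[OF coeff_continuous]) auto
    fix y assume y: "x < y" "y < 1"
    then have y0: "0 < y" using x by simp
    let ?d = "(dx a y * y ^ p - a y * (real p * y ^ (p - 1))) / (y ^ p * y ^ p)"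
    have "((\<lambda>y. a y / y ^ p) has_real_derivative ?d) (at y)"
      using coeff_derivative[OF y0 y(2)] y0
      by (auto intro!: derivative_eq_intros simp: field_simps)
    moreover have "?d \<le> 0"
    proof -
      have "y * (dx a y * y ^ p - a y * (real p * y ^ (p - 1))) = y ^ p * (y * dx a y - real p * a y)"
        by (cases p) (auto simp: algebra_simps)
      moreover have "y * dx a y \<le> real p * a y"
      proof -
        have "y * dx a y \<le> y * \<bar>dx a y\<bar>" using y0 by (intro mult_left_mono) auto
        also have "\<dots> \<le> mu a * a y" using coeff_logderiv[of y] y0 y by simp
        also have "\<dots> \<le> real p * a y" using p coeff_pos[of y] y0 y by (intro mult_right_mono) auto
        finally show ?thesis .
      qed
      ultimately have "y * (dx a y * y ^ p - a y * (real p * y ^ (p - 1))) \<le> 0"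
        using y0 by (simp add: mult_le_0_iff)
      then have "dx a y * y ^ p - a y * (real p * y ^ (p - 1)) \<le> 0"
        using y0 by (simp add: mult_le_0_iff)
      then show ?thesis using y0 by (intro divide_nonpos_pos) auto
    qed
    ultimately show "\<exists>d. ((\<lambda>y. a y / y ^ p) has_real_derivative d) (at y) \<and> d \<le> 0" by blast
  qed
  then show ?thesis using x by (simp add: le_divide_eq)
qed

lemma coeff_lower_square: "0 < x \<Longrightarrow> x \<le> 1 \<Longrightarrow> a 1 * x\<^sup>2 \<le> a x"
  using coeff_lower_bound[of 2 x] mu_less_2 by simp

text \<open>The derivative \<open>(a - x a')/a\<^sup>2\<close> is bounded by \<open>3/a\<close>, and \<open>a\<close> is bounded below on \<open>[c,1]\<close>.\<close>

lemma coeff_quotient_abs_cont: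
  assumes c: "0 < c" "c \<le> 1"
  shows "abs_cont_on {c..1} (\<lambda>x. x / a x)"
proof (rule abs_cont_on_bounded_derivative)
  have "a x \<noteq> 0" if "x \<in> {c..1}" for x using coeff_pos[of x] that c by auto
  then show "continuous_on {c..1} (\<lambda>x. x / a x)"
    using c by (intro continuous_intros continuous_on_subset[OF coeff_continuous]) auto
  fix x assume x: "c < x" "x < 1"
  then have x0: "0 < x" "x \<le> 1" using c by auto
  note pos = coeff_pos[OF x0]
  let ?d = "(a x - x * dx a x) / (a x * a x)"
  have "((\<lambda>x. x / a x) has_real_derivative ?d) (at x)"
    using coeff_derivative[of x] x0 x pos by (auto intro!: derivative_eq_intros)
  moreover have "\<bar>?d\<bar> \<le> 3 / (a 1 * c\<^sup>2)"
  proof -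
    have "\<bar>a x - x * dx a x\<bar> \<le> a x + x * \<bar>dx a x\<bar>"
      using abs_triangle_ineq4[of "a x" "x * dx a x"] pos x0 by (simp add: abs_mult)
    also have "\<dots> \<le> a x + 2 * a x"
      using coeff_logderiv[OF x0] mult_right_mono[of "mu a" 2 "a x"] mu_less_2 pos by linarith
    finally have "\<bar>a x - x * dx a x\<bar> / (a x * a x) \<le> (3 * a x) / (a x * a x)"
      using pos by (intro divide_right_mono) auto
    then have "\<bar>?d\<bar> \<le> (3 * a x) / (a x * a x)"
      using pos by (simp add: abs_divide abs_mult)
    also have "\<dots> = 3 / a x" using pos by simp
    also have "\<dots> \<le> 3 / (a 1 * c\<^sup>2)"
    proof (rule divide_left_mono)
      have "a 1 * c\<^sup>2 \<le> a 1 * x\<^sup>2" using coeff_pos[of 1] x c by (intro mult_left_mono power_mono) auto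
      also have "\<dots> \<le> a x" using coeff_lower_square[OF x0] .
      finally show "a 1 * c\<^sup>2 \<le> a x" .
      show "0 < a x * (a 1 * c\<^sup>2)" using pos coeff_pos[of 1] c by simp
    qed simp
    finally show ?thesis .
  qed
  ultimately show "\<exists>d. ((\<lambda>x. x / a x) has_real_derivative d) (at x) \<and> \<bar>d\<bar> \<le> 3 / (a 1 * c\<^sup>2)" by blast
qed

lemma V1D:
  assumes "u \<in> V1 a"
  shows "u \<in> L2 {0<..<1}" "loc_abs_cont u" "(\<lambda>x. sqrt (a x) * dx u x) \<in> L2 {0<..<1}"
  using assms unfolding V1_def by auto

lemma V1_energy_integrable:
  assumes "u \<in> V1 a" "v \<in> V1 a"
  shows "integrable leb01 (\<lambda>x. a x * dx u x * dx v x)"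
proof -
  have "integrable leb01 (\<lambda>x. (sqrt (a x) * dx u x) * (sqrt (a x) * dx v x))"
    by (rule L2_mult_integrable) (use assms V1D in auto)
  moreover have "(sqrt (a x) * dx u x) * (sqrt (a x) * dx v x) = a x * dx u x * dx v x" if "x \<in> space leb01" for x
  proof -
    have "0 \<le> a x" using coeff_pos[of x] that by auto
    then have "sqrt (a x) * sqrt (a x) = a x" by simp
    then show ?thesis by (metis mult.commute mult.left_commute)
  qed
  ultimately show ?thesis by (rule iffD1[OF Bochner_Integration.integrable_cong[OF refl], rotated])
qed

lemma V1_energy_integrable_square:
  "u \<in> V1 a \<Longrightarrow> integrable leb01 (\<lambda>x. a x * (dx u x)\<^sup>2)"
  using V1_energy_integrable[of u u] by (simp add: power2_eq_square mult.assoc)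

lemma V1_weighted_L2:
  assumes "u \<in> V1 a"
  shows "(\<lambda>x. x * dx u x) \<in> L2 {0<..<1}"
proof (rule L2_bound[OF V1D(3)[OF assms]])
  have "(\<lambda>x. x) \<in> borel_measurable leb01"
    by (rule continuous_imp_measurable_on_sets_lebesgue) (auto intro: continuous_intros)
  then show "(\<lambda>x. x * dx u x) \<in> borel_measurable leb01"
    using measurable_dx[OF V1D(2)[OF assms]] by simp
  show "AE x in leb01. \<bar>x * dx u x\<bar> \<le> (1 / sqrt (a 1)) * \<bar>sqrt (a x) * dx u x\<bar>"
  proof (rule AE_leb01_interior)
    fix x :: real assume x: "0 < x" "x < 1"
    have p: "0 < a 1" using coeff_pos by simp
    have "sqrt (a 1 * x\<^sup>2) \<le> sqrt (a x)" using coeff_lower_square[of x] x by simp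
    then have "sqrt (a 1) * x \<le> sqrt (a x)" using x by (simp add: real_sqrt_mult)
    then have "x \<le> (1 / sqrt (a 1)) * sqrt (a x)" using p by (simp add: field_simps)
    then have "x * \<bar>dx u x\<bar> \<le> ((1 / sqrt (a 1)) * sqrt (a x)) * \<bar>dx u x\<bar>" by (rule mult_right_mono) simp
    then show "\<bar>x * dx u x\<bar> \<le> (1 / sqrt (a 1)) * \<bar>sqrt (a x) * dx u x\<bar>"
      using x coeff_pos[of x] by (simp add: abs_mult)
  qed
qed

lemma loc_abs_cont_polynomial: "loc_abs_cont (\<lambda>x. x + b * x\<^sup>2)"
proof
  fix c :: real assume "c \<in> {0<..1}"
  show "abs_cont_on {c..1} (\<lambda>x. x + b * x\<^sup>2)"
  proof (rule abs_cont_on_bounded_derivative[where K="1 + 2 * \<bar>b\<bar>"])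
    show "continuous_on {c..1} (\<lambda>x. x + b * x\<^sup>2)" by (intro continuous_intros)
    fix x assume x: "c < x" "x < 1"
    have "((\<lambda>x. x + b * x\<^sup>2) has_real_derivative (1 + b * (2 * x))) (at x)"
      by (auto intro!: derivative_eq_intros)
    moreover have "\<bar>b\<bar> * x \<le> \<bar>b\<bar> * 1" using x by (intro mult_left_mono) auto
    then have "\<bar>1 + b * (2 * x)\<bar> \<le> 1 + 2 * \<bar>b\<bar>"
      using x \<open>c \<in> {0<..1}\<close> abs_triangle_ineq[of 1 "b * (2 * x)"] by (simp add: abs_mult)
    ultimately show "\<exists>d. ((\<lambda>x. x + b * x\<^sup>2) has_real_derivative d) (at x) \<and> \<bar>d\<bar> \<le> 1 + 2 * \<bar>b\<bar>" by blast
  qed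
qed

text \<open>Integrate the derivative of \<open>\<phi> u\<^sup>2\<close> for the weight \<open>\<phi> = x + b x\<^sup>2\<close>; the boundary term at \<open>1\<close> vanishes
  with \<open>u\<close>. What remains is a pointwise inequality between \<open>U = u(x)\<close> and \<open>D = u'(x)\<close>.\<close>

lemma hardy_poincare_aux:
  assumes u: "u \<in> V1 a" "u 1 = 0" and b: "0 \<le> b"
    and pt: "\<And>x U D. 0 < x \<Longrightarrow> x < 1 \<Longrightarrow>
       \<kappa> * U\<^sup>2 - (2 / a 1) * (a x * D\<^sup>2) \<le> (1 + b * (2 * x)) * U\<^sup>2 + (x + b * x\<^sup>2) * (2 * U * D)"
  shows "\<kappa> * (LINT x|leb01. (u x)\<^sup>2) \<le> (2 / a 1) * (LINT x|leb01. a x * (dx u x)\<^sup>2)"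
proof -
  let ?W = "\<lambda>x. (x + b * x\<^sup>2) * (u x * u x)"
  let ?F = "\<lambda>x. \<kappa> * (u x)\<^sup>2 - (2 / a 1) * (a x * (dx u x)\<^sup>2)"
  have i1: "integrable leb01 (\<lambda>x. (u x)\<^sup>2)" using L2D V1D(1)[OF u(1)] by blast
  note i2 = V1_energy_integrable_square[OF u(1)]
  have "(LINT x|leb01. ?F x) \<le> ?W 1"
  proof (rule integral_le_boundary_value[where W = ?W])
    show "loc_abs_cont ?W"
      using V1D(2)[OF u(1)] loc_abs_cont_polynomial[of b] by (auto intro!: abs_cont_on_mult)
    show "0 \<le> ?W x" if "0 < x" for x using that b by simp
    show "integrable leb01 ?F" using i1 i2 by simp
    show "AE x in leb01. ?F x \<le> dx ?W x"
    proof -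
      have "AE x in leb01. 0 < x \<and> x < 1" by (rule AE_leb01_interior) simp
      with loc_abs_cont_AE_derivative[OF V1D(2)[OF u(1)]] show ?thesis
      proof eventually_elim
        case (elim x)
        then have "(?W has_real_derivative ((1 + b * (2 * x)) * (u x)\<^sup>2 + (x + b * x\<^sup>2) * (2 * u x * dx u x))) (at x)"
          by (auto intro!: derivative_eq_intros simp: power2_eq_square algebra_simps)
        then have "dx ?W x = (1 + b * (2 * x)) * (u x)\<^sup>2 + (x + b * x\<^sup>2) * (2 * u x * dx u x)"
          using elim by (intro dx_eq_at) auto
        then show ?case using pt[of x "u x" "dx u x"] elim by simp
      qed
    qed
  qed
  then show ?thesis using i1 i2 u(2) by simp
qed

text \<open>The constant is \<open>2/a(1)\<close> if \<open>\<mu> \<le> 1\<close> and \<open>4/a(1)\<close> otherwise; the first uses \<open>a \<ge> a(1) x\<close> and the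
  weight \<open>x + x\<^sup>2\<close>, the second \<open>a \<ge> a(1) x\<^sup>2\<close> and the weight \<open>x\<close>. Both are at most
  \<open>4 C_const\<close>, whose square root \<open>2 \<surd>C_const\<close> is the factor that enters the multiplier estimate.\<close>

lemma hardy_poincare:
  assumes u: "u \<in> V1 a" "u 1 = 0"
  shows "(LINT x|leb01. (u x)\<^sup>2) \<le> 4 * C_const a * (LINT x|leb01. a x * (dx u x)\<^sup>2)"
proof -
  let ?I = "LINT x|leb01. a x * (dx u x)\<^sup>2"
  have p: "0 < a 1" using coeff_pos by simp
  have I0: "0 \<le> ?I" by (rule Bochner_Integration.integral_nonneg_AE, rule AE_leb01_interior)
    (use coeff_pos in \<open>auto simp: less_imp_le\<close>)
  define K where "K = (if mu a \<le> 1 then 2 else (4::real))"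
  have "(LINT x|leb01. (u x)\<^sup>2) \<le> K / a 1 * ?I"
  proof (cases "mu a \<le> 1")
    case True
    have "1 * (LINT x|leb01. (u x)\<^sup>2) \<le> (2 / a 1) * ?I"
    proof (rule hardy_poincare_aux[OF u, of 1])
      fix x U D :: real assume x: "0 < x" "x < 1"
      have "x \<le> a x / a 1" using coeff_lower_bound[of 1 x] True x p by (simp add: field_simps)
      then have "x * D\<^sup>2 \<le> a x / a 1 * D\<^sup>2" by (rule mult_right_mono) simp
      then have 1: "2 * (x * D\<^sup>2) \<le> (2 / a 1) * (a x * D\<^sup>2)" by simp
      \<comment> \<open>Absorbs the mixed term \<open>(x + x\<^sup>2) 2 U D\<close> into the \<open>2 x U\<^sup>2\<close> coming from the derivative of the weight.\<close>
      have "0 \<le> x * (2 * U + (1 + x) * D)\<^sup>2 / 2" using x by simp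
      also have "\<dots> = 2 * x * U\<^sup>2 + (x + x\<^sup>2) * (2 * U * D) + x * (1 + x)\<^sup>2 / 2 * D\<^sup>2"
        by (simp add: power2_eq_square field_simps)
      also have "x * (1 + x)\<^sup>2 / 2 * D\<^sup>2 \<le> 2 * (x * D\<^sup>2)"
      proof -
        have "(1 + x)\<^sup>2 \<le> 2\<^sup>2" using x by (intro power_mono) auto
        then have "x * D\<^sup>2 / 2 * (1 + x)\<^sup>2 \<le> x * D\<^sup>2 / 2 * 4" using x by (intro mult_left_mono) auto
        then show ?thesis by (simp add: algebra_simps)
      qed
      finally have "0 \<le> 2 * x * U\<^sup>2 + (x + x\<^sup>2) * (2 * U * D) + 2 * (x * D\<^sup>2)" by simp
      moreover have "(1 + 1 * (2 * x)) * U\<^sup>2 + (x + 1 * x\<^sup>2) * (2 * U * D) = U\<^sup>2 + 2 * x * U\<^sup>2 + (x + x\<^sup>2) * (2 * U * D)"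
        by (simp add: algebra_simps)
      ultimately show "1 * U\<^sup>2 - (2 / a 1) * (a x * D\<^sup>2) \<le> (1 + 1 * (2 * x)) * U\<^sup>2 + (x + 1 * x\<^sup>2) * (2 * U * D)"
        using 1 by linarith
    qed simp
    then show ?thesis using True unfolding K_def by simp
  next
    case False
    have "(1/2) * (LINT x|leb01. (u x)\<^sup>2) \<le> (2 / a 1) * ?I"
    proof (rule hardy_poincare_aux[OF u, of 0])
      fix x U D :: real assume x: "0 < x" "x < 1"
      have "x\<^sup>2 \<le> a x / a 1" using coeff_lower_square[of x] x p by (simp add: field_simps)
      then have "x\<^sup>2 * D\<^sup>2 \<le> a x / a 1 * D\<^sup>2" by (rule mult_right_mono) simp
      then have 1: "2 * (x\<^sup>2 * D\<^sup>2) \<le> (2 / a 1) * (a x * D\<^sup>2)" by simp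
      have "0 \<le> (U + 2 * x * D)\<^sup>2 / 2" by simp
      also have "\<dots> = U\<^sup>2 / 2 + x * (2 * U * D) + 2 * (x\<^sup>2 * D\<^sup>2)"
        by (simp add: power2_eq_square field_simps)
      finally have "0 \<le> U\<^sup>2 / 2 + x * (2 * U * D) + 2 * (x\<^sup>2 * D\<^sup>2)" .
      moreover have "(1 + 0 * (2 * x)) * U\<^sup>2 + (x + 0 * x\<^sup>2) * (2 * U * D) = U\<^sup>2 + x * (2 * U * D)" by simp
      ultimately show "(1/2) * U\<^sup>2 - (2 / a 1) * (a x * D\<^sup>2) \<le> (1 + 0 * (2 * x)) * U\<^sup>2 + (x + 0 * x\<^sup>2) * (2 * U * D)"
        using 1 by linarith
    qed simp
    then show ?thesis using False unfolding K_def by simp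
  qed
  also have "\<dots> \<le> 4 * C_const a * ?I"
  proof (rule mult_right_mono[OF _ I0])
    have "K \<le> 4 * min 4 (1 / (2 - mu a))"
      using mu_nonneg mu_less_2 unfolding K_def by (auto simp: min_def field_simps)
    then show "K / a 1 \<le> 4 * C_const a"
      using p unfolding C_const_def by (simp add: divide_right_mono)
  qed
  finally show ?thesis .
qed

text \<open>Almost everywhere \<open>u' = g/a\<close> with \<open>g\<close> continuous, so \<open>u\<close> is continuously differentiable on
  \<open>]0,1]\<close> and the equality holds at every point. In particular it holds at \<open>1\<close>, where the trace is taken.\<close>

lemma H2a_flux:
  assumes u: "u \<in> H2a a"
  obtains g where "abs_cont_on {0..1} g" "dx g \<in> L2 {0<..<1}"
    "\<forall>x. 0 < x \<longrightarrow> x \<le> 1 \<longrightarrow> a x * dx u x = g x"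
    "\<forall>x. 0 < x \<longrightarrow> x < 1 \<longrightarrow> dx (\<lambda>x. a x * dx u x) x = dx g x"
proof -
  have uV: "u \<in> V1 a" using u unfolding H2a_def V2_def by auto
  obtain g where g: "abs_cont_on {0..1} g" "dx g \<in> L2 {0<..<1}" "AE x in leb01. a x * dx u x = g x"
    using u unfolding H2a_def V2_def H1_def by auto
  obtain N where N: "negligible N" "\<And>x. 0 < x \<Longrightarrow> x < 1 \<Longrightarrow> x \<notin> N \<Longrightarrow> a x * dx u x = g x"
    using AE_leb01_obtain[OF g(3)] by blast
  have der: "(u has_real_derivative g x / a x) (at x within {0..1})" if x: "0 < x" "x \<le> 1" for x
  proof -
    define c where "c = x / 2"
    have c: "0 < c" "c < x" "c < 1" using x unfolding c_def by auto
    have nz: "a y \<noteq> 0" if "y \<in> {c..1}" for y using coeff_pos[of y] that c by auto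
    have cont: "continuous_on {c..1} (\<lambda>y. g y / a y)"
      using c nz by (intro continuous_intros continuous_on_subset[OF coeff_continuous]
          continuous_on_subset[OF abs_cont_on_imp_continuous_on[OF g(1)]]) auto
    have eq: "u y = u c + integral {c..y} (\<lambda>y. g y / a y)" if y: "c \<le> y" "y \<le> 1" for y
    proof -
      have "(dx u has_integral u y - u c) {c..y}" using loc_abs_cont_FTC[OF V1D(2)[OF uV]] y c by simp
      then have "((\<lambda>y. g y / a y) has_integral u y - u c) {c..y}"
      proof (rule has_integral_spike[rotated 2])
        show "negligible (N \<union> {1})" using N(1) by (simp add: negligible_Un)
        show "g t / a t = dx u t" if "t \<in> {c..y} - (N \<union> {1})" for t
          using N(2)[of t] that y c coeff_pos[of t] by (auto simp: field_simps)
      qed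
      then show ?thesis by (simp add: integral_unique)
    qed
    have "((\<lambda>y. integral {c..y} (\<lambda>y. g y / a y)) has_real_derivative g x / a x) (at x within {c..1})"
      by (rule integral_has_real_derivative[OF cont]) (use c x in auto)
    then have "((\<lambda>y. u c + integral {c..y} (\<lambda>y. g y / a y)) has_real_derivative g x / a x) (at x within {c..1})"
      by (auto intro!: derivative_eq_intros)
    then have "(u has_real_derivative g x / a x) (at x within {c..1})"
    proof (rule has_field_derivative_transform_within[of _ _ _ _ 1])
      show "u c + integral {c..y} (\<lambda>y. g y / a y) = u y" if "y \<in> {c..1}" for y
        using eq[of y] that by simp
    qed (use c x in auto)
    moreover have "at x within {c..1} = at x within {0..1}"
      by (rule at_within_nhd[of x "{c<..}"]) (use c in auto)
    ultimately show ?thesis by simp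
  qed
  have val: "dx u x = g x / a x" if "0 < x" "x \<le> 1" for x
    using dx_eq[OF der[OF that]] that by simp
  have flux: "a x * dx u x = g x" if "0 < x" "x \<le> 1" for x
    using val[OF that] coeff_pos[OF that] by simp
  have dd: "dx (\<lambda>x. a x * dx u x) x = dx g x" if "0 < x" "x < 1" for x
    by (rule dx_cong) (use flux that in auto)
  show thesis using that[OF g(1,2)] flux dd by blast
qed

lemma H2a_operator_L2:
  assumes u: "u \<in> H2a a"
  shows "dx (\<lambda>x. a x * dx u x) \<in> L2 {0<..<1}"
proof -
  obtain g where g: "dx g \<in> L2 {0<..<1}"
    "\<forall>x. 0 < x \<longrightarrow> x < 1 \<longrightarrow> dx (\<lambda>x. a x * dx u x) x = dx g x" by (rule H2a_flux[OF u], rule that)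
  show ?thesis by (rule L2_AE_cong[OF g(1)], rule AE_leb01_interior) (use g in simp)
qed

text \<open>The integrand is a lower bound for the derivative of \<open>W = (x v\<^sup>2 + (x/a) (a u')\<^sup>2)/2\<close>. In terms of
  the flux \<open>g = a u'\<close> the last summand is \<open>(x/a) g\<^sup>2/2\<close>, a product of absolutely continuous functions
  whose derivative is \<open>(a - x a') u'\<^sup>2/2 + x u' f\<close>.\<close>

lemma multiplier_inequality:
  assumes u: "u \<in> H2a a" and v: "v \<in> V1 a" "v 1 = 0"
  defines "f \<equiv> dx (\<lambda>x. a x * dx u x)"
  shows "(LINT x|leb01. 1/2 * (v x)\<^sup>2 + x * dx v x * v x + (1 - mu a) / 2 * (a x * (dx u x)\<^sup>2) + x * dx u x * f x)
     \<le> 1/2 * (a 1 * (dx u 1)\<^sup>2)"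
proof -
  have uV: "u \<in> V1 a" using u unfolding H2a_def V2_def by auto
  obtain g where g: "abs_cont_on {0..1} g" "dx g \<in> L2 {0<..<1}"
    "\<forall>x. 0 < x \<longrightarrow> x \<le> 1 \<longrightarrow> a x * dx u x = g x"
    "\<forall>x. 0 < x \<longrightarrow> x < 1 \<longrightarrow> dx (\<lambda>x. a x * dx u x) x = dx g x" by (rule H2a_flux[OF u], rule that)
  have gl: "loc_abs_cont g" using abs_cont_on_subset[OF g(1)] by auto
  have fL: "f \<in> L2 {0<..<1}" unfolding f_def by (rule H2a_operator_L2[OF u])
  let ?F = "\<lambda>x. 1/2 * (v x)\<^sup>2 + x * dx v x * v x + (1 - mu a) / 2 * (a x * (dx u x)\<^sup>2) + x * dx u x * f x"
  \<comment> \<open>The summand \<open>0 * x\<^sup>2\<close> only brings the weight into the form of \<open>loc_abs_cont_polynomial\<close>.\<close>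
  let ?W = "\<lambda>x. 1/2 * ((x + 0 * x\<^sup>2) * (v x * v x)) + 1/2 * ((x / a x) * (g x * g x))"
  have "(LINT x|leb01. ?F x) \<le> ?W 1"
  proof (rule integral_le_boundary_value[where W = ?W])
    show "loc_abs_cont ?W"
    proof
      fix c :: real assume c: "c \<in> {0<..1}"
      have "abs_cont_on {c..1} v" "abs_cont_on {c..1} g" "abs_cont_on {c..1} (\<lambda>x. x + 0 * x\<^sup>2)"
        using c V1D(2)[OF v(1)] gl loc_abs_cont_polynomial[of 0] by blast+
      moreover have "abs_cont_on {c..1} (\<lambda>x. x / a x)" using c by (intro coeff_quotient_abs_cont) auto
      ultimately show "abs_cont_on {c..1} ?W"
        by (intro abs_cont_on_lincomb abs_cont_on_mult)
    qed
    show "0 \<le> ?W x" if "0 < x" "x \<le> 1" for x using that coeff_pos[OF that] by simp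
    have "integrable leb01 (\<lambda>x. (v x)\<^sup>2)" using L2D V1D(1)[OF v(1)] by blast
    moreover have "integrable leb01 (\<lambda>x. x * dx v x * v x)"
      by (rule L2_mult_integrable[OF V1_weighted_L2[OF v(1)] V1D(1)[OF v(1)]])
    moreover have "integrable leb01 (\<lambda>x. x * dx u x * f x)"
      by (rule L2_mult_integrable[OF V1_weighted_L2[OF uV] fL])
    ultimately show "integrable leb01 ?F" using V1_energy_integrable_square[OF uV] by simp
    show "AE x in leb01. ?F x \<le> dx ?W x"
    proof -
      have "AE x in leb01. 0 < x \<and> x < 1" by (rule AE_leb01_interior) simp
      with loc_abs_cont_AE_derivative[OF V1D(2)[OF v(1)]] loc_abs_cont_AE_derivative[OF gl] show ?thesis
      proof eventually_elim
        case (elim x)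
        then have x: "0 < x" "x < 1" "x \<le> 1" by auto
        note pos = coeff_pos[OF x(1,3)] and ad = coeff_derivative[OF x(1,2)]
        let ?d = "1/2 * (v x)\<^sup>2 + x * dx v x * v x + 1/2 * ((a x - x * dx a x) / (a x * a x) * (g x * g x)) + (x / a x) * g x * dx g x"
        have "(?W has_real_derivative ?d) (at x)"
        proof -
          have q: "((\<lambda>x. x / a x) has_real_derivative ((a x - x * dx a x) / (a x * a x))) (at x)"
            using ad pos by (auto intro!: derivative_eq_intros)
          have p: "((\<lambda>x. x + 0 * x\<^sup>2) has_real_derivative 1) (at x)"
            by (auto intro!: derivative_eq_intros)
          have "(?W has_real_derivative
              1/2 * (1 * (v x * v x) + (dx v x * v x + dx v x * v x) * (x + 0 * x\<^sup>2)) +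
              1/2 * ((a x - x * dx a x) / (a x * a x) * (g x * g x) + (dx g x * g x + dx g x * g x) * (x / a x))) (at x)"
            by (intro DERIV_add DERIV_cmult DERIV_mult p q elim(1,2))
          then show ?thesis
            by (rule DERIV_cong) (simp add: power2_eq_square algebra_simps)
        qed
        then have 1: "dx ?W x = ?d" using x by (intro dx_eq_at) auto
        have gx: "g x = a x * dx u x" using g(3)[rule_format, of x] x by simp
        have 2: "(x / a x) * g x * dx g x = x * dx u x * f x"
          unfolding f_def g(4)[rule_format, OF x(1,2)] using gx pos by simp
        have 3: "(a x - x * dx a x) / (a x * a x) * (g x * g x) = (a x - x * dx a x) * (dx u x)\<^sup>2"
          unfolding gx using pos by (simp add: power2_eq_square)
        have "x * dx a x \<le> mu a * a x"
          using coeff_logderiv[OF x(1,3)] mult_left_mono[of "dx a x" "\<bar>dx a x\<bar>" x] x by linarith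
        then have "(1 - mu a) * a x * (dx u x)\<^sup>2 \<le> (a x - x * dx a x) * (dx u x)\<^sup>2"
          by (intro mult_right_mono) (auto simp: algebra_simps)
        then show ?case unfolding 1 2 3 by (simp add: mult.assoc)
      qed
    qed
  qed
  also have "?W 1 = 1/2 * (a 1 * (dx u 1)\<^sup>2)"
    using g(3)[rule_format, of 1, symmetric] v(2) coeff_pos[of 1] by (simp add: power2_eq_square)
  finally show ?thesis .
qed

end

section \<open>The energy space and its bounded bilinear forms\<close>

text \<open>The derivative is additive only where both functions are differentiable.\<close>

lemma dx_lincomb_AE:
  assumes "loc_abs_cont u" "loc_abs_cont v"
  shows "AE x in leb01. dx (\<lambda>x. c * u x + d * v x) x = c * dx u x + d * dx v x"
proof -
  have "AE x in leb01. 0 < x \<and> x < 1" by (rule AE_leb01_interior) simp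
  with assms[THEN loc_abs_cont_AE_derivative] show ?thesis
  proof eventually_elim
    case (elim x)
    have "((\<lambda>x. c * u x + d * v x) has_real_derivative (c * dx u x + d * dx v x)) (at x)"
      by (intro DERIV_add DERIV_cmult elim)
    then show ?case using elim by (intro dx_eq_at) auto
  qed
qed

lemma H1a_lincomb:
  assumes "u \<in> H1a a" "v \<in> H1a a"
  shows "(\<lambda>x. c * u x + d * v x) \<in> H1a a"
proof -
  let ?w = "\<lambda>x. c * u x + d * v x"
  have u: "u \<in> L2 {0<..<1}" "loc_abs_cont u" "(\<lambda>x. sqrt (a x) * dx u x) \<in> L2 {0<..<1}" "u 1 = 0"
    and v: "v \<in> L2 {0<..<1}" "loc_abs_cont v" "(\<lambda>x. sqrt (a x) * dx v x) \<in> L2 {0<..<1}" "v 1 = 0"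
    using assms unfolding H1a_def V1_def by auto
  have "(\<lambda>x. c * (sqrt (a x) * dx u x) + d * (sqrt (a x) * dx v x)) \<in> L2 {0<..<1}"
    by (rule L2_lincomb[OF u(3) v(3)])
  then have "(\<lambda>x. sqrt (a x) * dx ?w x) \<in> L2 {0<..<1}"
  proof (rule L2_AE_cong)
    show "AE x in leb01. c * (sqrt (a x) * dx u x) + d * (sqrt (a x) * dx v x) = sqrt (a x) * dx ?w x"
      using dx_lincomb_AE[OF u(2) v(2), of c d] by eventually_elim (simp add: algebra_simps)
  qed
  moreover have "?w \<in> L2 {0<..<1}" by (rule L2_lincomb[OF u(1) v(1)])
  moreover have "loc_abs_cont ?w" using u(2) v(2) abs_cont_on_lincomb by blast
  moreover have "(?w \<longlongrightarrow> 0) (at_right 0)" if "mu a < 1"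
  proof -
    have "(u \<longlongrightarrow> 0) (at_right 0)" "(v \<longlongrightarrow> 0) (at_right 0)" using assms that unfolding H1a_def by auto
    then have "(?w \<longlongrightarrow> c * 0 + d * 0) (at_right 0)" by (intro tendsto_intros)
    then show ?thesis by simp
  qed
  ultimately show ?thesis using u(4) v(4) unfolding H1a_def V1_def by simp
qed

lemma state_spaceD:
  assumes "p \<in> state_space a"
  shows "fst p \<in> H1a a" "fst p \<in> V1 a" "fst p 1 = 0" "snd p \<in> L2 {0<..<1}"
  using assms unfolding state_space_def H1a_def by auto

lemma lincomb_state_space:
  assumes "p \<in> state_space a" "q \<in> state_space a"
  shows "lincomb c p d q \<in> state_space a"
  using assms H1a_lincomb L2_lincomb unfolding state_space_def lincomb_def by auto

lemma dom_A_subset_state_space: "dom_A a \<subseteq> state_space a"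
  unfolding dom_A_def state_space_def H2a_def H1a_def V1_def by auto

text \<open>The bound is additive rather than multiplicative because this is what integrating a pointwise
  inequality \<open>2 \<bar>y z\<bar> \<le> y\<^sup>2 + z\<^sup>2\<close> yields; rescaling the arguments turns it into the multiplicative
  one.\<close>

definition bounded_form :: "(real \<Rightarrow> real) \<Rightarrow> real \<Rightarrow> (state \<Rightarrow> state \<Rightarrow> real) \<Rightarrow> bool" where
  "bounded_form a K b \<longleftrightarrow> 0 \<le> K \<and>
     (\<forall>p\<in>state_space a. \<forall>q\<in>state_space a. \<forall>r\<in>state_space a. \<forall>c d.
        b (lincomb c p d q) r = c * b p r + d * b q r \<and> b r (lincomb c p d q) = c * b r p + d * b r q) \<and>
     (\<forall>p\<in>state_space a. \<forall>q\<in>state_space a. \<bar>b p q\<bar> \<le> K * (inner_state a p p + inner_state a q q))"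

lemma lincomb_sub_lincomb:
  "lincomb 1 (lincomb c p d q) (-1) (lincomb c p' d q') = lincomb c (lincomb 1 p (-1) p') d (lincomb 1 q (-1) q')"
  unfolding lincomb_def by (auto simp: algebra_simps)

context
  fixes a :: "real \<Rightarrow> real"
  assumes standing: "standing a"
begin

lemma inner_state_integrable:
  assumes "p \<in> state_space a" "q \<in> state_space a"
  shows "integrable leb01 (\<lambda>x. snd p x * snd q x)" "integrable leb01 (\<lambda>x. a x * dx (fst p) x * dx (fst q) x)"
  using assms by (auto intro!: L2_mult_integrable V1_energy_integrable[OF standing] dest: state_spaceD)

lemma inner_state_split:
  assumes "p \<in> state_space a" "q \<in> state_space a"
  shows "inner_state a p q = (LINT x|leb01. snd p x * snd q x) + (LINT x|leb01. a x * dx (fst p) x * dx (fst q) x)"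
  unfolding inner_state_def
  by (rule Bochner_Integration.integral_add) (use inner_state_integrable[OF assms] in auto)

lemma inner_state_self:
  assumes "p \<in> state_space a"
  shows "inner_state a p p = (LINT x|leb01. (snd p x)\<^sup>2) + (LINT x|leb01. a x * (dx (fst p) x)\<^sup>2)"
  using inner_state_split[OF assms assms] by (simp add: power2_eq_square mult.assoc)

lemma energy_integral_nonneg: "0 \<le> (LINT x|leb01. a x * (dx u x)\<^sup>2)"
  by (rule Bochner_Integration.integral_nonneg_AE, rule AE_leb01_interior)
    (use coeff_pos[OF standing] in \<open>auto simp: less_imp_le\<close>)

lemma inner_state_nonneg:
  assumes "p \<in> state_space a"
  shows "0 \<le> inner_state a p p"
  unfolding inner_state_self[OF assms] using energy_integral_nonneg by simp

lemma inner_state_commute: "inner_state a p q = inner_state a q p"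
  unfolding inner_state_def by (simp add: mult.commute mult.left_commute)

lemma inner_state_lincomb_left:
  assumes p: "p \<in> state_space a" and q: "q \<in> state_space a" and r: "r \<in> state_space a"
  shows "inner_state a (lincomb c p d q) r = c * inner_state a p r + d * inner_state a q r"
proof -
  have "inner_state a (lincomb c p d q) r =
    (LINT x|leb01. c * (snd p x * snd r x + a x * dx (fst p) x * dx (fst r) x) +
                   d * (snd q x * snd r x + a x * dx (fst q) x * dx (fst r) x))"
    unfolding inner_state_def
  proof (rule integral_cong_AE)
    show "AE x in leb01. snd (lincomb c p d q) x * snd r x + a x * dx (fst (lincomb c p d q)) x * dx (fst r) x =
       c * (snd p x * snd r x + a x * dx (fst p) x * dx (fst r) x) +
                   d * (snd q x * snd r x + a x * dx (fst q) x * dx (fst r) x)"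
      using dx_lincomb_AE[of "fst p" "fst q" c d] state_spaceD(2)[OF p] state_spaceD(2)[OF q] V1D(2)[OF standing]
      unfolding lincomb_def by (auto elim!: eventually_mono simp: algebra_simps)
    show "(\<lambda>x. snd (lincomb c p d q) x * snd r x + a x * dx (fst (lincomb c p d q)) x * dx (fst r) x) \<in> borel_measurable leb01"
      using inner_state_integrable[OF lincomb_state_space[OF p q, of c d] r] by auto
    show "(\<lambda>x. c * (snd p x * snd r x + a x * dx (fst p) x * dx (fst r) x) +
                   d * (snd q x * snd r x + a x * dx (fst q) x * dx (fst r) x)) \<in> borel_measurable leb01"
      using inner_state_integrable[OF p r] inner_state_integrable[OF q r] by auto
  qed
  also have "\<dots> = c * inner_state a p r + d * inner_state a q r"
    unfolding inner_state_def using inner_state_integrable[OF p r] inner_state_integrable[OF q r] by simp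
  finally show ?thesis .
qed


text \<open>Positivity at \<open>p \<plusminus> q\<close> gives the bound.\<close>

lemma bounded_form_inner_state: "bounded_form a (1/2) (inner_state a)"
  unfolding bounded_form_def
proof (intro conjI ballI allI)
  fix p q r c d assume p: "p \<in> state_space a" and q: "q \<in> state_space a" and r: "r \<in> state_space a"
  show "inner_state a (lincomb c p d q) r = c * inner_state a p r + d * inner_state a q r"
    by (rule inner_state_lincomb_left[OF p q r])
  then show "inner_state a r (lincomb c p d q) = c * inner_state a r p + d * inner_state a r q"
    using inner_state_commute[of r p] inner_state_commute[of r q] inner_state_commute[of r "lincomb c p d q"] by simp
next
  fix p q assume p: "p \<in> state_space a" and q: "q \<in> state_space a"
  have "0 \<le> inner_state a (lincomb 1 p c q) (lincomb 1 p c q)" for c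
    by (rule inner_state_nonneg[OF lincomb_state_space[OF p q]])
  moreover have "inner_state a (lincomb 1 p c q) (lincomb 1 p c q)
     = inner_state a p p + 2 * c * inner_state a p q + c\<^sup>2 * inner_state a q q" for c
  proof -
    let ?l = "lincomb 1 p c q"
    have "inner_state a ?l ?l = 1 * inner_state a p ?l + c * inner_state a q ?l"
      by (rule inner_state_lincomb_left[OF p q lincomb_state_space[OF p q]])
    moreover have "inner_state a p ?l = 1 * inner_state a p p + c * inner_state a q p"
      by (subst inner_state_commute) (rule inner_state_lincomb_left[OF p q p])
    moreover have "inner_state a q ?l = 1 * inner_state a p q + c * inner_state a q q"
      by (subst inner_state_commute) (rule inner_state_lincomb_left[OF p q q])
    moreover have "inner_state a q p = inner_state a p q" by (rule inner_state_commute)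
    ultimately show ?thesis by (simp add: power2_eq_square algebra_simps)
  qed
  ultimately have "0 \<le> inner_state a p p + 2 * c * inner_state a p q + c\<^sup>2 * inner_state a q q" for c by simp
  from this[of 1] this[of "-1"]
  show "\<bar>inner_state a p q\<bar> \<le> 1/2 * (inner_state a p p + inner_state a q q)" by simp
qed simp

lemma norm_state_square:
  assumes "p \<in> state_space a" shows "(norm_state a p)\<^sup>2 = inner_state a p p"
  unfolding norm_state_def using inner_state_nonneg[OF assms] by simp

lemma norm_state_nonneg: "p \<in> state_space a \<Longrightarrow> 0 \<le> norm_state a p"
  unfolding norm_state_def using inner_state_nonneg by simp

lemma bounded_form_lincomb:
  assumes "bounded_form a K b" "p \<in> state_space a" "q \<in> state_space a" "r \<in> state_space a"
  shows "b (lincomb c p d q) r = c * b p r + d * b q r" "b r (lincomb c p d q) = c * b r p + d * b r q"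
  using assms unfolding bounded_form_def by blast+

lemma inner_state_scale:
  assumes p: "p \<in> state_space a"
  shows "inner_state a (lincomb c p 0 p) (lincomb c p 0 p) = c\<^sup>2 * inner_state a p p"
  using bounded_form_lincomb[OF bounded_form_inner_state p p] p lincomb_state_space[OF p p]
  by (simp add: power2_eq_square)

text \<open>Replace \<open>p\<close> and \<open>q\<close> by \<open>\<surd>s p\<close> and \<open>q/\<surd>s\<close> and choose \<open>s = \<parallel>q\<parallel>/\<parallel>p\<parallel>\<close>. Adding \<open>\<eta>\<close> to both norms avoids a
  case distinction when one of them is zero. For the inner product this is the Cauchy-Schwarz
  inequality.\<close>

lemma bounded_form_le_norm:
  assumes b: "bounded_form a K b" and p: "p \<in> state_space a" and q: "q \<in> state_space a"
  shows "\<bar>b p q\<bar> \<le> 2 * K * (norm_state a p * norm_state a q)"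
proof -
  let ?P = "norm_state a p" and ?Q = "norm_state a q"
  have P: "0 \<le> ?P" and Q: "0 \<le> ?Q" using norm_state_nonneg p q by auto
  have K: "0 \<le> K" using b unfolding bounded_form_def by blast
  have scaled: "\<bar>b p q\<bar> \<le> K * (s * ?P\<^sup>2 + (1 / s) * ?Q\<^sup>2)" if s: "0 < s" for s
  proof -
    let ?p = "lincomb (sqrt s) p 0 p" and ?q = "lincomb (1 / sqrt s) q 0 q"
    have in': "?p \<in> state_space a" "?q \<in> state_space a" using lincomb_state_space p q by auto
    have "b ?p ?q = sqrt s * (1 / sqrt s) * b p q"
      using bounded_form_lincomb[OF b] p q in' by simp
    then have "b ?p ?q = b p q" using s by simp
    moreover have "\<bar>b ?p ?q\<bar> \<le> K * (inner_state a ?p ?p + inner_state a ?q ?q)"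
      using b in' unfolding bounded_form_def by blast
    ultimately show ?thesis
      using s by (simp add: inner_state_scale p q norm_state_square power_divide)
  qed
  have "\<bar>b p q\<bar> \<le> 2 * K * (?P * ?Q) + e" if "0 < e" for e
  proof -
    \<comment> \<open>The perturbation costs \<open>\<eta> K (\<parallel>p\<parallel> + \<parallel>q\<parallel>)\<close>.\<close>
    define \<eta> where "\<eta> = e / (K * (?P + ?Q) + 1)"
    have den: "0 < K * (?P + ?Q) + 1" using K P Q by (intro add_nonneg_pos mult_nonneg_nonneg) auto
    have \<eta>: "0 < \<eta>" unfolding \<eta>_def using \<open>0 < e\<close> den by simp
    let ?s = "(?Q + \<eta>) / (?P + \<eta>)"
    have s: "0 < ?s" using P Q \<eta> by (intro divide_pos_pos) auto
    have le: "y / (y + \<eta>) * y \<le> y" if "0 \<le> y" for y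
      using that \<eta> by (intro mult_left_le_one_le) (auto simp: divide_le_eq)
    have "?s * ?P\<^sup>2 = (?Q + \<eta>) * (?P / (?P + \<eta>) * ?P)" by (simp add: power2_eq_square)
    also have "\<dots> \<le> (?Q + \<eta>) * ?P" using le[OF P] Q \<eta> by (intro mult_left_mono) auto
    finally have 1: "?s * ?P\<^sup>2 \<le> (?Q + \<eta>) * ?P" .
    have "(1 / ?s) * ?Q\<^sup>2 = (?P + \<eta>) * (?Q / (?Q + \<eta>) * ?Q)" by (simp add: power2_eq_square)
    also have "\<dots> \<le> (?P + \<eta>) * ?Q" using le[OF Q] P \<eta> by (intro mult_left_mono) auto
    finally have 2: "(1 / ?s) * ?Q\<^sup>2 \<le> (?P + \<eta>) * ?Q" .
    have "\<bar>b p q\<bar> \<le> K * (?s * ?P\<^sup>2 + (1 / ?s) * ?Q\<^sup>2)" by (rule scaled[OF s])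
    also have "\<dots> \<le> K * ((?Q + \<eta>) * ?P + (?P + \<eta>) * ?Q)"
      using 1 2 K by (intro mult_left_mono) auto
    also have "\<dots> = 2 * K * (?P * ?Q) + \<eta> * (K * (?P + ?Q))" by (simp add: algebra_simps)
    also have "\<eta> * (K * (?P + ?Q)) \<le> \<eta> * (K * (?P + ?Q) + 1)" using \<eta> by simp
    also have "\<eta> * (K * (?P + ?Q) + 1) = e" unfolding \<eta>_def using den by simp
    finally show ?thesis by simp
  qed
  then show ?thesis by (rule field_le_epsilon)
qed

lemma norm_state_lincomb_le:
  assumes p: "p \<in> state_space a" and q: "q \<in> state_space a"
  shows "norm_state a (lincomb c p d q) \<le> \<bar>c\<bar> * norm_state a p + \<bar>d\<bar> * norm_state a q"
proof (rule power2_le_imp_le)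
  let ?l = "lincomb c p d q"
  have l: "?l \<in> state_space a" by (rule lincomb_state_space[OF p q])
  note bl = bounded_form_lincomb[OF bounded_form_inner_state]
  have "(norm_state a ?l)\<^sup>2 = c\<^sup>2 * inner_state a p p + 2 * (c * d * inner_state a p q) + d\<^sup>2 * inner_state a q q"
    unfolding norm_state_square[OF l] bl(1)[OF p q l] bl(2)[OF p q p] bl(2)[OF p q q]
    by (simp add: inner_state_commute[of q p] power2_eq_square algebra_simps)
  also have "c * d * inner_state a p q \<le> \<bar>c\<bar> * \<bar>d\<bar> * (norm_state a p * norm_state a q)"
  proof -
    have "c * d * inner_state a p q \<le> \<bar>c * d\<bar> * \<bar>inner_state a p q\<bar>" by (metis abs_ge_self abs_mult)
    also have "\<dots> \<le> \<bar>c * d\<bar> * (norm_state a p * norm_state a q)"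
      using bounded_form_le_norm[OF bounded_form_inner_state p q] by (intro mult_left_mono) auto
    finally show ?thesis by (simp add: abs_mult)
  qed
  finally show "(norm_state a ?l)\<^sup>2 \<le> (\<bar>c\<bar> * norm_state a p + \<bar>d\<bar> * norm_state a q)\<^sup>2"
    using norm_state_square[OF p, symmetric] norm_state_square[OF q, symmetric]
    by (simp add: power2_eq_square algebra_simps abs_mult_self_eq)
  show "0 \<le> \<bar>c\<bar> * norm_state a p + \<bar>d\<bar> * norm_state a q"
    using norm_state_nonneg p q by simp
qed

lemma dist_state_nonneg: "p \<in> state_space a \<Longrightarrow> q \<in> state_space a \<Longrightarrow> 0 \<le> dist_state a p q"
  unfolding dist_state_def by (intro norm_state_nonneg lincomb_state_space)

lemma dist_state_refl: "dist_state a p p = 0"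
proof -
  have "lincomb 1 p (-1) p = ((\<lambda>x. 0), (\<lambda>x. 0))" unfolding lincomb_def by simp
  moreover have "AE x in leb01. dx (\<lambda>x. 0) x = 0"
    by (rule AE_leb01_interior) (auto intro: dx_eq_at)
  then have "(LINT x|leb01. a x * dx (\<lambda>x. 0) x * dx (\<lambda>x. 0) x) = (LINT x|leb01. 0)"
    by (intro Bochner_Integration.integral_cong refl) (auto intro: dx_eq_at simp: dx_eq_at[of "\<lambda>x. 0" 0])
  ultimately show ?thesis unfolding dist_state_def norm_state_def inner_state_def by simp
qed

lemma dist_state_commute:
  assumes "p \<in> state_space a" "q \<in> state_space a"
  shows "dist_state a p q = dist_state a q p"
proof -
  have le: "dist_state a p q \<le> dist_state a q p" if "p \<in> state_space a" "q \<in> state_space a" for p q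
  proof -
    let ?l = "lincomb 1 q (-1) p"
    have "lincomb 1 p (-1) q = lincomb (-1) ?l 0 ?l" unfolding lincomb_def by auto
    then show ?thesis unfolding dist_state_def
      using norm_state_lincomb_le[of ?l ?l "-1" 0] lincomb_state_space[OF that(2,1)] by simp
  qed
  then show ?thesis using assms by (intro antisym)
qed

lemma dist_state_triangle:
  assumes "p \<in> state_space a" "q \<in> state_space a" "r \<in> state_space a"
  shows "dist_state a p r \<le> dist_state a p q + dist_state a q r"
proof -
  have "lincomb 1 p (-1) r = lincomb 1 (lincomb 1 p (-1) q) 1 (lincomb 1 q (-1) r)"
    unfolding lincomb_def by auto
  then show ?thesis unfolding dist_state_def
    using norm_state_lincomb_le[of "lincomb 1 p (-1) q" "lincomb 1 q (-1) r" 1 1] lincomb_state_space assms by simp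
qed

lemma norm_state_le_dist:
  assumes "p \<in> state_space a" "q \<in> state_space a"
  shows "norm_state a p \<le> norm_state a q + dist_state a p q"
proof -
  have "p = lincomb 1 q 1 (lincomb 1 p (-1) q)" unfolding lincomb_def by (cases p) auto
  then show ?thesis unfolding dist_state_def
    using norm_state_lincomb_le[of q "lincomb 1 p (-1) q" 1 1] lincomb_state_space assms by simp
qed

lemma dist_state_lincomb_le:
  assumes "p \<in> state_space a" "q \<in> state_space a" "p' \<in> state_space a" "q' \<in> state_space a"
  shows "dist_state a (lincomb c p d q) (lincomb c p' d q') \<le> \<bar>c\<bar> * dist_state a p p' + \<bar>d\<bar> * dist_state a q q'"
  unfolding dist_state_def lincomb_sub_lincomb
  by (rule norm_state_lincomb_le) (use assms lincomb_state_space in auto)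

lemma dist_state_cong:
  assumes "eq_state a p p'" "eq_state a q q'"
    and "p \<in> state_space a" "q \<in> state_space a" "p' \<in> state_space a" "q' \<in> state_space a"
  shows "dist_state a p q = dist_state a p' q'"
proof -
  have "dist_state a p q \<le> dist_state a p' q'"
    if "dist_state a p p' = 0" "dist_state a q q' = 0"
      "p \<in> state_space a" "q \<in> state_space a" "p' \<in> state_space a" "q' \<in> state_space a" for p q p' q'
    using dist_state_triangle[of p p' q] dist_state_triangle[of p' q' q] dist_state_commute[of q q'] that by simp
  from this[of p p' q q'] this[of p' p q' q] show ?thesis
    using assms dist_state_commute unfolding eq_state_def by fastforce
qed

lemma eq_state_refl: "eq_state a p p"
  unfolding eq_state_def by (rule dist_state_refl)

lemma eq_state_sym: "eq_state a p q \<Longrightarrow> p \<in> state_space a \<Longrightarrow> q \<in> state_space a \<Longrightarrow> eq_state a q p"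
  unfolding eq_state_def using dist_state_commute by simp

lemma eq_state_trans:
  assumes "eq_state a p q" "eq_state a q r" "p \<in> state_space a" "q \<in> state_space a" "r \<in> state_space a"
  shows "eq_state a p r"
  using dist_state_triangle[OF assms(3-5)] dist_state_nonneg[OF assms(3,5)] assms(1,2)
  unfolding eq_state_def by simp

lemma norm_state_cong:
  assumes "eq_state a p q" "p \<in> state_space a" "q \<in> state_space a"
  shows "norm_state a p = norm_state a q"
  using norm_state_le_dist[OF assms(2,3)] norm_state_le_dist[OF assms(3,2)] dist_state_commute[OF assms(2,3)] assms(1)
  unfolding eq_state_def by simp

lemma bounded_form_diff_le:
  assumes b: "bounded_form a K b"
    and p: "p \<in> state_space a" "p' \<in> state_space a" and q: "q \<in> state_space a" "q' \<in> state_space a"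
  shows "\<bar>b p q - b p' q'\<bar> \<le> 2 * K * (dist_state a p p' * norm_state a q + norm_state a p' * dist_state a q q')"
proof -
  have "b p q - b p' q' = b (lincomb 1 p (-1) p') q + b p' (lincomb 1 q (-1) q')"
    using bounded_form_lincomb[OF b] p q by simp
  then have "\<bar>b p q - b p' q'\<bar> \<le> \<bar>b (lincomb 1 p (-1) p') q\<bar> + \<bar>b p' (lincomb 1 q (-1) q')\<bar>" by simp
  also have "\<dots> \<le> 2 * K * (dist_state a p p' * norm_state a q) + 2 * K * (norm_state a p' * dist_state a q q')"
    unfolding dist_state_def
    by (intro add_mono bounded_form_le_norm[OF b]) (use p q lincomb_state_space in auto)
  finally show ?thesis by (simp add: algebra_simps)
qed

lemma bounded_form_cong:
  assumes b: "bounded_form a K b" and "eq_state a p p'" "eq_state a q q'"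
    and "p \<in> state_space a" "p' \<in> state_space a" "q \<in> state_space a" "q' \<in> state_space a"
  shows "b p q = b p' q'"
  using bounded_form_diff_le[OF b, of p p' q q'] assms unfolding eq_state_def by simp

text \<open>Equal states have almost everywhere equal derivatives and the common value \<open>0\<close> at \<open>1\<close>. Hence the
  trace at \<open>1\<close> depends on the state alone and not on its representative.\<close>

lemma eq_state_fst:
  assumes eq: "eq_state a p q" and p: "p \<in> state_space a" and q: "q \<in> state_space a" and x: "0 < x" "x \<le> 1"
  shows "fst p x = fst q x"
proof -
  let ?l = "lincomb 1 p (-1) q"
  have l: "?l \<in> state_space a" by (rule lincomb_state_space[OF p q])
  have "inner_state a ?l ?l = 0"
    using eq norm_state_square[OF l] unfolding eq_state_def dist_state_def by simp
  moreover have "0 \<le> (LINT x|leb01. (snd ?l x)\<^sup>2)" by simp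
  ultimately have "(LINT x|leb01. a x * (dx (fst ?l) x)\<^sup>2) = 0"
    using inner_state_self[OF l] energy_integral_nonneg[of "fst ?l"] by linarith
  moreover have "AE x in leb01. 0 \<le> a x * (dx (fst ?l) x)\<^sup>2"
    by (rule AE_leb01_interior) (use coeff_pos[OF standing] in \<open>auto simp: less_imp_le\<close>)
  ultimately have "AE x in leb01. a x * (dx (fst ?l) x)\<^sup>2 = 0"
    using V1_energy_integrable_square[OF standing state_spaceD(2)[OF l]] integral_nonneg_eq_0_iff_AE by blast
  then obtain N where N: "negligible N" "\<And>x. 0 < x \<Longrightarrow> x < 1 \<Longrightarrow> x \<notin> N \<Longrightarrow> a x * (dx (fst ?l) x)\<^sup>2 = 0"
    using AE_leb01_obtain[of "\<lambda>x. a x * (dx (fst ?l) x)\<^sup>2 = 0"] by blast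
  have "(dx (fst ?l) has_integral fst ?l 1 - fst ?l x) {x..1}"
    by (rule loc_abs_cont_FTC) (use V1D(2)[OF standing state_spaceD(2)[OF l]] x in auto)
  moreover have "(dx (fst ?l) has_integral 0) {x..1}"
  proof (rule has_integral_spike[of "N \<union> {1}" _ _ "\<lambda>x. 0"])
    show "negligible (N \<union> {1})" using N(1) by (simp add: negligible_Un)
    show "dx (fst ?l) y = 0" if "y \<in> {x..1} - (N \<union> {1})" for y
      using N(2)[of y] coeff_pos[OF standing, of y] that x by auto
  qed simp
  ultimately have "fst ?l 1 - fst ?l x = 0" by (rule has_integral_unique)
  then show ?thesis using state_spaceD(3)[OF l] unfolding lincomb_def by simp
qed

end

section \<open>Orbits of the semigroup\<close>

text \<open>A Lipschitz function is the integral of its derivative, and almost everywhere the derivative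
  agrees with the right derivative.\<close>

lemma lipschitz_right_derivative_bound:
  fixes G \<psi> R :: "real \<Rightarrow> real"
  assumes T: "0 \<le> T" and L: "\<And>s t. 0 \<le> s \<Longrightarrow> s \<le> t \<Longrightarrow> \<bar>G t - G s\<bar> \<le> L * (t - s)" "0 \<le> L"
    and R: "\<And>t. 0 \<le> t \<Longrightarrow> ((\<lambda>h. (G (t + h) - G t) / h) \<longlongrightarrow> R t) (at_right 0)"
    and le: "\<And>t. 0 < t \<Longrightarrow> t < T \<Longrightarrow> R t \<le> \<psi> t" and \<psi>: "(\<psi> has_integral I) {0..T}"
  shows "G T - G 0 \<le> I"
proof -
  have "abs_cont_on {0..T} G" by (rule abs_cont_on_lipschitz[where K=L]) (use L in auto)
  then obtain g N where N: "negligible N"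
    and g: "\<And>t. t \<in> {0<..<T} - N \<Longrightarrow> (G has_real_derivative g t) (at t)"
    and int: "\<And>x y. 0 \<le> x \<Longrightarrow> x \<le> y \<Longrightarrow> y \<le> T \<Longrightarrow> (g has_integral G y - G x) {x..y}"
    using abs_cont_on_FTC[OF _ T] by metis
  have gR: "g t = R t" if t: "t \<in> {0<..<T} - N" for t
  proof -
    have "((\<lambda>h. (G (t + h) - G t) / h) \<longlongrightarrow> g t) (at 0)"
      using g[OF t] unfolding DERIV_def by simp
    then have "((\<lambda>h. (G (t + h) - G t) / h) \<longlongrightarrow> g t) (at_right 0)"
      by (rule filterlim_mono) (auto simp: at_within_le_at)
    moreover have "((\<lambda>h. (G (t + h) - G t) / h) \<longlongrightarrow> R t) (at_right 0)" using R t by auto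
    ultimately show ?thesis by (rule tendsto_unique[rotated]) simp
  qed
  \<comment> \<open>Almost everywhere the minimum is \<open>g\<close>; it is bounded by \<open>\<psi>\<close> everywhere.\<close>
  have "((\<lambda>t. min (g t) (\<psi> t)) has_integral G T - G 0) {0..T}"
  proof (rule has_integral_spike[of "N \<union> {0, T}" _ _ g])
    show "negligible (N \<union> {0, T})" using N by (simp add: negligible_Un)
    show "min (g t) (\<psi> t) = g t" if "t \<in> {0..T} - (N \<union> {0, T})" for t
      using that gR[of t] le[of t] by auto
    show "(g has_integral G T - G 0) {0..T}" using int[of 0 T] T by simp
  qed
  from has_integral_le[OF this \<psi>] show ?thesis by simp
qed

context
  fixes a :: "real \<Rightarrow> real" and S :: "real \<Rightarrow> state \<Rightarrow> state"
  assumes standing: "standing a"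
    and csg: "contraction_semigroup a S" and gen: "has_generator_A a S"
begin

lemma semigroup_state: "0 \<le> t \<Longrightarrow> p \<in> state_space a \<Longrightarrow> S t p \<in> state_space a"
  using csg unfolding contraction_semigroup_def by blast

lemma semigroup_norm_le: "0 \<le> t \<Longrightarrow> p \<in> state_space a \<Longrightarrow> norm_state a (S t p) \<le> norm_state a p"
  using csg unfolding contraction_semigroup_def by blast

lemma semigroup_add: "0 \<le> s \<Longrightarrow> 0 \<le> t \<Longrightarrow> p \<in> state_space a \<Longrightarrow> eq_state a (S (s + t) p) (S s (S t p))"
  using csg unfolding contraction_semigroup_def by blast

lemma semigroup_0: "p \<in> state_space a \<Longrightarrow> eq_state a (S 0 p) p"
  using csg unfolding contraction_semigroup_def by blast

lemma semigroup_lincomb: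
  "0 \<le> t \<Longrightarrow> p \<in> state_space a \<Longrightarrow> q \<in> state_space a \<Longrightarrow>
    eq_state a (S t (lincomb c p d q)) (lincomb c (S t p) d (S t q))"
  using csg unfolding contraction_semigroup_def by blast

lemma semigroup_dist_le:
  assumes "0 \<le> t" "p \<in> state_space a" "q \<in> state_space a"
  shows "dist_state a (S t p) (S t q) \<le> dist_state a p q"
proof -
  let ?l = "lincomb 1 p (-1) q"
  have l: "?l \<in> state_space a" using assms lincomb_state_space by blast
  have "dist_state a (S t p) (S t q) = norm_state a (S t ?l)"
    unfolding dist_state_def
    by (rule norm_state_cong[OF standing semigroup_lincomb[OF assms], symmetric])
      (use assms l semigroup_state lincomb_state_space in auto)
  then show ?thesis using semigroup_norm_le[OF assms(1) l] unfolding dist_state_def by simp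
qed

definition generates :: "state \<Rightarrow> state \<Rightarrow> bool" where
  "generates p q \<longleftrightarrow>
    ((\<lambda>h. dist_state a (lincomb (1 / h) (S h p) (- 1 / h) p) q) \<longlongrightarrow> 0) (at_right 0)"

lemma generates_iff:
  assumes "p \<in> state_space a" "q \<in> state_space a"
  shows "generates p q \<longleftrightarrow> (\<exists>p'\<in>dom_A a. eq_state a p p' \<and> eq_state a q (op_A a p'))"
  using gen assms unfolding has_generator_A_def generates_def by blast

text \<open>For small \<open>s\<close> the difference quotient has norm at most \<open>\<parallel>q\<parallel> + 1\<close>. The displacement is
  subadditive in time by contractivity, which extends the bound to all \<open>h\<close>.\<close>

lemma orbit_lipschitz_0:
  assumes p: "p \<in> state_space a" and q: "q \<in> state_space a" and pq: "generates p q" and h: "0 \<le> h"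
  shows "dist_state a (S h p) p \<le> (norm_state a q + 1) * h"
proof -
  have "\<forall>\<^sub>F s in at_right 0. dist_state a (lincomb (1 / s) (S s p) (- 1 / s) p) q < 1"
    using pq unfolding generates_def by (rule order_tendstoD) simp
  then obtain \<delta> where \<delta>: "\<delta> > 0" "\<And>s. 0 < s \<Longrightarrow> s < \<delta> \<Longrightarrow> dist_state a (lincomb (1 / s) (S s p) (- 1 / s) p) q < 1"
    unfolding eventually_at_right_field by auto
  have small: "dist_state a (S s p) p \<le> (norm_state a q + 1) * s" if s: "0 < s" "s < \<delta>" for s
  proof -
    let ?r = "lincomb (1 / s) (S s p) (- 1 / s) p"
    have Sp: "S s p \<in> state_space a" using semigroup_state p s by simp
    have r: "?r \<in> state_space a" by (rule lincomb_state_space[OF Sp p])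
    have "lincomb 1 (S s p) (-1) p = lincomb s ?r 0 ?r" unfolding lincomb_def using s by (auto simp: field_simps)
    then have "dist_state a (S s p) p \<le> s * norm_state a ?r"
      unfolding dist_state_def using norm_state_lincomb_le[OF standing r r, of s 0] s by simp
    also have "norm_state a ?r \<le> norm_state a q + 1"
      using norm_state_le_dist[OF standing r q] \<delta>(2)[OF s] by simp
    finally show ?thesis using s by (simp add: mult.commute mult_left_mono)
  qed
  have multi: "dist_state a (S (real n * s) p) p \<le> real n * dist_state a (S s p) p" if s: "0 \<le> s" for n s
  proof (induction n)
    case 0
    then show ?case using semigroup_0[OF p] unfolding eq_state_def by simp
  next
    case (Suc n)
    have ns: "0 \<le> real n * s" using s by simp
    note st = semigroup_state[OF ns p] semigroup_state[OF s p] semigroup_state[OF ns semigroup_state[OF s p]]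
    have st': "S (real n * s + s) p \<in> state_space a" using semigroup_state p s by simp
    have "real (Suc n) * s = real n * s + s" by (simp add: algebra_simps)
    then have "dist_state a (S (real (Suc n) * s) p) p = dist_state a (S (real n * s + s) p) p" by simp
    also have "\<dots> = dist_state a (S (real n * s) (S s p)) p"
      by (rule dist_state_cong[OF standing semigroup_add[OF ns s p] eq_state_refl[OF standing]]) (use st st' p in auto)
    also have "\<dots> \<le> dist_state a (S (real n * s) (S s p)) (S (real n * s) p) + dist_state a (S (real n * s) p) p"
      by (rule dist_state_triangle[OF standing]) (use st p in auto)
    also have "\<dots> \<le> dist_state a (S s p) p + real n * dist_state a (S s p) p"
      using Suc semigroup_dist_le[OF ns st(2) p] by simp
    finally show ?case by (simp add: algebra_simps)
  qed
  show ?thesis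
  proof (cases "h = 0")
    case True
    then show ?thesis using semigroup_0[OF p] unfolding eq_state_def by simp
  next
    case False
    then have h0: "0 < h" using h by simp
    obtain n :: nat where n: "h / \<delta> < real n" using reals_Archimedean2 by blast
    then have n0: "0 < real n" using h0 \<delta>(1) by (meson divide_pos_pos less_trans)
    have "h / real n < \<delta>" using n n0 \<delta>(1) by (simp add: field_simps)
    then have "real n * dist_state a (S (h / real n) p) p \<le> real n * ((norm_state a q + 1) * (h / real n))"
      using small[of "h / real n"] h0 n0 by (intro mult_left_mono) auto
    then show ?thesis using multi[of "h / real n" n] h0 n0 by simp
  qed
qed

lemma orbit_lipschitz:
  assumes p: "p \<in> state_space a" and q: "q \<in> state_space a" and pq: "generates p q" and st: "0 \<le> s" "s \<le> t"
  shows "dist_state a (S t p) (S s p) \<le> (norm_state a q + 1) * (t - s)"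
proof -
  have h: "0 \<le> t - s" and t: "0 \<le> t" using st by auto
  have "eq_state a (S (s + (t - s)) p) (S s (S (t - s) p))" by (rule semigroup_add[OF st(1) h p])
  then have "eq_state a (S t p) (S s (S (t - s) p))" by simp
  then have "dist_state a (S t p) (S s p) = dist_state a (S s (S (t - s) p)) (S s p)"
    by (rule dist_state_cong[OF standing _ eq_state_refl[OF standing]])
      (use semigroup_state p st h t in auto)
  also have "\<dots> \<le> dist_state a (S (t - s) p) p"
    by (rule semigroup_dist_le[OF st(1) semigroup_state[OF h p] p])
  also have "\<dots> \<le> (norm_state a q + 1) * (t - s)" by (rule orbit_lipschitz_0[OF p q pq h])
  finally show ?thesis .
qed

text \<open>The difference quotient at time \<open>t\<close> is the image under the contraction \<open>S t\<close> of the one at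
  time \<open>0\<close>.\<close>

lemma orbit_right_derivative:
  assumes p: "p \<in> state_space a" and q: "q \<in> state_space a" and pq: "generates p q" and t: "0 \<le> t"
  shows "((\<lambda>h. dist_state a (lincomb (1 / h) (S (t + h) p) (- 1 / h) (S t p)) (S t q)) \<longlongrightarrow> 0) (at_right 0)"
proof (rule tendsto_sandwich[OF _ _ tendsto_const pq[unfolded generates_def]])
  have ev: "\<forall>\<^sub>F h in at_right (0::real). 0 < h" by (simp add: eventually_at_right_less)
  show "\<forall>\<^sub>F h in at_right 0. 0 \<le> dist_state a (lincomb (1 / h) (S (t + h) p) (- 1 / h) (S t p)) (S t q)"
    using ev
  proof eventually_elim
    case (elim h)
    then show ?case using t p q
      by (intro dist_state_nonneg[OF standing] lincomb_state_space semigroup_state) auto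
  qed
  show "\<forall>\<^sub>F h in at_right 0. dist_state a (lincomb (1 / h) (S (t + h) p) (- 1 / h) (S t p)) (S t q)
      \<le> dist_state a (lincomb (1 / h) (S h p) (- 1 / h) p) q"
    using ev
  proof eventually_elim
    case (elim h)
    let ?c = "1 / h" and ?d = "- 1 / h"
    have h: "0 \<le> h" "0 \<le> t + h" using elim t by auto
    note Stp = semigroup_state[OF t p] and Shp = semigroup_state[OF h(1) p] and Sthp = semigroup_state[OF h(2) p]
    note StShp = semigroup_state[OF t Shp]
    let ?r = "lincomb ?c (S h p) ?d p"
    have r: "?r \<in> state_space a" by (rule lincomb_state_space[OF Shp p])
    have "dist_state a (lincomb ?c (S (t + h) p) ?d (S t p)) (lincomb ?c (S t (S h p)) ?d (S t p)) \<le> 0"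
      using dist_state_lincomb_le[OF standing Sthp Stp StShp Stp, of ?c ?d]
        semigroup_add[OF t h(1) p] dist_state_refl[OF standing] unfolding eq_state_def by simp
    then have "eq_state a (lincomb ?c (S (t + h) p) ?d (S t p)) (lincomb ?c (S t (S h p)) ?d (S t p))"
      unfolding eq_state_def
      using dist_state_nonneg[OF standing lincomb_state_space[OF Sthp Stp] lincomb_state_space[OF StShp Stp]]
      by (intro antisym) auto
    moreover have "eq_state a (lincomb ?c (S t (S h p)) ?d (S t p)) (S t ?r)"
      by (rule eq_state_sym[OF standing semigroup_lincomb[OF t Shp p]])
        (use semigroup_state[OF t r] lincomb_state_space[OF StShp Stp] in auto)
    ultimately have "eq_state a (lincomb ?c (S (t + h) p) ?d (S t p)) (S t ?r)"
      by (rule eq_state_trans[OF standing])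
        (use semigroup_state[OF t r] lincomb_state_space[OF StShp Stp] lincomb_state_space[OF Sthp Stp] in auto)
    then have "dist_state a (lincomb ?c (S (t + h) p) ?d (S t p)) (S t q) = dist_state a (S t ?r) (S t q)"
      by (rule dist_state_cong[OF standing _ eq_state_refl[OF standing]])
        (use semigroup_state[OF t r] semigroup_state[OF t q] lincomb_state_space[OF Sthp Stp] in auto)
    also have "\<dots> \<le> dist_state a ?r q" by (rule semigroup_dist_le[OF t r q])
    finally show ?case .
  qed
qed

text \<open>Same quotient, with \<open>S (t + h)\<close> factored in the other order.\<close>

lemma generates_orbit:
  assumes p: "p \<in> state_space a" and q: "q \<in> state_space a" and pq: "generates p q" and t: "0 \<le> t"
  shows "generates (S t p) (S t q)"
  unfolding generates_def
proof (rule Lim_transform_eventually[OF orbit_right_derivative[OF assms]])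
  have ev: "\<forall>\<^sub>F h in at_right (0::real). 0 < h" by (simp add: eventually_at_right_less)
  then show "\<forall>\<^sub>F h in at_right 0. dist_state a (lincomb (1 / h) (S (t + h) p) (- 1 / h) (S t p)) (S t q) =
      dist_state a (lincomb (1 / h) (S h (S t p)) (- 1 / h) (S t p)) (S t q)"
  proof eventually_elim
    case (elim h)
    have h: "0 \<le> h" "0 \<le> t + h" using elim t by auto
    let ?c = "1 / h" and ?d = "- 1 / h"
    note Stp = semigroup_state[OF t p] and Sthp = semigroup_state[OF h(2) p]
    note ShStp = semigroup_state[OF h(1) Stp]
    have "eq_state a (S (t + h) p) (S h (S t p))" using semigroup_add[OF h(1) t p] by (simp add: add.commute)
    then have "dist_state a (lincomb ?c (S (t + h) p) ?d (S t p)) (lincomb ?c (S h (S t p)) ?d (S t p)) \<le> 0"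
      using dist_state_lincomb_le[OF standing Sthp Stp ShStp Stp, of ?c ?d]
         dist_state_refl[OF standing] unfolding eq_state_def by simp
    then have "eq_state a (lincomb ?c (S (t + h) p) ?d (S t p)) (lincomb ?c (S h (S t p)) ?d (S t p))"
      unfolding eq_state_def
      using dist_state_nonneg[OF standing lincomb_state_space[OF Sthp Stp] lincomb_state_space[OF ShStp Stp]]
      by (intro antisym) auto
    then show ?case
      by (rule dist_state_cong[OF standing _ eq_state_refl[OF standing]])
        (use semigroup_state[OF t q] lincomb_state_space[OF Sthp Stp] lincomb_state_space[OF ShStp Stp] in auto)
  qed
qed

lemma form_orbit_lipschitz:
  assumes b: "bounded_form a K b"
    and p: "p \<in> state_space a" and q: "q \<in> state_space a" and pq: "generates p q" and st: "0 \<le> s" "s \<le> t"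
  shows "\<bar>b (S t p) (S t p) - b (S s p) (S s p)\<bar> \<le> 4 * K * norm_state a p * (norm_state a q + 1) * (t - s)"
proof -
  have t: "0 \<le> t" using st by simp
  have K: "0 \<le> K" using b unfolding bounded_form_def by blast
  note Stp = semigroup_state[OF t p] and Ssp = semigroup_state[OF st(1) p]
  let ?D = "dist_state a (S t p) (S s p)"
  have D: "0 \<le> ?D" by (rule dist_state_nonneg[OF standing Stp Ssp])
  have "\<bar>b (S t p) (S t p) - b (S s p) (S s p)\<bar> \<le> 2 * K * (?D * norm_state a (S t p) + norm_state a (S s p) * ?D)"
    by (rule bounded_form_diff_le[OF standing b Stp Ssp Stp Ssp])
  also have "\<dots> \<le> 2 * K * (?D * norm_state a p + norm_state a p * ?D)"
    using K D semigroup_norm_le[OF t p] semigroup_norm_le[OF st(1) p]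
    by (intro mult_left_mono add_mono mult_right_mono) auto
  also have "\<dots> = (4 * K * norm_state a p) * ?D" by (simp add: algebra_simps)
  also have "\<dots> \<le> (4 * K * norm_state a p) * ((norm_state a q + 1) * (t - s))"
    using orbit_lipschitz[OF p q pq st] K norm_state_nonneg[OF standing p] by (intro mult_left_mono) auto
  finally show ?thesis by (simp add: mult.assoc)
qed

text \<open>With \<open>r h\<close> the difference quotient of the orbit, bilinearity rewrites the quotient of the form as
  \<open>b (r h) (S (t + h) p) + b (S t p) (r h)\<close>.\<close>

lemma form_orbit_right_derivative:
  assumes b: "bounded_form a K b"
    and p: "p \<in> state_space a" and q: "q \<in> state_space a" and pq: "generates p q" and t: "0 \<le> t"
  shows "((\<lambda>h. (b (S (t + h) p) (S (t + h) p) - b (S t p) (S t p)) / h) \<longlongrightarrow>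
     b (S t q) (S t p) + b (S t p) (S t q)) (at_right 0)"
proof -
  note Stp = semigroup_state[OF t p] and Stq = semigroup_state[OF t q]
  define r where "r = (\<lambda>h. lincomb (1 / h) (S (t + h) p) (- 1 / h) (S t p))"
  have r0: "((\<lambda>h. dist_state a (r h) (S t q)) \<longlongrightarrow> 0) (at_right 0)"
    unfolding r_def by (rule orbit_right_derivative[OF p q pq t])
  have ev: "\<forall>\<^sub>F h in at_right (0::real). 0 < h" by (simp add: eventually_at_right_less)
  let ?C = "norm_state a q + 1"
  define e where "e = (\<lambda>h. 2 * K * (dist_state a (r h) (S t q) * norm_state a p + norm_state a q * (?C * h)
      + norm_state a p * dist_state a (r h) (S t q)))"
  have "((\<lambda>h. e h) \<longlongrightarrow> 2 * K * (0 * norm_state a p + norm_state a q * (?C * 0) + norm_state a p * 0)) (at_right 0)"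
    unfolding e_def by (intro tendsto_intros r0)
  then have e0: "(e \<longlongrightarrow> 0) (at_right 0)" by simp
  show ?thesis
  proof (rule LIM_zero_cancel, rule Lim_null_comparison[OF _ e0])
    show "\<forall>\<^sub>F h in at_right 0. norm ((b (S (t + h) p) (S (t + h) p) - b (S t p) (S t p)) / h -
        (b (S t q) (S t p) + b (S t p) (S t q))) \<le> e h"
      using ev
    proof eventually_elim
      case (elim h)
      have h: "0 \<le> h" "0 \<le> t + h" "t \<le> t + h" using elim t by auto
      note Sthp = semigroup_state[OF h(2) p]
      have rh: "r h \<in> state_space a" unfolding r_def by (rule lincomb_state_space[OF Sthp Stp])
      have K: "0 \<le> K" using b unfolding bounded_form_def by blast
      have "b (r h) (S (t + h) p) + b (S t p) (r h) = (b (S (t + h) p) (S (t + h) p) - b (S t p) (S t p)) / h"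
        unfolding r_def bounded_form_lincomb(1)[OF standing b Sthp Stp Sthp] bounded_form_lincomb(2)[OF standing b Sthp Stp Stp]
        by (simp add: diff_divide_distrib)
      moreover have "\<bar>b (r h) (S (t + h) p) - b (S t q) (S t p)\<bar>
          \<le> 2 * K * (dist_state a (r h) (S t q) * norm_state a p + norm_state a q * (?C * h))"
      proof -
        have "\<bar>b (r h) (S (t + h) p) - b (S t q) (S t p)\<bar> \<le> 2 * K *
          (dist_state a (r h) (S t q) * norm_state a (S (t + h) p) + norm_state a (S t q) * dist_state a (S (t + h) p) (S t p))"
          by (rule bounded_form_diff_le[OF standing b rh Stq Sthp Stp])
        also have "\<dots> \<le> 2 * K * (dist_state a (r h) (S t q) * norm_state a p + norm_state a q * (?C * h))"
          using K semigroup_norm_le[OF h(2) p] semigroup_norm_le[OF t q] orbit_lipschitz[OF p q pq t h(3)]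
            dist_state_nonneg[OF standing rh Stq] dist_state_nonneg[OF standing Sthp Stp] norm_state_nonneg[OF standing q]
          by (intro mult_left_mono add_mono mult_mono) auto
        finally show ?thesis .
      qed
      moreover have "\<bar>b (S t p) (r h) - b (S t p) (S t q)\<bar> \<le> 2 * K * (norm_state a p * dist_state a (r h) (S t q))"
      proof -
        have "\<bar>b (S t p) (r h) - b (S t p) (S t q)\<bar> \<le> 2 * K *
          (dist_state a (S t p) (S t p) * norm_state a (r h) + norm_state a (S t p) * dist_state a (r h) (S t q))"
          by (rule bounded_form_diff_le[OF standing b Stp Stp rh Stq])
        also have "\<dots> \<le> 2 * K * (norm_state a p * dist_state a (r h) (S t q))"
          using K semigroup_norm_le[OF t p] dist_state_nonneg[OF standing rh Stq] dist_state_refl[OF standing]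
          by (auto intro!: mult_left_mono mult_right_mono)
        finally show ?thesis .
      qed
      ultimately show ?case unfolding e_def by (simp add: algebra_simps abs_le_iff)
    qed
  qed
qed

end

section \<open>The multiplier form\<close>

lemma abs_mult_le_half_squares: "\<bar>x * y\<bar> \<le> 1/2 * (x\<^sup>2 + (y::real)\<^sup>2)"
  using sum_squares_bound[of "\<bar>x\<bar>" "\<bar>y\<bar>"] by (simp add: abs_mult)

definition multiplier_form :: "(real \<Rightarrow> real) \<Rightarrow> state \<Rightarrow> state \<Rightarrow> real" where
  "multiplier_form a p q = (LINT x|leb01. (x * dx (fst p) x + mu a / 4 * fst p x) * snd q x)"

context
  fixes a :: "real \<Rightarrow> real"
  assumes standing: "standing a"
begin

lemma op_A_state_space:
  assumes "p \<in> dom_A a" shows "op_A a p \<in> state_space a"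
  using assms H2a_operator_L2[OF standing] unfolding dom_A_def op_A_def state_space_def by auto

lemma multiplier_L2:
  assumes "p \<in> state_space a"
  shows "(\<lambda>x. x * dx (fst p) x + mu a / 4 * fst p x) \<in> L2 {0<..<1}"
  using L2_lincomb[OF V1_weighted_L2[OF standing state_spaceD(2)[OF assms]]
      V1D(1)[OF standing state_spaceD(2)[OF assms]], of 1 "mu a / 4"] by simp

lemma multiplier_integrable:
  assumes "p \<in> state_space a" "q \<in> state_space a"
  shows "integrable leb01 (\<lambda>x. (x * dx (fst p) x + mu a / 4 * fst p x) * snd q x)"
  by (rule L2_mult_integrable[OF multiplier_L2[OF assms(1)] state_spaceD(4)[OF assms(2)]])

lemma weighted_square_le:
  assumes "0 < x" "x < 1" shows "(x * d)\<^sup>2 \<le> 1 / a 1 * (a x * d\<^sup>2)"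
proof -
  have p: "0 < a 1" using coeff_pos[OF standing] by simp
  have "x\<^sup>2 \<le> a x / a 1" using coeff_lower_square[OF standing, of x] assms p by (simp add: field_simps)
  then have "x\<^sup>2 * d\<^sup>2 \<le> a x / a 1 * d\<^sup>2" by (rule mult_right_mono) simp
  then show ?thesis by (simp add: power_mult_distrib)
qed

lemma C_const_pos: "0 < C_const a"
  using coeff_pos[OF standing, of 1] mu_less_2[OF standing] unfolding C_const_def by (simp add: min_def)

text \<open>Some constant is needed for differentiating along orbits; the quantitative bound on the diagonal
  is \<open>multiplier_form_le_energy\<close>.\<close>

lemma bounded_form_multiplier_form: "bounded_form a (1 / a 1 + C_const a + 1/2) (multiplier_form a)"
  unfolding bounded_form_def
proof (intro conjI ballI allI)
  show "0 \<le> 1 / a 1 + C_const a + 1/2" using coeff_pos[OF standing, of 1] C_const_pos by simp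
next
  fix p q r c d assume p: "p \<in> state_space a" and q: "q \<in> state_space a" and r: "r \<in> state_space a"
  let ?w = "\<lambda>p x. x * dx (fst p) x + mu a / 4 * fst p x"
  have "multiplier_form a (lincomb c p d q) r = (LINT x|leb01. c * (?w p x * snd r x) + d * (?w q x * snd r x))"
    unfolding multiplier_form_def
  proof (rule integral_cong_AE)
    show "AE x in leb01. ?w (lincomb c p d q) x * snd r x = c * (?w p x * snd r x) + d * (?w q x * snd r x)"
      using dx_lincomb_AE[of "fst p" "fst q" c d] state_spaceD(2)[OF p] state_spaceD(2)[OF q] V1D(2)[OF standing]
      unfolding lincomb_def by (auto elim!: eventually_mono simp: algebra_simps)
    show "(\<lambda>x. ?w (lincomb c p d q) x * snd r x) \<in> borel_measurable leb01"
      using multiplier_integrable[OF lincomb_state_space[OF p q] r] by blast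
    show "(\<lambda>x. c * (?w p x * snd r x) + d * (?w q x * snd r x)) \<in> borel_measurable leb01"
      by (intro borel_measurable_integrable Bochner_Integration.integrable_add integrable_mult_right)
        (use multiplier_integrable p q r in auto)
  qed
  then show "multiplier_form a (lincomb c p d q) r = c * multiplier_form a p r + d * multiplier_form a q r"
    unfolding multiplier_form_def using multiplier_integrable[OF p r] multiplier_integrable[OF q r] by simp
  have "multiplier_form a r (lincomb c p d q) = (LINT x|leb01. c * (?w r x * snd p x) + d * (?w r x * snd q x))"
    unfolding multiplier_form_def lincomb_def
    by (intro Bochner_Integration.integral_cong) (simp_all add: algebra_simps)
  then show "multiplier_form a r (lincomb c p d q) = c * multiplier_form a r p + d * multiplier_form a r q"
    unfolding multiplier_form_def using multiplier_integrable[OF r p] multiplier_integrable[OF r q] by simp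
next
  fix p q assume p: "p \<in> state_space a" and q: "q \<in> state_space a"
  let ?w = "\<lambda>x. x * dx (fst p) x + mu a / 4 * fst p x"
  let ?A = "LINT x|leb01. a x * (dx (fst p) x)\<^sup>2"
  note pV = state_spaceD(2)[OF p]
  have i: "integrable leb01 (\<lambda>x. a x * (dx (fst p) x)\<^sup>2)" "integrable leb01 (\<lambda>x. (fst p x)\<^sup>2)"
    "integrable leb01 (\<lambda>x. (snd q x)\<^sup>2)"
    using V1_energy_integrable_square[OF standing pV] L2D(2) V1D(1)[OF standing pV] state_spaceD(4)[OF q] by auto
  have "\<bar>multiplier_form a p q\<bar> \<le> (LINT x|leb01. \<bar>?w x * snd q x\<bar>)"
    unfolding multiplier_form_def by (rule integral_abs_bound)
  also have "\<dots> \<le> (LINT x|leb01. 1 / a 1 * (a x * (dx (fst p) x)\<^sup>2) + 1/4 * (fst p x)\<^sup>2 + 1/2 * (snd q x)\<^sup>2)"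
  proof (rule integral_mono_AE)
    show "integrable leb01 (\<lambda>x. \<bar>?w x * snd q x\<bar>)" using multiplier_integrable[OF p q] by simp
    show "integrable leb01 (\<lambda>x. 1 / a 1 * (a x * (dx (fst p) x)\<^sup>2) + 1/4 * (fst p x)\<^sup>2 + 1/2 * (snd q x)\<^sup>2)"
      using i by simp
    show "AE x in leb01. \<bar>?w x * snd q x\<bar> \<le> 1 / a 1 * (a x * (dx (fst p) x)\<^sup>2) + 1/4 * (fst p x)\<^sup>2 + 1/2 * (snd q x)\<^sup>2"
    proof (rule AE_leb01_interior)
      fix x :: real assume x: "0 < x" "x < 1"
      let ?y = "x * dx (fst p) x" and ?z = "mu a / 4 * fst p x"
      have "(?y + ?z)\<^sup>2 \<le> 2 * ?y\<^sup>2 + 2 * ?z\<^sup>2" using sum_squares_bound[of ?y ?z] by (simp add: power2_sum)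
      moreover have "?z\<^sup>2 \<le> 1/4 * (fst p x)\<^sup>2"
      proof -
        have "(mu a / 4)\<^sup>2 \<le> (1/2)\<^sup>2" using mu_nonneg[OF standing] mu_less_2[OF standing] by (intro power_mono) auto
        then have "(mu a / 4)\<^sup>2 * (fst p x)\<^sup>2 \<le> 1/4 * (fst p x)\<^sup>2"
          by (intro mult_right_mono) (auto simp: power2_eq_square)
        then show ?thesis by (simp only: power_mult_distrib)
      qed
      moreover have "\<bar>?w x * snd q x\<bar> \<le> 1/2 * ((?w x)\<^sup>2 + (snd q x)\<^sup>2)"
        by (rule abs_mult_le_half_squares)
      moreover have "A \<le> B + 1/4 * U + 1/2 * V"
        if "W \<le> 2 * Y + 2 * Z" "Z \<le> 1/4 * U" "A \<le> 1/2 * (W + V)" "Y \<le> B" for A B U V W Y Z :: real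
        using that by (simp add: field_simps)
      ultimately show "\<bar>?w x * snd q x\<bar> \<le> 1 / a 1 * (a x * (dx (fst p) x)\<^sup>2) + 1/4 * (fst p x)\<^sup>2 + 1/2 * (snd q x)\<^sup>2"
        using weighted_square_le[OF x, of "dx (fst p) x"] by blast
    qed
  qed
  also have "\<dots> = 1 / a 1 * ?A + 1/4 * (LINT x|leb01. (fst p x)\<^sup>2) + 1/2 * (LINT x|leb01. (snd q x)\<^sup>2)"
    using i by simp
  also have "\<dots> \<le> (1 / a 1 + C_const a) * ?A + 1/2 * (LINT x|leb01. (snd q x)\<^sup>2)"
    using hardy_poincare[OF standing pV state_spaceD(3)[OF p]] by (simp add: algebra_simps)
  also have "\<dots> \<le> (1 / a 1 + C_const a) * inner_state a p p + 1/2 * inner_state a q q"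
  proof (intro add_mono mult_left_mono)
    have "0 \<le> (LINT x|leb01. (snd p x)\<^sup>2)" by simp
    then show "?A \<le> inner_state a p p" using inner_state_self[OF standing p] by linarith
    show "(LINT x|leb01. (snd q x)\<^sup>2) \<le> inner_state a q q"
      using inner_state_self[OF standing q] energy_integral_nonneg[OF standing, of "fst q"] by linarith
  qed (use coeff_pos[OF standing, of 1] C_const_pos in auto)
  also have "\<dots> \<le> (1 / a 1 + C_const a + 1/2) * (inner_state a p p + inner_state a q q)"
  proof -
    have "0 \<le> 1/2 * inner_state a p p" "0 \<le> (1 / a 1 + C_const a) * inner_state a q q"
      using inner_state_nonneg[OF standing] p q coeff_pos[OF standing, of 1] C_const_pos by auto
    then show ?thesis by (simp add: algebra_simps)
  qed
  finally show "\<bar>multiplier_form a p q\<bar> \<le> (1 / a 1 + C_const a + 1/2) * (inner_state a p p + inner_state a q q)" .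
qed

text \<open>Estimate \<open>x u' v\<close> through \<open>x\<^sup>2 \<le> a/a(1)\<close>, and \<open>u v\<close> with the weight \<open>s = 2 \<surd>C_const\<close> that balances
  the two terms after the Hardy-Poincare inequality.\<close>

lemma multiplier_form_le_energy:
  assumes p: "p \<in> state_space a"
  shows "\<bar>multiplier_form a p p\<bar> \<le> 1/2 * inner_state a p p * (1 / min 1 (a 1) + mu a / 2 * sqrt (C_const a))"
proof -
  let ?w = "\<lambda>x. x * dx (fst p) x + mu a / 4 * fst p x"
  let ?A = "LINT x|leb01. a x * (dx (fst p) x)\<^sup>2" and ?V = "LINT x|leb01. (snd p x)\<^sup>2"
  let ?m = "min 1 (a 1)" and ?s = "2 * sqrt (C_const a)"
  note pV = state_spaceD(2)[OF p]
  have a1: "0 < a 1" using coeff_pos[OF standing] by simp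
  have s: "0 < ?s" using C_const_pos by simp
  have mu: "0 \<le> mu a" by (rule mu_nonneg[OF standing])
  have i: "integrable leb01 (\<lambda>x. a x * (dx (fst p) x)\<^sup>2)" "integrable leb01 (\<lambda>x. (fst p x)\<^sup>2)"
    "integrable leb01 (\<lambda>x. (snd p x)\<^sup>2)"
    using V1_energy_integrable_square[OF standing pV] L2D(2) V1D(1)[OF standing pV] state_spaceD(4)[OF p] by auto
  let ?F = "\<lambda>x. 1/2 * (1 / ?m) * (a x * (dx (fst p) x)\<^sup>2 + (snd p x)\<^sup>2) + mu a / 8 * (1 / ?s * (fst p x)\<^sup>2 + ?s * (snd p x)\<^sup>2)"
  have "\<bar>multiplier_form a p p\<bar> \<le> (LINT x|leb01. \<bar>?w x * snd p x\<bar>)"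
    unfolding multiplier_form_def by (rule integral_abs_bound)
  also have "\<dots> \<le> (LINT x|leb01. ?F x)"
  proof (rule integral_mono_AE)
    show "integrable leb01 (\<lambda>x. \<bar>?w x * snd p x\<bar>)" using multiplier_integrable[OF p p] by simp
    show "integrable leb01 ?F" using i by simp
    show "AE x in leb01. \<bar>?w x * snd p x\<bar> \<le> ?F x"
    proof (rule AE_leb01_interior)
      fix x :: real assume x: "0 < x" "x < 1"
      let ?y = "x * dx (fst p) x" and ?E = "a x * (dx (fst p) x)\<^sup>2"
      have E: "0 \<le> ?E" using coeff_pos[OF standing, of x] x by (simp add: less_imp_le)
      have "1 / a 1 \<le> 1 / ?m" "1 \<le> 1 / ?m" using a1 by (auto simp: min_def divide_left_mono)
      then have "1 / a 1 * ?E \<le> 1 / ?m * ?E" "1 * (snd p x)\<^sup>2 \<le> 1 / ?m * (snd p x)\<^sup>2"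
        using E by (intro mult_right_mono; simp)+
      moreover have "\<bar>?y * snd p x\<bar> \<le> 1/2 * (?y\<^sup>2 + (snd p x)\<^sup>2)" by (rule abs_mult_le_half_squares)
      ultimately have 1: "\<bar>?y * snd p x\<bar> \<le> 1/2 * (1 / ?m) * (?E + (snd p x)\<^sup>2)"
        using weighted_square_le[OF x, of "dx (fst p) x"] by (simp add: distrib_left)
      have "\<bar>fst p x * snd p x\<bar> \<le> 1/2 * (1 / ?s * (fst p x)\<^sup>2 + ?s * (snd p x)\<^sup>2)"
      proof -
        let ?r = "sqrt ?s"
        have "\<bar>(1 / ?r * fst p x) * (?r * snd p x)\<bar> \<le> 1/2 * ((1 / ?r * fst p x)\<^sup>2 + (?r * snd p x)\<^sup>2)"
          by (rule abs_mult_le_half_squares)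
        then show ?thesis using s by (simp add: power_mult_distrib power_divide)
      qed
      then have "mu a / 4 * \<bar>fst p x * snd p x\<bar> \<le> mu a / 4 * (1/2 * (1 / ?s * (fst p x)\<^sup>2 + ?s * (snd p x)\<^sup>2))"
        using mu by (intro mult_left_mono) auto
      then have 2: "\<bar>mu a / 4 * fst p x * snd p x\<bar> \<le> mu a / 8 * (1 / ?s * (fst p x)\<^sup>2 + ?s * (snd p x)\<^sup>2)"
        using mu by (simp add: abs_mult)
      have "?w x * snd p x = ?y * snd p x + mu a / 4 * fst p x * snd p x" by (simp add: algebra_simps)
      then have "\<bar>?w x * snd p x\<bar> \<le> \<bar>?y * snd p x\<bar> + \<bar>mu a / 4 * fst p x * snd p x\<bar>" by (metis abs_triangle_ineq)
      then show "\<bar>?w x * snd p x\<bar> \<le> ?F x" using 1 2 by linarith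
    qed
  qed
  also have "\<dots> = 1/2 * (1 / ?m) * (?A + ?V) + mu a / 8 * (1 / ?s * (LINT x|leb01. (fst p x)\<^sup>2) + ?s * ?V)"
    using i by simp
  also have "\<dots> \<le> 1/2 * (1 / ?m) * (?A + ?V) + mu a / 8 * (?s * ?A + ?s * ?V)"
  proof (intro add_left_mono mult_left_mono add_right_mono)
    have "1 / ?s * (LINT x|leb01. (fst p x)\<^sup>2) \<le> 1 / ?s * (4 * C_const a * ?A)"
      using hardy_poincare[OF standing pV state_spaceD(3)[OF p]] s by (intro mult_left_mono) auto
    also have "1 / ?s * (4 * C_const a * ?A) = ?s * ?A"
    proof -
      have "4 * C_const a = ?s * ?s" using C_const_pos by simp
      then have "1 / ?s * (4 * C_const a * ?A) = 1 / ?s * ?s * (?s * ?A)" by (simp only: mult.assoc)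
      then show ?thesis using s by simp
    qed
    finally show "1 / ?s * (LINT x|leb01. (fst p x)\<^sup>2) \<le> ?s * ?A" .
  qed (use mu in simp)
  also have "\<dots> = 1/2 * (?V + ?A) * (1 / ?m + mu a / 2 * sqrt (C_const a))"
    by (simp add: algebra_simps add_divide_distrib)
  finally show ?thesis unfolding inner_state_self[OF standing p] .
qed

end

section \<open>Classical solutions\<close>

context
  fixes a :: "real \<Rightarrow> real" and S :: "real \<Rightarrow> state \<Rightarrow> state"
  assumes standing: "standing a"
    and csg: "contraction_semigroup a S" and gen: "has_generator_A a S"
begin

lemmas sg = standing csg gen

lemma generates_op_A:
  assumes "p \<in> dom_A a"
  shows "generates a S p (op_A a p)"
  using generates_iff[OF sg, of p "op_A a p"] assms eq_state_refl[OF standing]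
    op_A_state_space[OF standing assms] dom_A_subset_state_space by blast

text \<open>The quotient \<open>(\<langle>S\<^sub>h p, p\<rangle> - \<langle>p, p\<rangle>)/h\<close> is nonpositive for a contraction.\<close>

lemma op_A_dissipative:
  assumes p: "p \<in> dom_A a"
  shows "inner_state a (op_A a p) p \<le> 0"
proof -
  let ?q = "op_A a p"
  have pX: "p \<in> state_space a" and qX: "?q \<in> state_space a"
    using p dom_A_subset_state_space op_A_state_space[OF standing p] by auto
  define r where "r = (\<lambda>h. lincomb (1 / h) (S h p) (- 1 / h) p)"
  have r0: "((\<lambda>h. dist_state a (r h) ?q) \<longlongrightarrow> 0) (at_right 0)"
    using generates_op_A[OF p] unfolding generates_def[OF sg] r_def .
  have ev: "\<forall>\<^sub>F h in at_right (0::real). 0 < h" by (simp add: eventually_at_right_less)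
  have e0: "((\<lambda>h. norm_state a p * dist_state a (r h) ?q) \<longlongrightarrow> 0) (at_right 0)"
    using tendsto_mult[OF tendsto_const r0, of "norm_state a p"] by simp
  have "((\<lambda>h. inner_state a (r h) p) \<longlongrightarrow> inner_state a ?q p) (at_right 0)"
  proof (rule LIM_zero_cancel, rule Lim_null_comparison[OF _ e0])
    show "\<forall>\<^sub>F h in at_right 0. norm (inner_state a (r h) p - inner_state a ?q p) \<le> norm_state a p * dist_state a (r h) ?q"
      using ev
    proof eventually_elim
      case (elim h)
      have "r h \<in> state_space a" unfolding r_def
        using lincomb_state_space semigroup_state[OF sg] pX elim by simp
      from bounded_form_diff_le[OF standing bounded_form_inner_state[OF standing] this qX pX pX]
      show ?case using dist_state_refl[OF standing] by (simp add: mult.commute)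
    qed
  qed
  moreover have "\<forall>\<^sub>F h in at_right 0. inner_state a (r h) p \<le> 0"
    using ev
  proof eventually_elim
    case (elim h)
    have Sp: "S h p \<in> state_space a" using semigroup_state[OF sg] pX elim by simp
    have "inner_state a (r h) p = 1 / h * (inner_state a (S h p) p - inner_state a p p)"
      unfolding r_def bounded_form_lincomb(1)[OF standing bounded_form_inner_state[OF standing] Sp pX pX]
      by (simp add: diff_divide_distrib)
    moreover have "inner_state a (S h p) p \<le> inner_state a p p"
    proof -
      have "inner_state a (S h p) p \<le> norm_state a (S h p) * norm_state a p"
        using bounded_form_le_norm[OF standing bounded_form_inner_state[OF standing] Sp pX] by simp
      also have "\<dots> \<le> norm_state a p * norm_state a p"
        using semigroup_norm_le[OF sg, of h p] elim pX norm_state_nonneg[OF standing pX] by (intro mult_right_mono) auto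
      finally show ?thesis using norm_state_square[OF standing pX] by (simp add: power2_eq_square)
    qed
    ultimately show ?case using elim by (simp add: mult_le_0_iff divide_le_0_iff)
  qed
  ultimately show ?thesis by (rule tendsto_upperbound) simp
qed

text \<open>The domain of the generator is a product, so \<open>(u,v)\<close> and \<open>(u,-v)\<close> both belong to it, while the
  integral is odd in \<open>v\<close>; dissipativity therefore holds with equality. This is integration by parts
  with vanishing boundary terms, at the degenerate end point included.\<close>

lemma op_A_skew_adjoint:
  assumes u: "u \<in> H2a a" and v: "v \<in> H1a a"
  shows "(LINT x|leb01. dx (\<lambda>x. a x * dx u x) x * v x + a x * dx v x * dx u x) = 0"
proof -
  let ?f = "dx (\<lambda>x. a x * dx u x)"
  let ?J = "\<lambda>v x. ?f x * v x + a x * dx v x * dx u x"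
  have le: "(LINT x|leb01. ?J v x) \<le> 0" if "v \<in> H1a a" for v
    using op_A_dissipative[of "(u, v)"] u that unfolding dom_A_def op_A_def inner_state_def by simp
  have int: "integrable leb01 (?J v)" if "v \<in> H1a a" for v
    using that u H2a_operator_L2[OF standing u] V1D(1)[OF standing]
    by (intro Bochner_Integration.integrable_add L2_mult_integrable V1_energy_integrable[OF standing])
      (auto simp: H1a_def H2a_def)
  \<comment> \<open>The velocity \<open>-v\<close>, written as a linear combination.\<close>
  let ?n = "\<lambda>x. (-1) * v x + 0 * v x"
  have n: "?n \<in> H1a a" by (rule H1a_lincomb[OF v v])
  have "(LINT x|leb01. ?J ?n x) = (LINT x|leb01. - ?J v x)"
  proof (rule integral_cong_AE)
    have "loc_abs_cont v" using v V1D(2)[OF standing] unfolding H1a_def by auto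
    from dx_lincomb_AE[OF this this, of "-1" 0]
    show "AE x in leb01. ?J ?n x = - ?J v x" by eventually_elim (simp add: algebra_simps)
    show "?J ?n \<in> borel_measurable leb01" using int[OF n] by blast
    show "(\<lambda>x. - ?J v x) \<in> borel_measurable leb01"
      by (intro borel_measurable_uminus borel_measurable_integrable int v)
  qed
  also have "\<dots> = - (LINT x|leb01. ?J v x)" by (rule Bochner_Integration.integral_minus)
  finally show ?thesis using le[OF v] le[OF n] by linarith
qed

lemma op_A_inner_state_zero:
  assumes "p \<in> dom_A a" shows "inner_state a (op_A a p) p = 0"
  using op_A_skew_adjoint[of "fst p" "snd p"] assms unfolding dom_A_def op_A_def inner_state_def by auto

text \<open>An orbit stays in the domain only up to equality of states, so a representative \<open>r\<close> has to be
  chosen at every time.\<close>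

lemma orbit_in_dom_A:
  assumes p: "p \<in> dom_A a" and t: "0 \<le> t"
  obtains r where "r \<in> dom_A a" "eq_state a (S t p) r" "eq_state a (S t (op_A a p)) (op_A a r)"
proof -
  have pX: "p \<in> state_space a" and qX: "op_A a p \<in> state_space a"
    using p dom_A_subset_state_space op_A_state_space[OF standing p] by auto
  have "generates a S (S t p) (S t (op_A a p))"
    by (rule generates_orbit[OF sg pX qX generates_op_A[OF p] t])
  then show thesis
    using that generates_iff[OF sg semigroup_state[OF sg t pX] semigroup_state[OF sg t qX]] by blast
qed

lemma form_orbit_integral_bound:
  assumes b: "bounded_form a K b" and p: "p \<in> dom_A a" and T: "0 \<le> T"
    and le: "\<And>t r. 0 < t \<Longrightarrow> t < T \<Longrightarrow> r \<in> dom_A a \<Longrightarrow> eq_state a (S t p) r \<Longrightarrow>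
      b (op_A a r) r + b r (op_A a r) \<le> \<psi> t"
    and \<psi>: "(\<psi> has_integral I) {0..T}"
  shows "b (S T p) (S T p) - b (S 0 p) (S 0 p) \<le> I"
proof -
  let ?q = "op_A a p"
  have pX: "p \<in> state_space a" and qX: "?q \<in> state_space a"
    using p dom_A_subset_state_space op_A_state_space[OF standing p] by auto
  note pq = generates_op_A[OF p]
  show ?thesis
  proof (rule lipschitz_right_derivative_bound[OF T _ _ form_orbit_right_derivative[OF sg b pX qX pq] _ \<psi>])
    show "\<bar>b (S t p) (S t p) - b (S s p) (S s p)\<bar> \<le> (4 * K * norm_state a p * (norm_state a ?q + 1)) * (t - s)"
      if "0 \<le> s" "s \<le> t" for s t
      by (rule form_orbit_lipschitz[OF sg b pX qX pq that])
    show "0 \<le> 4 * K * norm_state a p * (norm_state a ?q + 1)"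
      using b norm_state_nonneg[OF standing pX] norm_state_nonneg[OF standing qX] unfolding bounded_form_def by simp
    fix t assume t: "0 < t" "t < T"
    obtain r where r: "r \<in> dom_A a" "eq_state a (S t p) r" "eq_state a (S t ?q) (op_A a r)"
      using orbit_in_dom_A[OF p, of t] t by (metis less_imp_le)
    have X: "S t p \<in> state_space a" "S t ?q \<in> state_space a" "r \<in> state_space a" "op_A a r \<in> state_space a"
      using semigroup_state[OF sg] pX qX t subsetD[OF dom_A_subset_state_space r(1)] op_A_state_space[OF standing r(1)]
      by auto
    have "b (S t ?q) (S t p) + b (S t p) (S t ?q) = b (op_A a r) r + b r (op_A a r)"
      using bounded_form_cong[OF standing b r(3,2)] bounded_form_cong[OF standing b r(2,3)] X by simp
    then show "b (S t ?q) (S t p) + b (S t p) (S t ?q) \<le> \<psi> t" using le[OF t r(1,2)] by simp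
  qed
qed

text \<open>The integral bound applies to the inner product and to its negative, both with right derivative
  zero.\<close>

lemma energy_conserved:
  assumes p: "p \<in> dom_A a" and t: "0 \<le> t"
  shows "inner_state a (S t p) (S t p) = inner_state a p p"
proof -
  have pX: "p \<in> state_space a" using p dom_A_subset_state_space by auto
  have z: "((\<lambda>s. 0) has_integral 0) {0..t}" by simp
  note B = bounded_form_inner_state[OF standing]
  have B': "bounded_form a (1/2) (\<lambda>p q. - inner_state a p q)"
    using B unfolding bounded_form_def by (auto simp: algebra_simps)
  have c: "inner_state a r (op_A a r) = 0" "inner_state a (op_A a r) r = 0" if "r \<in> dom_A a" for r
    using op_A_inner_state_zero[OF that] inner_state_commute[OF standing, of r "op_A a r"] by auto
  have "inner_state a (S t p) (S t p) - inner_state a (S 0 p) (S 0 p) \<le> 0"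
    by (rule form_orbit_integral_bound[OF B p t _ z]) (use c in auto)
  moreover have "- inner_state a (S t p) (S t p) - - inner_state a (S 0 p) (S 0 p) \<le> 0"
    by (rule form_orbit_integral_bound[OF B' p t _ z]) (use c in auto)
  moreover have "inner_state a (S 0 p) (S 0 p) = inner_state a p p"
    by (rule bounded_form_cong[OF standing B semigroup_0[OF sg pX] semigroup_0[OF sg pX]])
      (use semigroup_state[OF sg _ pX, of 0] pX in auto)
  ultimately show ?thesis by simp
qed

text \<open>Combine the multiplier inequality for \<open>x u\<^sub>x\<close> with \<open>\<integral> u (a u')' = - \<integral> a u'\<^sup>2\<close>, which is
  skew-adjointness for the velocity \<open>v = u\<close>. The weight \<open>\<mu>/4\<close> is the one that equalises the
  coefficients of \<open>\<integral> v\<^sup>2\<close> and \<open>\<integral> a u'\<^sup>2\<close>: \<open>1/2 - \<mu>/4 = (1 - \<mu>)/2 + \<mu>/4\<close>.\<close>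

lemma multiplier_form_op_A:
  assumes r: "r \<in> dom_A a"
  shows "multiplier_form a (op_A a r) r + multiplier_form a r (op_A a r)
    \<le> 1/2 * (a 1 * (dx (fst r) 1)\<^sup>2) - 1/2 * (1 - mu a / 2) * inner_state a r r"
proof -
  obtain u v where uv: "r = (u, v)" by (cases r)
  have u: "u \<in> H2a a" and v: "v \<in> H1a a" using r unfolding uv dom_A_def by auto
  have u1: "u \<in> H1a a" using u unfolding H2a_def by auto
  have uV: "u \<in> V1 a" and vV: "v \<in> V1 a" "v 1 = 0" using u1 v unfolding H1a_def by auto
  let ?f = "dx (\<lambda>x. a x * dx u x)"
  have f: "?f \<in> L2 {0<..<1}" by (rule H2a_operator_L2[OF standing u])
  have rX: "r \<in> state_space a" using r dom_A_subset_state_space by auto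
  let ?V = "LINT x|leb01. (v x)\<^sup>2" and ?A = "LINT x|leb01. a x * (dx u x)\<^sup>2"
  let ?P1 = "LINT x|leb01. x * dx v x * v x" and ?P2 = "LINT x|leb01. x * dx u x * ?f x"
  let ?P3 = "LINT x|leb01. u x * ?f x"
  have iV: "integrable leb01 (\<lambda>x. (v x)\<^sup>2)" using L2D(2)[OF V1D(1)[OF standing vV(1)]] .
  have iA: "integrable leb01 (\<lambda>x. a x * (dx u x)\<^sup>2)" by (rule V1_energy_integrable_square[OF standing uV])
  have i1: "integrable leb01 (\<lambda>x. x * dx v x * v x)"
    by (rule L2_mult_integrable[OF V1_weighted_L2[OF standing vV(1)] V1D(1)[OF standing vV(1)]])
  have i2: "integrable leb01 (\<lambda>x. x * dx u x * ?f x)"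
    by (rule L2_mult_integrable[OF V1_weighted_L2[OF standing uV] f])
  have i3: "integrable leb01 (\<lambda>x. u x * ?f x)"
    by (rule L2_mult_integrable[OF V1D(1)[OF standing uV] f])
  have "multiplier_form a (op_A a r) r = (LINT x|leb01. x * dx v x * v x + mu a / 4 * (v x)\<^sup>2)"
    unfolding multiplier_form_def op_A_def uv by (simp add: power2_eq_square distrib_right mult.assoc)
  also have "\<dots> = ?P1 + mu a / 4 * ?V" using i1 iV by simp
  finally have Q1: "multiplier_form a (op_A a r) r = ?P1 + mu a / 4 * ?V" .
  have "multiplier_form a r (op_A a r) = (LINT x|leb01. x * dx u x * ?f x + mu a / 4 * (u x * ?f x))"
    unfolding multiplier_form_def op_A_def uv by (simp add: distrib_right mult.assoc)
  also have "\<dots> = ?P2 + mu a / 4 * ?P3" using i2 i3 by simp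
  finally have Q2: "multiplier_form a r (op_A a r) = ?P2 + mu a / 4 * ?P3" .
  have "(LINT x|leb01. ?f x * u x + a x * dx u x * dx u x) = ?P3 + ?A"
    using i3 iA by (simp add: power2_eq_square mult.commute mult.left_commute)
  then have P3: "?P3 = - ?A" using op_A_skew_adjoint[OF u u1] by simp
  have "1/2 * ?V + ?P1 + (1 - mu a) / 2 * ?A + ?P2 \<le> 1/2 * (a 1 * (dx u 1)\<^sup>2)"
    using multiplier_inequality[OF standing u vV] iV iA i1 i2 by simp
  moreover have "1/2 * ?V + ?P1 + (1 - mu a) / 2 * ?A + ?P2
      = (?P1 + mu a / 4 * ?V + (?P2 + mu a / 4 * (- ?A))) + 1/2 * (1 - mu a / 2) * (?V + ?A)"
    by (simp add: field_simps)
  moreover have "inner_state a r r = ?V + ?A" using inner_state_self[OF standing rX] unfolding uv by simp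
  ultimately show ?thesis unfolding Q1 Q2 P3 by (simp add: uv)
qed

text \<open>Integrate the bound for the derivative of the multiplier form over \<open>[0,T]\<close>. Its values at the two
  ends are bounded by the conserved energy, and they account for the terms independent of \<open>T\<close>.\<close>

lemma classical_boundary_observability:
  assumes p: "p \<in> dom_A a" and T: "0 \<le> T"
    and u: "\<And>t. 0 \<le> t \<Longrightarrow> (u t, ut t) \<in> state_space a \<and> eq_state a (u t, ut t) (S t p)"
    and w: "(\<lambda>t. dx (u t) 1) \<in> L2 {0<..<T}"
  shows "((2 - mu a) * T - 4 / min 1 (a 1) - 2 * mu a * sqrt (C_const a)) * (1/2 * inner_state a p p)
    \<le> a 1 * (LINT t|lebesgue_on {0<..<T}. (dx (u t) 1)\<^sup>2)"
proof -
  let ?W = "LINT t|lebesgue_on {0<..<T}. (dx (u t) 1)\<^sup>2"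
  let ?E = "inner_state a p p" and ?\<kappa> = "1 / min 1 (a 1) + mu a / 2 * sqrt (C_const a)"
  let ?\<psi> = "\<lambda>t. 1/2 * a 1 * (dx (u t) 1)\<^sup>2 - 1/2 * (1 - mu a / 2) * ?E"
  note M = bounded_form_multiplier_form[OF standing]
  have pX: "p \<in> state_space a" using p dom_A_subset_state_space by auto
  have "((\<lambda>t. (dx (u t) 1)\<^sup>2) has_integral ?W) {0<..<T}"
    by (rule has_integral_integral_lebesgue_on[OF L2D(2)[OF w]]) simp
  then have "((\<lambda>t. (dx (u t) 1)\<^sup>2) has_integral ?W) {0..T}"
    by (simp add: has_integral_Icc_iff_Ioo)
  moreover have "((\<lambda>t. 1/2 * (1 - mu a / 2) * ?E) has_integral T * (1/2 * (1 - mu a / 2) * ?E)) {0..T}"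
    using has_integral_const_real[of "1/2 * (1 - mu a / 2) * ?E" 0 T] T by simp
  ultimately have \<psi>: "(?\<psi> has_integral 1/2 * a 1 * ?W - T * (1/2 * (1 - mu a / 2) * ?E)) {0..T}"
    by (intro has_integral_diff has_integral_mult_right)
  have main: "multiplier_form a (S T p) (S T p) - multiplier_form a (S 0 p) (S 0 p)
      \<le> 1/2 * a 1 * ?W - T * (1/2 * (1 - mu a / 2) * ?E)"
  proof (rule form_orbit_integral_bound[OF M p T _ \<psi>])
    fix t r assume t: "0 < t" "t < T" and r: "r \<in> dom_A a" and eq: "eq_state a (S t p) r"
    have X: "S t p \<in> state_space a" "r \<in> state_space a" "(u t, ut t) \<in> state_space a"
      using semigroup_state[OF sg _ pX] t subsetD[OF dom_A_subset_state_space r] u by auto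
    have "inner_state a r r = ?E"
      using bounded_form_cong[OF standing bounded_form_inner_state[OF standing] eq eq] X energy_conserved[OF p, of t] t by simp
    moreover have "eq_state a (u t, ut t) r"
      using eq_state_trans[OF standing _ eq, of "(u t, ut t)"] u[of t] t X by simp
    then have "u t x = fst r x" if "0 < x" "x \<le> 1" for x
      using eq_state_fst[OF standing _ X(3,2) that] by simp
    then have "dx (u t) 1 = dx (fst r) 1" by (intro dx_cong) auto
    ultimately show "multiplier_form a (op_A a r) r + multiplier_form a r (op_A a r) \<le> ?\<psi> t"
      using multiplier_form_op_A[OF r] by simp
  qed
  define X where "X = 1/2 * ?E * ?\<kappa>"
  have bnd: "\<bar>multiplier_form a (S t p) (S t p)\<bar> \<le> X" if "0 \<le> t" for t
    using multiplier_form_le_energy[OF standing semigroup_state[OF sg that pX]] energy_conserved[OF p that]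
    unfolding X_def by simp
  have "- (X + X) \<le> multiplier_form a (S T p) (S T p) - multiplier_form a (S 0 p) (S 0 p)"
    using bnd[OF T] bnd[OF order_refl] by (simp add: abs_le_iff)
  also note main
  finally have "- (X + X) \<le> 1/2 * a 1 * ?W - T * (1/2 * (1 - mu a / 2) * ?E)" .
  then have "2 * (T * (1/2 * (1 - mu a / 2) * ?E)) - 4 * X \<le> a 1 * ?W" by simp
  moreover have "((2 - mu a) * T - 4 / min 1 (a 1) - 2 * mu a * sqrt (C_const a)) * (1/2 * ?E)
      = 2 * (T * (1/2 * (1 - mu a / 2) * ?E)) - 4 * X"
  proof -
    have "((2 - m) * T - 4 * i - 2 * m * s) * (1/2 * E) = 2 * (T * (1/2 * (1 - m / 2) * E)) - 4 * (1/2 * E * (i + m / 2 * s))"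
      for m i s E :: real
      by (simp add: field_simps)
    from this[of "mu a" "1 / min 1 (a 1)" "sqrt (C_const a)" ?E] show ?thesis unfolding X_def by simp
  qed
  ultimately show ?thesis by simp
qed

end

section \<open>Passage to mild solutions\<close>

lemma mild_solution_initial_energy:
  assumes st: "standing a" and p: "p \<in> state_space a" and ms: "mild_solution a p u ut"
  shows "energy a u ut 0 = 1/2 * inner_state a p p"
proof -
  obtain S where S: "contraction_semigroup a S" "has_generator_A a S"
    and u: "\<And>t. 0 \<le> t \<Longrightarrow> (u t, ut t) \<in> state_space a \<and> eq_state a (u t, ut t) (S t p)"
    using ms unfolding mild_solution_def by blast
  let ?q = "(u 0, ut 0)"
  have q: "?q \<in> state_space a" "eq_state a ?q (S 0 p)" using u[of 0] by auto
  have S0: "S 0 p \<in> state_space a" by (rule semigroup_state[OF st S _ p]) simp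
  have "eq_state a ?q p" by (rule eq_state_trans[OF st q(2) semigroup_0[OF st S p] q(1) S0 p])
  then have "inner_state a ?q ?q = inner_state a p p"
    using bounded_form_cong[OF st bounded_form_inner_state[OF st]] q(1) p by blast
  moreover have "energy a u ut 0 = 1/2 * inner_state a ?q ?q"
    unfolding energy_def inner_state_def by (simp add: power2_eq_square mult.assoc)
  ultimately show ?thesis by simp
qed

lemma inner_state_tendsto:
  assumes st: "standing a" and p: "p \<in> state_space a" and pn: "\<And>n. pn n \<in> state_space a"
    and lim: "(\<lambda>n. dist_state a (pn n) p) \<longlonglongrightarrow> 0"
  shows "(\<lambda>n. inner_state a (pn n) (pn n)) \<longlonglongrightarrow> inner_state a p p"
proof -
  have "(\<lambda>n. norm_state a (pn n)) \<longlonglongrightarrow> norm_state a p"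
  proof (rule LIM_zero_cancel, rule Lim_null_comparison[OF _ lim], intro always_eventually allI)
    fix n
    show "norm (norm_state a (pn n) - norm_state a p) \<le> dist_state a (pn n) p"
      using norm_state_le_dist[OF st pn p, of n] norm_state_le_dist[OF st p pn, of n] dist_state_commute[OF st pn p, of n]
      by simp
  qed
  then have "(\<lambda>n. (norm_state a (pn n))\<^sup>2) \<longlonglongrightarrow> (norm_state a p)\<^sup>2" by (rule tendsto_power)
  then show ?thesis using norm_state_square[OF st p] norm_state_square[OF st pn] by simp
qed

text \<open>Young's inequality with a weight close to \<open>1\<close> in front of the limit, so that no constant is lost
  when the traces converge.\<close>

lemma L2_square_integral_le:
  assumes f: "f \<in> L2 S" and g: "g \<in> L2 S" and \<eta>: "0 < \<eta>"
  shows "(LINT t|lebesgue_on S. (f t)\<^sup>2)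
    \<le> (1 + \<eta>) * (LINT t|lebesgue_on S. (g t)\<^sup>2) + (1 + 1 / \<eta>) * (LINT t|lebesgue_on S. (f t - g t)\<^sup>2)"
proof -
  have d: "(\<lambda>t. f t - g t) \<in> L2 S" using L2_lincomb[OF f g, of 1 "-1"] by simp
  have "(LINT t|lebesgue_on S. (f t)\<^sup>2) \<le> (LINT t|lebesgue_on S. (1 + \<eta>) * (g t)\<^sup>2 + (1 + 1 / \<eta>) * (f t - g t)\<^sup>2)"
  proof (rule integral_mono)
    fix t
    have "0 \<le> (\<eta> * g t - (f t - g t))\<^sup>2 / \<eta>" using \<eta> by simp
    also have "\<dots> = (1 + \<eta>) * (g t)\<^sup>2 + (1 + 1 / \<eta>) * (f t - g t)\<^sup>2 - (f t)\<^sup>2"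
      using \<eta> by (simp add: power2_eq_square field_simps)
    finally show "(f t)\<^sup>2 \<le> (1 + \<eta>) * (g t)\<^sup>2 + (1 + 1 / \<eta>) * (f t - g t)\<^sup>2" by simp
  qed (use L2D(2)[OF f] L2D(2)[OF g] L2D(2)[OF d] in auto)
  then show ?thesis using L2D(2)[OF g] L2D(2)[OF d] by simp
qed

theorem theorem3p4:
  fixes a u0 u1 ux1 :: "real \<Rightarrow> real"
    and u ut :: "real \<Rightarrow> real \<Rightarrow> real"
    and T :: real
  assumes "standing a"
    and "(u0, u1) \<in> state_space a"
    and "mild_solution a (u0, u1) u ut"
    and "T \<ge> 0"
    and "boundary_trace a T (u0, u1) ux1"
  shows "a 1 * (LINT t|lebesgue_on {0<..<T}. (ux1 t)\<^sup>2)
      \<ge> ((2 - mu a) * T - 4 / min 1 (a 1) - 2 * mu a * sqrt (C_const a)) * energy a u ut 0"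
proof -
  note st = assms(1)
  let ?p = "(u0, u1)" and ?L = "lebesgue_on {0<..<T}"
  let ?c = "(2 - mu a) * T - 4 / min 1 (a 1) - 2 * mu a * sqrt (C_const a)"
  have a1: "0 < a 1" using coeff_pos[OF st] by simp
  \<comment> \<open>Each approximating solution comes with a semigroup of its own, so the classical estimate is
    applied to every \<open>n\<close> separately.\<close>
  obtain pn un utn where w: "ux1 \<in> L2 {0<..<T}"
    and pn: "\<And>n::nat. pn n \<in> dom_A a" and ms: "\<And>n. mild_solution a (pn n) (un n) (utn n)"
    and wn: "\<And>n. (\<lambda>t. dx (un n t) 1) \<in> L2 {0<..<T}"
    and lim: "(\<lambda>n. dist_state a (pn n) ?p) \<longlonglongrightarrow> 0"
    and wlim: "(\<lambda>n. LINT t|?L. (dx (un n t) 1 - ux1 t)\<^sup>2) \<longlonglongrightarrow> 0"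
    using assms(5) unfolding boundary_trace_def by blast
  let ?W = "LINT t|?L. (ux1 t)\<^sup>2" and ?D = "\<lambda>n. LINT t|?L. (dx (un n t) 1 - ux1 t)\<^sup>2"
  have pnX: "pn n \<in> state_space a" for n using pn dom_A_subset_state_space by blast
  have classical: "?c * (1/2 * inner_state a (pn n) (pn n)) \<le> a 1 * (LINT t|?L. (dx (un n t) 1)\<^sup>2)" for n
  proof -
    obtain S where S: "contraction_semigroup a S" "has_generator_A a S"
      and u: "\<And>t. 0 \<le> t \<Longrightarrow> (un n t, utn n t) \<in> state_space a \<and> eq_state a (un n t, utn n t) (S t (pn n))"
      using ms[of n] unfolding mild_solution_def by blast
    show ?thesis by (rule classical_boundary_observability[OF st S pn assms(4) u wn])
  qed
  have "?c * (1/2 * inner_state a ?p ?p) \<le> a 1 * ((1 + \<eta>) * ?W)" if \<eta>: "0 < \<eta>" for \<eta>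
  proof (rule LIMSEQ_le)
    show "(\<lambda>n. ?c * (1/2 * inner_state a (pn n) (pn n))) \<longlonglongrightarrow> ?c * (1/2 * inner_state a ?p ?p)"
      by (intro tendsto_intros inner_state_tendsto[OF st assms(2) pnX lim])
    have "(\<lambda>n. a 1 * ((1 + \<eta>) * ?W + (1 + 1 / \<eta>) * ?D n)) \<longlonglongrightarrow> a 1 * ((1 + \<eta>) * ?W + (1 + 1 / \<eta>) * 0)"
      by (intro tendsto_intros wlim)
    then show "(\<lambda>n. a 1 * ((1 + \<eta>) * ?W + (1 + 1 / \<eta>) * ?D n)) \<longlonglongrightarrow> a 1 * ((1 + \<eta>) * ?W)" by simp
    have "?c * (1/2 * inner_state a (pn n) (pn n)) \<le> a 1 * ((1 + \<eta>) * ?W + (1 + 1 / \<eta>) * ?D n)" for n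
      using classical[of n] mult_left_mono[OF L2_square_integral_le[OF wn w \<eta>, of n], of "a 1"] a1 by linarith
    then show "\<exists>N. \<forall>n\<ge>N. ?c * (1/2 * inner_state a (pn n) (pn n)) \<le> a 1 * ((1 + \<eta>) * ?W + (1 + 1 / \<eta>) * ?D n)" by blast
  qed
  note eta = this
  have "((\<lambda>\<eta>. a 1 * ((1 + \<eta>) * ?W)) \<longlongrightarrow> a 1 * ((1 + 0) * ?W)) (at_right 0)"
    by (intro tendsto_intros)
  moreover have "\<forall>\<^sub>F \<eta> in at_right 0. ?c * (1/2 * inner_state a ?p ?p) \<le> a 1 * ((1 + \<eta>) * ?W)"
    by (rule eventually_at_rightI[of 0 1]) (use eta in auto)
  ultimately have "?c * (1/2 * inner_state a ?p ?p) \<le> a 1 * ((1 + 0) * ?W)"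
    by (rule tendsto_lowerbound) simp
  then show ?thesis unfolding mild_solution_initial_energy[OF st assms(2,3)] by simp
qed

end
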